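(* Let $p,q\ge3$ be integers with $1/p+1/q>1/2$, and let $N_0$, $\mathcal V$, $\mathbf\Gamma^{\{p,q\}}$, $\sigma_i$ and $\mathcal M_{\{p,q\}}$ be as in the context. Let $\mathcal G_{\{p,q\}}$ be an undirected connected graph on $\mathcal V$ for which every $\sigma_i$ is a graph automorphism, and let $h(\theta)=\exp(2\cos\theta)$. Consider the closed-loop system $$\dot\Gamma_i=\widehat{\Gamma}_i\sum_{j\in\mathcal{N}_i}h(\theta_{ij})\,\widehat{\Gamma}_i\Gamma_j,\qquad \Gamma_i\in\mathcal S^2,\ i\in\mathcal V,$$ and the induced system $\dot\xi_s=\hat f_s(\xi_s)$ on $\xi_s=(\xi_{ij})_{1\le i<j\le N_0}\in\mathbb{R}^{N_0(N_0-1)/2}$, $\xi_{ij}=\Gamma_i^T\Gamma_j$, given componentwise by $$\dot\xi_{ij}=\sum_{k\in\mathcal N_j}e^{2\xi_{jk}}\big(\xi_{ij}\xi_{jk}-\xi_{ik}\big)+\sum_{k\in\mathcal N_i}e^{2\xi_{ik}}\big(\xi_{ij}\xi_{ik}-\xi_{jk}\big)$$ (with $\xi_{ji}=\xi_{ij}$, $\xi_{ii}=1$). Let $\xi_s^*$ be the value of $\xi_s$ at any configuration of $\mathcal M_{\{p,q\}}$ and $\hat A=\frac{\partial\hat f_s}{\partial\xi_s}(\xi_s^* )$. Let $C_1,\dots,C_m$ be 4-element subsets of $\mathcal V$ and $G(\xi_s)=[g_{C_1}(\xi_s),\dots,g_{C_m}(\xi_s)]^T$. Suppose (a) $\frac{\partial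 G}{\partial\xi_s}(\xi_s^* )$ has full row rank, and (b) $T_1\hat AT_1^T$ is Hurwitz, where the rows of $T_1$ form an orthonormal basis of the maximal $\hat A$-invariant subspace contained in $\mathbf V=\{\xi_s:\frac{\partial G}{\partial\xi_s}(\xi_s^* )\xi_s=0\}$. Then the formation $\mathcal M_{\{p,q\}}$ is exponentially stable, in the sense that there is a neighbourhood $B$ of $\xi_s^*$ such that for every solution $(\Gamma_i(t))$ of the closed-loop system whose initial relative coordinates $\xi_s(0)$ lie in $B$, there exist $\alpha,\beta>0$ with $\|\xi_s(t)-\xi_s^*\|\le\alpha e^{-\beta t}$ for all $t\ge0$.
   Context: $\mathcal{S}^2$ is the unit sphere in $\mathbb{R}^3$; $\widehat{x}$ is the matrix with $\widehat{x}y=x\times y$; $\theta_{ij}=\arccos(\Gamma_i^T\Gamma_j)$; $\mathcal N_i$ is the neighbor set of $i$ in $\mathcal G_{\{p,q\}}$. $N_0=4p/d$, $d=4-(p-2)(q-2)$, $\mathcal V=\{1,\dots,N_0\}$. $\mathbf{\Gamma}^{\{p,q\}}=(\Gamma^{\{p,q\}}_1,\dots,\Gamma^{\{p,q\}}_{N_0})$ enumerates the vertices of a regular polyhedron with Schläfli symbol $\{p,q\}$ inscribed in the unit sphere centered at the origin; $\mathcal{M}_{\{p,q\}}=\{(R\Gamma^{\{p,q\}}_1,\dots,R\Gamma^{\{p,q\}}_{N_0}):R\in\mathcal{SO}(3)\}$. For $i\in\mathcal V$, $\sigma_i$ is the permutation of $\mathcal V$ with $\Gamma^{\{p,q\}}_{\sigma_i(k)}=\exp(\tfrac{2\pi}{q}\widehat{\Gamma}^{\{p,q\}}_i)\Gamma^{\{p,q\}}_k$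 for all $k$. A permutation $\sigma$ is a graph automorphism if $(\sigma(i),\sigma(j))$ is an edge iff $(i,j)$ is. For a 4-element set $C=\{i,j,k,l\}\subset\mathcal V$, $$g_C(\xi_s)=\det\begin{pmatrix}1&\xi_{ij}&\xi_{ik}&\xi_{il}\\ \xi_{ij}&1&\xi_{jk}&\xi_{jl}\\ \xi_{ik}&\xi_{jk}&1&\xi_{kl}\\ \xi_{il}&\xi_{jl}&\xi_{kl}&1\end{pmatrix}.$$ The maximal $\hat A$-invariant subspace contained in $\mathbf V$ is the largest subspace $\mathbf W\subseteq\mathbf V$ with $\hat A\mathbf W\subseteq\mathbf W$. *)

theory Defs
  imports "HOL-Analysis.Analysis" "HOL-Combinatorics.Permutations"
begin

text \<open>hat x is the matrix with (hat x) y = x cross y: its j-th column is x cross e_j.\<close>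
definition hat :: "real^3 \<Rightarrow> real^3^3" where
  "hat x = (\<chi> i j. (cross3 x (axis j 1)) $ i)"

fun matpow :: "real^3^3 \<Rightarrow> nat \<Rightarrow> real^3^3" where
  "matpow A 0 = mat 1"
| "matpow A (Suc n) = A ** matpow A n"

definition mexp :: "real^3^3 \<Rightarrow> real^3^3" where
  "mexp A = (\<Sum>n. (1 / fact n) *\<^sub>R matpow A n)"

text \<open>Number of vertices N0 = 4p/d with d = 4-(p-2)(q-2).\<close>
definition N0 :: "nat \<Rightarrow> nat \<Rightarrow> nat" where
  "N0 p q = 4 * p div (4 - (p - 2) * (q - 2))"

text \<open>Gamma enumerates (on 1..N) the vertices of a regular (convex, Platonic) polyhedron with
  Schlaefli symbol {p,q} inscribed in the unit sphere centred at the origin: the convex hull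
  is a 3-dimensional polytope whose vertices are exactly the Gamma k; all its edges have the
  same length (so all faces, being equilateral polygons inscribed in circles, are congruent
  regular polygons); every 2-dimensional face has exactly p vertices; and exactly q faces meet
  at every vertex.\<close>
definition regular_polyhedron_vertices :: "nat \<Rightarrow> nat \<Rightarrow> nat \<Rightarrow> (nat \<Rightarrow> real^3) \<Rightarrow> bool" where
  "regular_polyhedron_vertices p q N \<Gamma> \<longleftrightarrow>
     inj_on \<Gamma> {1..N} \<and> (\<forall>k\<in>{1..N}. norm (\<Gamma> k) = 1) \<and>
     (let P = convex hull (\<Gamma> ` {1..N}) in
        aff_dim P = 3 \<and>
        {v. v extreme_point_of P} = \<Gamma> ` {1..N} \<and>
        (\<exists>len>0. \<forall>e. e face_of P \<and> aff_dim e = 1 \<longrightarrow>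
              (\<exists>a b. e = closed_segment a b \<and> dist a b = len)) \<and>
        (\<forall>F. F face_of P \<and> aff_dim F = 2 \<longrightarrow> card {v. v extreme_point_of F} = p) \<and>
        (\<forall>v\<in>\<Gamma> ` {1..N}. card {F. F face_of P \<and> aff_dim F = 2 \<and> v \<in> F} = q))"

definition sigma :: "nat \<Rightarrow> nat \<Rightarrow> (nat \<Rightarrow> real^3) \<Rightarrow> nat \<Rightarrow> nat \<Rightarrow> nat" where
  "sigma q N \<Gamma> i k =
     (THE m. m \<in> {1..N} \<and> \<Gamma> m = mexp ((2 * pi / real q) *\<^sub>R hat (\<Gamma> i)) *v \<Gamma> k)"

definition undirected_connected_graph :: "nat set \<Rightarrow> (nat \<Rightarrow> nat \<Rightarrow> bool) \<Rightarrow> bool" where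
  "undirected_connected_graph V E \<longleftrightarrow>
     (\<forall>i j. E i j \<longrightarrow> i \<in> V \<and> j \<in> V) \<and>
     (\<forall>i j. E i j \<longleftrightarrow> E j i) \<and> (\<forall>i. \<not> E i i) \<and>
     (\<forall>i\<in>V. \<forall>j\<in>V. E\<^sup>*\<^sup>* i j)"

definition nbrs :: "(nat \<Rightarrow> nat \<Rightarrow> bool) \<Rightarrow> nat \<Rightarrow> nat set" where
  "nbrs E i = {j. E i j}"

definition graph_automorphism :: "nat set \<Rightarrow> (nat \<Rightarrow> nat \<Rightarrow> bool) \<Rightarrow> (nat \<Rightarrow> nat) \<Rightarrow> bool" where
  "graph_automorphism V E \<sigma> \<longleftrightarrow> (\<forall>i\<in>V. \<forall>j\<in>V. E (\<sigma> i) (\<sigma> j) \<longleftrightarrow> E i j)"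

definition closed_loop_solution :: "nat \<Rightarrow> (nat \<Rightarrow> nat \<Rightarrow> bool) \<Rightarrow> (real \<Rightarrow> nat \<Rightarrow> real^3) \<Rightarrow> bool" where
  "closed_loop_solution N E G \<longleftrightarrow>
     (\<forall>i\<in>{1..N}. \<forall>t\<ge>0. norm (G t i) = 1 \<and>
        ((\<lambda>s. G s i) has_vector_derivative
           (hat (G t i) *v (\<Sum>j\<in>nbrs E i.
               exp (2 * cos (arccos (G t i \<bullet> G t j))) *\<^sub>R (hat (G t i) *v G t j))))
        (at t within {0..}))"

text \<open>xi_s is represented as a function on index pairs, supported on the set of pairs (i,j),
  1 <= i < j <= N.\<close>
definition pairs :: "nat \<Rightarrow> (nat \<times> nat) set" where
  "pairs N = {(i, j). 1 \<le> i \<and> i < j \<and> j \<le> N}"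

definition xi_space :: "nat \<Rightarrow> (nat \<times> nat \<Rightarrow> real) set" where
  "xi_space N = {x. \<forall>a. a \<notin> pairs N \<longrightarrow> x a = 0}"

definition xnorm :: "nat \<Rightarrow> (nat \<times> nat \<Rightarrow> real) \<Rightarrow> real" where
  "xnorm N x = sqrt (\<Sum>a\<in>pairs N. (x a)\<^sup>2)"

definition xi_of :: "nat \<Rightarrow> (nat \<Rightarrow> real^3) \<Rightarrow> nat \<times> nat \<Rightarrow> real" where
  "xi_of N \<Gamma> a = (if a \<in> pairs N then \<Gamma> (fst a) \<bullet> \<Gamma> (snd a) else 0)"

definition xx :: "(nat \<times> nat \<Rightarrow> real) \<Rightarrow> nat \<Rightarrow> nat \<Rightarrow> real" where
  "xx x i j = (if i = j then 1 else if i < j then x (i, j) else x (j, i))"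

definition fs :: "nat \<Rightarrow> (nat \<Rightarrow> nat \<Rightarrow> bool) \<Rightarrow> (nat \<times> nat \<Rightarrow> real) \<Rightarrow> nat \<times> nat \<Rightarrow> real" where
  "fs N E x a = (if a \<in> pairs N then
     (let i = fst a; j = snd a in
       (\<Sum>k\<in>nbrs E j. exp (2 * xx x j k) * (xx x i j * xx x j k - xx x i k)) +
       (\<Sum>k\<in>nbrs E i. exp (2 * xx x i k) * (xx x i j * xx x i k - xx x j k)))
     else 0)"

definition pderiv_xi :: "((nat \<times> nat \<Rightarrow> real) \<Rightarrow> real) \<Rightarrow> (nat \<times> nat \<Rightarrow> real) \<Rightarrow> nat \<times> nat \<Rightarrow> real" where
  "pderiv_xi F x0 b = deriv (\<lambda>y. F (x0(b := y))) (x0 b)"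

definition jacobian_fs :: "nat \<Rightarrow> (nat \<Rightarrow> nat \<Rightarrow> bool) \<Rightarrow> (nat \<times> nat \<Rightarrow> real) \<Rightarrow> nat \<times> nat \<Rightarrow> nat \<times> nat \<Rightarrow> real" where
  "jacobian_fs N E x0 a b = pderiv_xi (\<lambda>x. fs N E x a) x0 b"

definition mat_app :: "nat \<Rightarrow> (nat \<times> nat \<Rightarrow> nat \<times> nat \<Rightarrow> real) \<Rightarrow> (nat \<times> nat \<Rightarrow> real) \<Rightarrow> nat \<times> nat \<Rightarrow> real" where
  "mat_app N A x a = (if a \<in> pairs N then (\<Sum>b\<in>pairs N. A a b * x b) else 0)"

definition det4 :: "(nat \<Rightarrow> nat \<Rightarrow> real) \<Rightarrow> real" where
  "det4 M = (\<Sum>\<pi> | \<pi> permutes {0..<4::nat}. of_int (sign \<pi>) * (\<Prod>r\<in>{0..<4}. M r (\<pi> r)))"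

definition gC :: "nat set \<Rightarrow> (nat \<times> nat \<Rightarrow> real) \<Rightarrow> real" where
  "gC C x = (let cs = sorted_list_of_set C in det4 (\<lambda>r s. xx x (cs ! r) (cs ! s)))"

definition lin_subspace :: "nat \<Rightarrow> (nat \<times> nat \<Rightarrow> real) set \<Rightarrow> bool" where
  "lin_subspace N W \<longleftrightarrow> W \<subseteq> xi_space N \<and> (\<lambda>_. 0) \<in> W \<and>
     (\<forall>x\<in>W. \<forall>y\<in>W. (\<lambda>a. x a + y a) \<in> W) \<and> (\<forall>c. \<forall>x\<in>W. (\<lambda>a. c * x a) \<in> W)"

definition max_invariant_subspace ::
  "nat \<Rightarrow> (nat \<times> nat \<Rightarrow> nat \<times> nat \<Rightarrow> real) \<Rightarrow> (nat \<times> nat \<Rightarrow> real) set \<Rightarrow> (nat \<times> nat \<Rightarrow> real) set \<Rightarrow> bool" where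
  "max_invariant_subspace N A Vs W \<longleftrightarrow>
     lin_subspace N W \<and> W \<subseteq> Vs \<and> mat_app N A ` W \<subseteq> W \<and>
     (\<forall>W'. lin_subspace N W' \<and> W' \<subseteq> Vs \<and> mat_app N A ` W' \<subseteq> W' \<longrightarrow> W' \<subseteq> W)"

definition orthonormal_basis_rows ::
  "nat \<Rightarrow> nat \<Rightarrow> (nat \<Rightarrow> nat \<times> nat \<Rightarrow> real) \<Rightarrow> (nat \<times> nat \<Rightarrow> real) set \<Rightarrow> bool" where
  "orthonormal_basis_rows N d T W \<longleftrightarrow>
     (\<forall>r<d. T r \<in> W) \<and>
     (\<forall>r<d. \<forall>s<d. (\<Sum>a\<in>pairs N. T r a * T s a) = (if r = s then 1 else 0)) \<and>
     (\<forall>w\<in>W. \<exists>c. \<forall>a\<in>pairs N. w a = (\<Sum>r<d. c r * T r a))"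

definition hurwitz :: "nat \<Rightarrow> (nat \<Rightarrow> nat \<Rightarrow> real) \<Rightarrow> bool" where
  "hurwitz d K \<longleftrightarrow>
     (\<forall>ev::complex. (\<exists>v::nat \<Rightarrow> complex. (\<exists>r<d. v r \<noteq> 0) \<and>
          (\<forall>r<d. (\<Sum>s<d. complex_of_real (K r s) * v s) = ev * v r)) \<longrightarrow> Re ev < 0)"

definition sandwich :: "nat \<Rightarrow> (nat \<Rightarrow> nat \<times> nat \<Rightarrow> real) \<Rightarrow> (nat \<times> nat \<Rightarrow> nat \<times> nat \<Rightarrow> real) \<Rightarrow> nat \<Rightarrow> nat \<Rightarrow> real" where
  "sandwich N T A r s = (\<Sum>a\<in>pairs N. \<Sum>b\<in>pairs N. T r a * A a b * T s b)"

end

theory Submission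
  imports Defs "Jordan_Normal_Form.Schur_Decomposition"
begin

text \<open>The vector field vanishes at the formation: the faces of an inscribed polyhedron with equal edges are
  regular polygons, hence so are its vertex figures, so the rotations about the vertices permute the vertex set, and
  a weighted sum over the neighbours of \<open>i\<close> is fixed by the rotation about \<open>\<Gamma> i\<close>.
  The relative coordinates of a configuration form a Gram matrix of rank at most 3. Near \<open>\<xi>*\<close> such
  matrices deviate from \<open>\<xi>*\<close>, up to a quadratic error, by the first variation of the Gram matrix along a tangential
  variation of the vertices. These first variations form an \<open>A\<close>-invariant subspace on which the derivatives
  of all Gram determinants vanish, so they lie in the maximal invariant subspace \<open>W\<close>. Hence the component of
  the error transversal to \<open>W\<close> is slaved quadratically to the component in \<open>W\<close>, which obeys a
  Hurwitz linear system up to a quadratic perturbation; a quadratic Lyapunov function then yields exponential decay.\<close>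

text \<open>Condition (b) controls \<open>A\<close> on \<open>W\<close> only, and nothing is known
  about the other directions of \<open>xi_space\<close>. No stability theorem therefore applies to
  the induced system as an equation on all of \<open>xi_space\<close>. Every estimate is made at
  points that come from actual configurations, and the transversal component is never integrated: it
  is bounded algebraically at each instant. The first variation used for this bound is written down
  explicitly from Gram entries and a dual basis, so no configuration close to
  \<open>\<Gamma>\<close> has to be reconstructed and the ambiguity by a common rotation never
  shows. On the geometric side, \<open>regular_polyhedron_vertices\<close> speaks of equal edges and
  of the counts \<open>p\<close> and \<open>q\<close> but grants no symmetry, whereas
  \<open>sigma\<close> denotes the intended permutation only if the rotations preserve the vertex
  set. The tool for deriving this is the principle that a linear functional with a local maximum
  along the edges at a vertex has a global one. It yields the faces at a vertex as well as
  connectedness along edges.\<close>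

no_notation Matrix.vec_index (infixl "$" 100)
no_notation Matrix.scalar_prod (infix "\<bullet>" 70)

section \<open>Regular polygons inscribed in a circle\<close>

lemma unit_circle_angle:
  fixes x y :: complex
  assumes "norm x = 1" "norm y = 1"
  obtains t where "0 \<le> t" "t < 2*pi" "y = x * cis t"
proof -
  have "x \<noteq> 0" using assms by auto
  have "y / x = of_real (norm (y/x)) * exp (\<i> * of_real (Arg2pi (y/x)))"
    using Arg2pi[of "y/x"] unfolding is_Arg_def by blast
  then have "y / x = cis (Arg2pi (y/x))"
    using assms by (simp add: norm_divide cis_conv_exp)
  then have "y = x * cis (Arg2pi (y/x))" using \<open>x \<noteq> 0\<close> by (simp add: field_simps)
  then show ?thesis using that Arg2pi_ge_0 Arg2pi_lt_2pi by blast
qed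

lemma cis_inj_2pi:
  assumes "0 \<le> s" "s < 2*pi" "0 \<le> t" "t < 2*pi" "cis s = cis t"
  shows "s = t"
proof -
  have "Arg2pi (cis u) = u" if "0 \<le> u" "u < 2*pi" for u
    by (rule Arg2pi_unique[of 1]) (use that in \<open>simp_all add: cis_conv_exp\<close>)
  from this[of s] this[of t] show ?thesis using assms by metis
qed

text \<open>The left side is the signed area of the chord and \<open>y - x\<close> for
  \<open>y = x * cis s\<close>, positive when \<open>y\<close> lies to the left of the chord. In the
  product form the sign can be read off: for \<open>g\<close> and \<open>s\<close> strictly between
  \<open>0\<close> and \<open>2*pi\<close> it is the sign of \<open>s - g\<close>.\<close>

lemma Im_chord_cis:
  fixes x :: complex
  assumes "norm x = 1"
  shows "Im (cnj (x * cis g - x) * (x * cis s - x)) = 4 * sin (g/2) * sin (s/2) * sin ((s - g)/2)"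
proof -
  have "cnj (x * cis g - x) * (x * cis s - x) = (x * cnj x) * ((cis (-g) - 1) * (cis s - 1))"
    by (simp add: algebra_simps cis_cnj)
  also have "x * cnj x = 1" using assms by (simp add: complex_norm_square[symmetric])
  finally have "Im (cnj (x * cis g - x) * (x * cis s - x)) = Im ((cis (-g) - 1) * (cis s - 1))" by simp
  also have "\<dots> = sin (s - g) - sin s + sin g" by (simp add: sin_diff algebra_simps)
  also have "\<dots> = 4 * sin (g/2) * sin (s/2) * sin ((s - g)/2)"
  proof -
    have "sin (2*b - 2*a) - sin (2*b) + sin (2*a) = 4 * sin a * sin b * sin (b - a)" for a b :: real
      unfolding sin_diff sin_double cos_double_sin by (simp add: algebra_simps power2_eq_square)
    from this[of "s/2" "g/2"] show ?thesis by (simp add: diff_divide_distrib)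
  qed
  finally show ?thesis .
qed

lemma dist_chord_cis:
  fixes x :: complex
  assumes "norm x = 1" "0 \<le> g" "g \<le> 2*pi"
  shows "dist x (x * cis g) = 2 * sin (g/2)"
proof -
  have "dist x (x * cis g) = norm (x * (1 - cis g))" by (simp add: dist_norm algebra_simps)
  also have "\<dots> = norm (1 - cis g)" using assms by (simp add: norm_mult)
  also have "\<dots> = sqrt ((1 - cos g)^2 + (sin g)^2)" by (simp add: cmod_def)
  also have "(1 - cos g)^2 + (sin g)^2 = 2 - 2 * cos g"
    using sin_cos_squared_add[of g] by (simp add: power2_eq_square algebra_simps)
  also have "\<dots> = (2 * sin (g/2))^2" using cos_double_sin[of "g/2"] by (simp add: power2_eq_square)
  also have "sqrt \<dots> = 2 * sin (g/2)" using assms by (simp add: sin_ge_zero real_sqrt_mult)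
  finally show ?thesis .
qed

text \<open>The hypothesis on chords only concerns pairs of cyclically consecutive points. The common gap
  then has no further point inside it, hence divides the full angle.\<close>
lemma regular_polygon_unit_circle:
  fixes X :: "complex set"
  assumes fin: "finite X" and card3: "3 \<le> card X" and unit: "\<And>x. x \<in> X \<Longrightarrow> norm x = 1"
    and chord: "\<And>x x'. x \<in> X \<Longrightarrow> x' \<in> X \<Longrightarrow> x \<noteq> x' \<Longrightarrow>
      (\<And>y. y \<in> X \<Longrightarrow> y \<noteq> x \<Longrightarrow> y \<noteq> x' \<Longrightarrow> Im (cnj (x' - x) * (y - x)) > 0) \<Longrightarrow> dist x x' = l"
  shows "x \<in> X \<Longrightarrow> X = (\<lambda>j. x * cis (2*pi*real j / real (card X))) ` {..<card X}"
    and "l = 2 * sin (pi / real (card X))"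
    and "x \<in> X \<Longrightarrow> y \<in> X \<Longrightarrow> y \<noteq> x \<Longrightarrow> y \<noteq> x * cis (2*pi / real (card X)) \<Longrightarrow>
      Im (cnj (x * cis (2*pi / real (card X)) - x) * (y - x)) > 0"
proof -
  \<comment> \<open>\<open>gap x g\<close> says that the next point after \<open>x\<close> in the
    counter-clockwise sense is at angle \<open>g\<close>.\<close>
  define gap where "gap x g \<longleftrightarrow> 0 < g \<and> g < 2*pi \<and> x * cis g \<in> X \<and> (\<forall>t. 0 < t \<and> t < g \<longrightarrow> x * cis t \<notin> X)" for x g
  have ex_gap: "\<exists>g. gap x g" if xX: "x \<in> X" for x
  proof -
    define A where "A = {t. 0 < t \<and> t < 2*pi \<and> x * cis t \<in> X}"
    have x0: "x \<noteq> 0" using unit[OF that] by auto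
    have "inj_on (\<lambda>t. x * cis t) A" using x0 by (auto intro!: inj_onI cis_inj_2pi simp: A_def)
    moreover have "(\<lambda>t. x * cis t) ` A \<subseteq> X" by (auto simp: A_def)
    ultimately have finA: "finite A" using fin finite_imageD finite_subset by blast
    have "\<exists>y\<in>X. y \<noteq> x"
    proof (rule ccontr)
      assume "\<not> (\<exists>y\<in>X. y \<noteq> x)"
      then have "card X \<le> card {x}" by (intro card_mono) auto
      then show False using card3 by simp
    qed
    then obtain y where y: "y \<in> X" "y \<noteq> x" by auto
    obtain t where t: "0 \<le> t" "t < 2*pi" "y = x * cis t"
      by (rule unit_circle_angle[OF unit[OF xX] unit[OF y(1)]])
    have "t \<noteq> 0" using t y by auto
    then have "A \<noteq> {}" using t y by (auto simp: A_def intro!: exI[of _ t])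
    then have "Min A \<in> A" using finA by simp
    moreover have "x * cis t \<notin> X" if "0 < t" "t < Min A" for t
    proof
      assume "x * cis t \<in> X"
      then have "t \<in> A" using that \<open>Min A \<in> A\<close> by (auto simp: A_def)
      then show False using that finA by (meson Min_le not_less)
    qed
    ultimately show ?thesis unfolding gap_def A_def by blast
  qed
  have gap_pos: "Im (cnj (x * cis g - x) * (y - x)) > 0"
    if g: "x \<in> X" "gap x g" and y: "y \<in> X" "y \<noteq> x" "y \<noteq> x * cis g" for x y g
  proof -
    have n: "norm x = 1" using unit g by auto
    obtain s where s: "0 \<le> s" "s < 2*pi" "y = x * cis s" by (rule unit_circle_angle[OF n unit[OF y(1)]])
    have "s \<noteq> 0" using s y by auto
    moreover have "s \<noteq> g" using s y by auto
    moreover have "\<not> s < g" using s y(1) g \<open>s \<noteq> 0\<close> unfolding gap_def by auto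
    ultimately have "g < s" by auto
    then show ?thesis
      unfolding s Im_chord_cis[OF n] using g s
      by (intro mult_pos_pos sin_gt_zero) (auto simp: gap_def)
  qed
  have gap_l: "l = 2 * sin (g/2)" if "x \<in> X" "gap x g" for x g
  proof -
    have g: "0 < g" "g < 2*pi" "x * cis g \<in> X" using that by (auto simp: gap_def)
    have n: "norm x = 1" using unit that by auto
    have "x \<noteq> x * cis g" using cis_inj_2pi[of 0 g] g n by auto
    then have "dist x (x * cis g) = l" using gap_pos[OF that] that g by (intro chord) auto
    then show ?thesis using dist_chord_cis[OF n, of g] g by simp
  qed
  \<comment> \<open>The chord length determines \<open>g\<close> only up to
    \<open>g \<mapsto> 2*pi - g\<close>. A gap beyond \<open>pi\<close> is excluded by a third
    point: the following gap \<open>g1\<close> then fits strictly into the remaining angle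
    \<open>2*pi - g < pi\<close>, so its chord would be shorter.\<close>
  have gap_pi: "g \<le> pi" if "x \<in> X" "gap x g" for x g
  proof (rule ccontr)
    assume "\<not> g \<le> pi"
    have g: "0 < g" "g < 2*pi" "x * cis g \<in> X" using that by (auto simp: gap_def)
    have n: "norm x = 1" using unit that by auto
    have "\<not> X \<subseteq> {x, x * cis g}"
    proof
      assume "X \<subseteq> {x, x * cis g}"
      then have "card X \<le> card {x, x * cis g}" by (intro card_mono) auto
      also have "\<dots> \<le> 2" by (simp add: card_insert_if)
      finally show False using card3 by simp
    qed
    then obtain y where y: "y \<in> X" "y \<noteq> x" "y \<noteq> x * cis g" by auto
    obtain s where s: "0 \<le> s" "s < 2*pi" "y = x * cis s"
      by (rule unit_circle_angle[OF n unit[OF y(1)]])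
    have "s \<noteq> 0" using s y by auto
    moreover have "s \<noteq> g" using s y by auto
    moreover have "\<not> s < g" using s that y \<open>s \<noteq> 0\<close> unfolding gap_def by auto
    ultimately have gs: "g < s" by auto
    obtain g1 where g1: "gap (x * cis g) g1" using ex_gap g by blast
    have "x * cis g * cis (s - g) \<in> X" using y s by (simp add: cis_mult mult.assoc)
    then have "\<not> s - g < g1" using g1 gs unfolding gap_def by auto
    then have "g1 \<le> s - g" by simp
    then have "g1 / 2 < pi - g/2" using s by simp
    moreover have "0 < g1" using g1 by (auto simp: gap_def)
    ultimately have "sin (g1/2) < sin (pi - g/2)"
      using \<open>\<not> g \<le> pi\<close> by (intro sin_monotone_2pi) auto
    then show False using gap_l[OF that] gap_l[OF g(3) g1] by simp
  qed
  obtain x0 where x0: "x0 \<in> X" using card3 by fastforce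
  then obtain p where p: "gap x0 p" using ex_gap by blast
  have p0: "0 < p" using p by (auto simp: gap_def)
  have gap_p: "gap x p" if xX: "x \<in> X" for x
  proof -
    obtain g where g: "gap x g" using ex_gap xX by blast
    have sn: "sin (g/2) = sin (p/2)" using gap_l[OF xX g] gap_l[OF x0 p] by simp
    have "0 < g" using g by (auto simp: gap_def)
    then have "- (pi/2) \<le> g/2" "g/2 \<le> pi/2" "- (pi/2) \<le> p/2" "p/2 \<le> pi/2"
      using gap_pi[OF xX g] gap_pi[OF x0 p] p0 pi_gt_zero by linarith+
    then have "g/2 = p/2" using sn by (rule sin_inj_pi)
    then show ?thesis using g by simp
  qed
  have step: "x * cis (real j * p) \<in> X" if "x \<in> X" for x j
  proof (induction j)
    case (Suc j)
    then have "x * cis (real j * p) * cis p \<in> X" using gap_p by (auto simp: gap_def)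
    then show ?case by (simp add: cis_mult mult.assoc algebra_simps)
  qed (use that in simp)
  \<comment> \<open>Division of \<open>s\<close> by \<open>p\<close> with remainder: a nonzero
    remainder would place a point of \<open>X\<close> inside an open gap. For the full turn this
    yields \<open>2*pi = real K * p\<close>.\<close>
  have all: "s = real (nat \<lfloor>s/p\<rfloor>) * p" if "x \<in> X" "0 \<le> s" "x * cis s \<in> X" for x s
  proof -
    define j where "j = nat \<lfloor>s/p\<rfloor>"
    have "real j \<le> s/p" "s/p < real j + 1" using that p0 unfolding j_def by (auto simp: of_nat_floor)
    then have j: "real j * p \<le> s" "s < real j * p + p" using p0 by (auto simp: field_simps)
    have in_X: "x * cis (real j * p) * cis (s - real j * p) \<in> X" using that by (simp add: cis_mult mult.assoc)
    have "\<not> (0 < s - real j * p)"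
    proof
      assume "0 < s - real j * p"
      moreover have "s - real j * p < p" using j(2) by simp
      ultimately show False using in_X gap_p[OF step[OF that(1)], of j] unfolding gap_def by blast
    qed
    then show ?thesis using j unfolding j_def by auto
  qed
  define K where "K = nat \<lfloor>2*pi/p\<rfloor>"
  have K: "2*pi = real K * p" unfolding K_def by (rule all[OF x0]) (use x0 in simp_all)
  have K0: "K > 0" 
  proof (rule gr0I)
    assume "K = 0"
    then have "real K * p = 0" by simp
    then show False using K pi_gt_zero by linarith
  qed
  have pK: "p = 2*pi/real K" using K K0 by (simp add: field_simps)
  have X: "X = (\<lambda>j. x * cis (real j * p)) ` {..<K}" if xX: "x \<in> X" for x
  proof
    show "X \<subseteq> (\<lambda>j. x * cis (real j * p)) ` {..<K}"
    proof
      fix y assume y: "y \<in> X"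
      obtain s where s: "0 \<le> s" "s < 2*pi" "y = x * cis s"
        by (rule unit_circle_angle[OF unit[OF xX] unit[OF y]])
      have "s = real (nat \<lfloor>s/p\<rfloor>) * p" using all[of x s] that y s by simp
      moreover have "nat \<lfloor>s/p\<rfloor> < K"
      proof -
        have "real (nat \<lfloor>s/p\<rfloor>) * p < real K * p" using calculation s(2) unfolding K by linarith
        then show ?thesis using p0 by simp
      qed
      ultimately show "y \<in> (\<lambda>j. x * cis (real j * p)) ` {..<K}"
        using s(3) by (intro image_eqI[of _ _ "nat \<lfloor>s/p\<rfloor>"]) simp_all
    qed
  qed (use step[OF that] in auto)
  have "inj_on (\<lambda>j. x0 * cis (real j * p)) {..<K}"
  proof (rule inj_onI)
    fix i j assume ij: "i \<in> {..<K}" "j \<in> {..<K}" "x0 * cis (real i * p) = x0 * cis (real j * p)"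
    have "x0 \<noteq> 0" using unit[OF x0] by auto
    then have "cis (real i * p) = cis (real j * p)" using ij by simp
    moreover have "real k * p < 2*pi" if "k < K" for k unfolding K using that p0 by simp
    ultimately have "real i * p = real j * p" using ij(1,2) p0
      by (intro cis_inj_2pi) simp_all
    then show "i = j" using p0 by simp
  qed
  then have cX: "card X = K" using X[OF x0] by (metis card_image card_lessThan)
  show "X = (\<lambda>j. x * cis (2*pi*real j / real (card X))) ` {..<card X}" if "x \<in> X"
  proof -
    have "real j * p = 2*pi*real j / real K" for j unfolding pK by simp
    then have "(\<lambda>j. x * cis (real j * p)) = (\<lambda>j. x * cis (2*pi*real j / real K))" by simp
    with X[OF that] show ?thesis unfolding cX by (rule subst[rotated])
  qed
  show "l = 2 * sin (pi / real (card X))"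
    using gap_l[OF x0 p] unfolding cX pK by simp
  show "x \<in> X \<Longrightarrow> y \<in> X \<Longrightarrow> y \<noteq> x \<Longrightarrow> y \<noteq> x * cis (2*pi / real (card X)) \<Longrightarrow>
      Im (cnj (x * cis (2*pi / real (card X)) - x) * (y - x)) > 0"
    using gap_pos[OF _ gap_p] unfolding cX pK by blast
qed

section \<open>Rotations about an axis and circles around it\<close>

text \<open>Rodrigues' formula. For a unit vector \<open>e\<close> this is the rotation about
  \<open>e\<close> by the angle \<open>t\<close>, with the component along \<open>e\<close>
  kept.\<close>

definition axis_rot :: "real^3 \<Rightarrow> real \<Rightarrow> real^3 \<Rightarrow> real^3" where
  "axis_rot e t x = (x \<bullet> e) *\<^sub>R e + cos t *\<^sub>R (x - (x \<bullet> e) *\<^sub>R e) + sin t *\<^sub>R cross3 e x"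

lemma cross3_add_scaleR:
  "cross3 x (y + z) = cross3 x y + cross3 x z" "cross3 x (y - z) = cross3 x y - cross3 x z"
  "cross3 x (c *\<^sub>R y) = c *\<^sub>R cross3 x y" "cross3 (c *\<^sub>R x) y = c *\<^sub>R cross3 x y"
  by (simp_all add: cross3_def Finite_Cartesian_Product.vec_eq_iff forall_3 algebra_simps)

lemma inner_cross3_self [simp]:
  "x \<bullet> cross3 x y = 0" "y \<bullet> cross3 x y = 0" "cross3 x y \<bullet> x = 0" "cross3 x y \<bullet> y = 0"
  by (simp_all add: dot_cross_self inner_commute)

lemma cross3_twice: "cross3 e (cross3 e x) = (e \<bullet> x) *\<^sub>R e - (e \<bullet> e) *\<^sub>R x"
  using Lagrange[of e e x] by simp

lemma linear_axis_rot: "linear (axis_rot e t)"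
  by (rule linearI) (simp_all add: axis_rot_def cross3_add_scaleR algebra_simps)

lemma axis_rot_axis: "norm e = 1 \<Longrightarrow> axis_rot e t e = e"
  by (simp add: axis_rot_def norm_eq_1)

lemma axis_rot_add:
  assumes "norm e = 1"
  shows "axis_rot e s (axis_rot e t x) = axis_rot e (s + t) x"
proof -
  have ee: "e \<bullet> e = 1" using assms by (simp add: norm_eq_1)
  show ?thesis
    unfolding axis_rot_def
    by (simp add: cross3_add_scaleR cross3_twice ee inner_add_left inner_diff_left inner_commute[of e x]
        cos_add sin_add algebra_simps)
qed

lemma axis_rot_0 [simp]: "axis_rot e 0 x = x"
  by (simp add: axis_rot_def)

lemma inner_axis_rot_axis: "norm e = 1 \<Longrightarrow> axis_rot e t x \<bullet> e = x \<bullet> e"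
  by (simp add: axis_rot_def norm_eq_1 inner_add_left inner_diff_left)

lemma norm_axis_rot:
  assumes "norm e = 1"
  shows "norm (axis_rot e t x) = norm x"
proof -
  have ee: "e \<bullet> e = 1" using assms by (simp add: norm_eq_1)
  define u where "u = x - (x \<bullet> e) *\<^sub>R e"
  have ue: "u \<bullet> e = 0" "e \<bullet> u = 0" by (simp_all add: u_def inner_diff_left inner_diff_right ee inner_commute)
  have xe: "cross3 e x = cross3 e u" unfolding u_def by (simp add: cross3_add_scaleR)
  have cc: "cross3 e u \<bullet> cross3 e u = u \<bullet> u"
    using norm_cross_dot[of e u] assms ue by (simp add: dot_square_norm)
  have "axis_rot e t x = (x \<bullet> e) *\<^sub>R e + (cos t *\<^sub>R u + sin t *\<^sub>R cross3 e u)"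
    by (simp add: axis_rot_def u_def xe[unfolded u_def])
  then have "axis_rot e t x \<bullet> axis_rot e t x
      = (x \<bullet> e)^2 + ((cos t)^2 * (u \<bullet> u) + (sin t)^2 * (u \<bullet> u))"
    by (simp add: inner_add_left inner_add_right ee ue cc power2_eq_square inner_commute)
  also have "\<dots> = (x \<bullet> e)^2 + ((sin t)^2 + (cos t)^2) * (u \<bullet> u)" by (simp only: algebra_simps)
  also have "\<dots> = (x \<bullet> e)^2 + u \<bullet> u" by simp
  also have "\<dots> = x \<bullet> x"
    by (simp add: u_def inner_diff_left inner_diff_right ee inner_commute power2_eq_square)
  finally show ?thesis by (simp add: norm_eq)
qed

lemma inner_axis_rot:
  assumes "norm e = 1"
  shows "axis_rot e t x \<bullet> axis_rot e t y = x \<bullet> y"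
proof -
  have "orthogonal_transformation (axis_rot e t)"
    by (simp add: orthogonal_transformation linear_axis_rot norm_axis_rot assms)
  then show ?thesis by (simp add: orthogonal_transformation_def)
qed

text \<open>The residual \<open>w\<close> is orthogonal to all three frame vectors. By Lagrange's
  identity its cross product with \<open>cross3 e a\<close> vanishes as well, and a vector both
  orthogonal and parallel to a unit vector is zero.\<close>

lemma orthonormal_expansion_cross3:
  fixes e a :: "real^3"
  assumes "norm e = 1" "norm a = 1" "e \<bullet> a = 0"
  shows "x = (x \<bullet> e) *\<^sub>R e + (x \<bullet> a) *\<^sub>R a + (x \<bullet> cross3 e a) *\<^sub>R cross3 e a"
proof -
  define b where "b = cross3 e a"
  have bb: "b \<bullet> b = 1" using norm_cross_dot[of e a] assms by (simp add: b_def dot_square_norm)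
  have [simp]: "e \<bullet> e = 1" "a \<bullet> a = 1" using assms by (simp_all add: norm_eq_1)
  have [simp]: "e \<bullet> b = 0" "a \<bullet> b = 0" "b \<bullet> e = 0" "b \<bullet> a = 0" "a \<bullet> e = 0" 
    using assms by (simp_all add: b_def inner_commute)
  define w where "w = x - (x \<bullet> e) *\<^sub>R e - (x \<bullet> a) *\<^sub>R a - (x \<bullet> b) *\<^sub>R b"
  have w: "w \<bullet> e = 0" "w \<bullet> a = 0" "w \<bullet> b = 0"
    using assms(3) bb by (simp_all add: w_def inner_diff_left)
  have "cross3 w b = 0" unfolding b_def Lagrange using w by simp
  then have "(norm w * norm b)^2 = 0" using norm_cross_dot[of w b] w by simp
  then have "w = 0" using bb by auto
  then show ?thesis by (simp add: w_def b_def algebra_simps)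
qed

text \<open>\<open>\<psi>\<close> identifies the unit circle of the complex plane with the circle of
  radius \<open>r\<close> in the plane \<open>x \<bullet> e = h\<close>, turning multiplication by
  \<open>cis t\<close> into rotation about \<open>e\<close>. The map \<open>c\<close> turns the
  planar side-of-a-chord test into a linear functional on space; the minus sign makes points to the
  left of the chord take smaller values.\<close>

definition circle_chart :: "real^3 \<Rightarrow> real \<Rightarrow> real \<Rightarrow> (complex \<Rightarrow> real^3) \<Rightarrow> (complex \<Rightarrow> real^3) \<Rightarrow> bool" where
  "circle_chart e h r \<psi> c \<longleftrightarrow>
    (\<forall>x. x \<bullet> e = h \<longrightarrow> norm (x - h *\<^sub>R e) = r \<longrightarrow> (\<exists>z. norm z = 1 \<and> x = \<psi> z)) \<and>
    (\<forall>z w. dist (\<psi> z) (\<psi> w) = r * dist z w) \<and>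
    (\<forall>z t. axis_rot e t (\<psi> z) = \<psi> (z * cis t)) \<and>
    (\<forall>d z. c d \<bullet> \<psi> z = - Im (cnj d * z))"

lemma circle_chartD:
  assumes "circle_chart e h r \<psi> c"
  shows "\<And>x. x \<bullet> e = h \<Longrightarrow> norm (x - h *\<^sub>R e) = r \<Longrightarrow> \<exists>z. norm z = 1 \<and> x = \<psi> z"
    and "\<And>z w. dist (\<psi> z) (\<psi> w) = r * dist z w"
    and "\<And>z t. axis_rot e t (\<psi> z) = \<psi> (z * cis t)"
    and "\<And>d z. c d \<bullet> \<psi> z = - Im (cnj d * z)"
  using assms unfolding circle_chart_def by blast+

lemma circle_parametrization:
  fixes e x0 :: "real^3"
  assumes e: "norm e = 1" and x0: "x0 \<bullet> e = h" "norm (x0 - h *\<^sub>R e) = r" and r: "r > 0"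
  shows "\<exists>\<psi> c. circle_chart e h r \<psi> c"
proof -
  define a where "a = (1/r) *\<^sub>R (x0 - h *\<^sub>R e)"
  define b where "b = cross3 e a"
  have na: "norm a = 1" using x0 r by (simp add: a_def)
  have ee [simp]: "e \<bullet> e = 1" "a \<bullet> a = 1" using e na by (simp_all add: norm_eq_1)
  have ea: "a \<bullet> e = 0" "e \<bullet> a = 0" using x0 by (simp_all add: a_def inner_diff_left inner_diff_right inner_commute)
  have bb [simp]: "b \<bullet> b = 1" using norm_cross_dot[of e a] e na ea by (simp add: b_def dot_square_norm)
  have [simp]: "e \<bullet> b = 0" "a \<bullet> b = 0" "b \<bullet> e = 0" "b \<bullet> a = 0" by (simp_all add: b_def)
  note ea [simp]
  have eb: "cross3 e b = - a" unfolding b_def cross3_twice by simp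
  define \<psi> where "\<psi> z = h *\<^sub>R e + (r * Re z) *\<^sub>R a + (r * Im z) *\<^sub>R b" for z
  \<comment> \<open>In the frame \<open>a\<close>, \<open>b\<close> this is the number
    \<open>- \<i> * d / r\<close>: the chord direction turned clockwise by a right angle, and
    rescaled to compensate the factor \<open>r\<close> in \<open>\<psi>\<close>.\<close>
  define c where "c d = (Im d / r) *\<^sub>R a - (Re d / r) *\<^sub>R b" for d
  have exp: "x = (x \<bullet> e) *\<^sub>R e + (x \<bullet> a) *\<^sub>R a + (x \<bullet> b) *\<^sub>R b" for x
    unfolding b_def by (rule orthonormal_expansion_cross3) (use e na in auto)
  have "\<exists>z. norm z = 1 \<and> x = \<psi> z" if x: "x \<bullet> e = h" "norm (x - h *\<^sub>R e) = r" for x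
  proof (intro exI conjI)
    define z where "z = Complex ((x \<bullet> a)/r) ((x \<bullet> b)/r)"
    show xz: "x = \<psi> z" using exp[of x] x r by (simp add: \<psi>_def z_def)
    have "x - h *\<^sub>R e = (r * Re z) *\<^sub>R a + (r * Im z) *\<^sub>R b" unfolding xz by (simp add: \<psi>_def)
    then have "r^2 = (norm ((r * Re z) *\<^sub>R a + (r * Im z) *\<^sub>R b))^2" using x by simp
    also have "\<dots> = r^2 * ((Re z)^2 + (Im z)^2)"
      unfolding power2_norm_eq_inner by (simp add: inner_add_left inner_add_right power2_eq_square algebra_simps)
    finally have "(Re z)^2 + (Im z)^2 = 1" using r by simp
    then show "norm z = 1" by (simp add: cmod_def)
  qed
  moreover have "dist (\<psi> z) (\<psi> w) = r * dist z w" for z w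
  proof -
    have eq: "\<psi> z - \<psi> w = (r * (Re z - Re w)) *\<^sub>R a + (r * (Im z - Im w)) *\<^sub>R b"
      by (simp add: \<psi>_def algebra_simps)
    have "(norm (\<psi> z - \<psi> w))^2 = r^2 * ((Re z - Re w)^2 + (Im z - Im w)^2)"
      unfolding eq power2_norm_eq_inner by (simp add: inner_add_left inner_add_right power2_eq_square algebra_simps)
    also have "\<dots> = (r * norm (z - w))^2" by (simp add: cmod_power2 power_mult_distrib)
    finally show ?thesis using r by (simp add: dist_norm)
  qed
  moreover have "axis_rot e t (\<psi> z) = \<psi> (z * cis t)" for z t
  proof -
    have cr: "cross3 e (\<psi> z) = (r * Re z) *\<^sub>R b - (r * Im z) *\<^sub>R a"
      unfolding \<psi>_def by (simp add: cross3_add_scaleR eb b_def[symmetric])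
    have ip: "\<psi> z \<bullet> e = h" by (simp add: \<psi>_def inner_add_left)
    show ?thesis
      unfolding axis_rot_def cr ip by (simp add: \<psi>_def algebra_simps)
  qed
  moreover have "c d \<bullet> \<psi> z = - Im (cnj d * z)" for d z
    using r by (simp add: c_def \<psi>_def inner_add_right inner_diff_left algebra_simps)
  ultimately show ?thesis unfolding circle_chart_def by blast
qed

lemma dist_axis_rot:
  assumes "norm e = 1" "x \<bullet> e = h" "norm (x - h *\<^sub>R e) = r" "0 \<le> t" "t \<le> 2*pi"
  shows "dist x (axis_rot e t x) = 2 * r * sin (t/2)"
proof (cases "r = 0")
  case True
  then have "x = h *\<^sub>R e" using assms by simp
  then have "axis_rot e t x = x"
    using axis_rot_axis[OF assms(1), of t] linear_scale[OF linear_axis_rot, of e t h e] by simp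
  then show ?thesis using True by simp
next
  case False
  then have r: "r > 0" using assms(3) norm_ge_zero[of "x - h *\<^sub>R e"] by linarith
  obtain \<psi> c where chart: "circle_chart e h r \<psi> c" using circle_parametrization[OF assms(1-3) r] by blast
  note p = circle_chartD[OF chart]
  obtain z where z: "norm z = 1" "x = \<psi> z" using p(1)[OF assms(2,3)] by blast
  show ?thesis unfolding z(2) p(3) p(2) using dist_chord_cis[OF z(1) assms(4,5)] by simp
qed

text \<open>A circle around \<open>x\<close> meets the given circle in at most two points, since
  \<open>sin (s/2)\<close> determines \<open>s\<close> in \<open>[0, 2*pi)\<close> up to
  \<open>s \<mapsto> 2*pi - s\<close>.\<close>

lemma axis_rot_chord_cases:
  assumes "norm e = 1" "x \<bullet> e = h" "norm (x - h *\<^sub>R e) = r" "y \<bullet> e = h" "norm (y - h *\<^sub>R e) = r" "r > 0"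
    and "0 \<le> t" "t \<le> pi" "dist x y = 2 * r * sin (t/2)"
  shows "y = axis_rot e t x \<or> y = axis_rot e (-t) x"
proof -
  obtain \<psi> c where chart: "circle_chart e h r \<psi> c" using circle_parametrization[OF assms(1-3) assms(6)] by blast
  note p = circle_chartD[OF chart]
  obtain z where z: "norm z = 1" "x = \<psi> z" using p(1)[OF assms(2,3)] by blast
  obtain w where w: "norm w = 1" "y = \<psi> w" using p(1)[OF assms(4,5)] by blast
  obtain s where s: "0 \<le> s" "s < 2*pi" "w = z * cis s" by (rule unit_circle_angle[OF z(1) w(1)])
  have "r * (2 * sin (s/2)) = r * (2 * sin (t/2))"
    using assms(9) dist_chord_cis[OF z(1), of s] s by (simp add: z(2) w(2) p(2))
  then have sn: "sin (s/2) = sin (t/2)" using assms(6) by simp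
  show ?thesis
  proof (cases "s \<le> pi")
    case True
    have "- (pi/2) \<le> s/2" "s/2 \<le> pi/2" "- (pi/2) \<le> t/2" "t/2 \<le> pi/2"
      using True s assms(7,8) pi_gt_zero by linarith+
    then have "s/2 = t/2" using sn by (rule sin_inj_pi)
    then have "s = t" by simp
    then show ?thesis unfolding z(2) w(2) s(3) p(3) by simp
  next
    case False
    have sn': "sin (pi - s/2) = sin (t/2)" using sn by simp
    have "- (pi/2) \<le> pi - s/2" "pi - s/2 \<le> pi/2" "- (pi/2) \<le> t/2" "t/2 \<le> pi/2"
      using False s assms(7,8) pi_gt_zero by linarith+
    then have "pi - s/2 = t/2" using sn' by (rule sin_inj_pi)
    then have "s = 2*pi - t" by (simp add: field_simps)
    then have "cis s = cis (-t)" by (simp only: complex_eq_iff cis.sel cos_2pi_minus sin_2pi_minus cos_minus sin_minus)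
    then show ?thesis unfolding z(2) w(2) s(3) p(3) by simp
  qed
qed

text \<open>The planar result transported by a chart. Consecutive points are described by a
  functional \<open>c\<close> whose maximum over \<open>X\<close> is attained exactly at the two of
  them, because such functionals are what cuts edges and faces out of a polytope. The last
  conclusion hands such a functional back.\<close>

lemma regular_polygon_circle:
  fixes X :: "(real^3) set"
  assumes e: "norm e = 1" and fin: "finite X" and card3: "3 \<le> card X"
    and circ: "\<And>x. x \<in> X \<Longrightarrow> x \<bullet> e = h" "\<And>x. x \<in> X \<Longrightarrow> norm (x - h *\<^sub>R e) = r"
    and chord: "\<And>x x' c. x \<in> X \<Longrightarrow> x' \<in> X \<Longrightarrow> x \<noteq> x' \<Longrightarrow> c \<bullet> x' = c \<bullet> x \<Longrightarrow>
      (\<And>y. y \<in> X \<Longrightarrow> y \<noteq> x \<Longrightarrow> y \<noteq> x' \<Longrightarrow> c \<bullet> y < c \<bullet> x) \<Longrightarrow> dist x x' = l"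
  shows "r > 0" and "x \<in> X \<Longrightarrow> X = (\<lambda>j. axis_rot e (2*pi*real j / real (card X)) x) ` {..<card X}"
    and "l = 2 * r * sin (pi / real (card X))"
    and "x \<in> X \<Longrightarrow> \<exists>c. c \<bullet> axis_rot e (2*pi / real (card X)) x = c \<bullet> x \<and>
      (\<forall>y\<in>X. y \<noteq> x \<longrightarrow> y \<noteq> axis_rot e (2*pi / real (card X)) x \<longrightarrow> c \<bullet> y < c \<bullet> x)"
proof -
  obtain x0 where x0: "x0 \<in> X" using card3 by fastforce
  show r: "r > 0"
  proof (rule ccontr)
    assume "\<not> r > 0"
    then have "r = 0" using circ(2)[OF x0] norm_ge_zero[of "x0 - h *\<^sub>R e"] by linarith
    then have "X \<subseteq> {h *\<^sub>R e}" using circ(2) by auto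
    then have "card X \<le> card {h *\<^sub>R e}" by (intro card_mono) auto
    then show False using card3 by simp
  qed
  obtain \<psi> c where chart: "circle_chart e h r \<psi> c" using circle_parametrization[OF e circ[OF x0] r] by blast
  note p = circle_chartD[OF chart]
  have inj: "inj \<psi>"
  proof (rule injI)
    fix z w assume "\<psi> z = \<psi> w"
    then have "r * dist z w = 0" using p(2)[of z w] by simp
    then show "z = w" using r by simp
  qed
  define Z where "Z = {z. norm z = 1 \<and> \<psi> z \<in> X}"
  have XZ: "X = \<psi> ` Z" using p(1) circ unfolding Z_def by blast
  have cZ: "card X = card Z" unfolding XZ by (rule card_image) (use inj in \<open>auto intro: inj_on_subset\<close>)
  have finZ: "finite Z" using fin unfolding XZ by (rule finite_imageD) (use inj in \<open>auto intro: inj_on_subset\<close>)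
  have chordZ: "dist z z' = l / r" if zz: "z \<in> Z" "z' \<in> Z" "z \<noteq> z'"
    and pos: "\<And>y. y \<in> Z \<Longrightarrow> y \<noteq> z \<Longrightarrow> y \<noteq> z' \<Longrightarrow> Im (cnj (z' - z) * (y - z)) > 0" for z z'
  proof -
    have "dist (\<psi> z) (\<psi> z') = l"
    proof (rule chord[of _ _ "c (z' - z)"])
      show "\<psi> z \<in> X" "\<psi> z' \<in> X" using zz by (auto simp: Z_def)
      show "\<psi> z \<noteq> \<psi> z'" using zz inj by (auto dest: injD)
      show "c (z' - z) \<bullet> \<psi> z' = c (z' - z) \<bullet> \<psi> z" unfolding p(4) by (simp add: algebra_simps)
      fix y assume y: "y \<in> X" "y \<noteq> \<psi> z" "y \<noteq> \<psi> z'"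
      then obtain w where w: "w \<in> Z" "y = \<psi> w" using XZ by auto
      have "Im (cnj (z' - z) * (w - z)) > 0" using w y by (intro pos) auto
      then show "c (z' - z) \<bullet> y < c (z' - z) \<bullet> \<psi> z" unfolding w p(4) by (simp add: algebra_simps)
    qed
    then show ?thesis using p(2)[of z z'] r by (simp add: field_simps)
  qed
  have unitZ: "\<And>z. z \<in> Z \<Longrightarrow> norm z = 1" by (simp add: Z_def)
  have card3Z: "3 \<le> card Z" using card3 cZ by simp
  have "l / r = 2 * sin (pi / real (card Z))"
    by (rule regular_polygon_unit_circle(2)[OF finZ card3Z unitZ chordZ])
  then show "l = 2 * r * sin (pi / real (card X))" using r unfolding cZ by (simp add: field_simps)
  have orbit: "Z = (\<lambda>j. z * cis (2*pi*real j / real (card Z))) ` {..<card Z}" if "z \<in> Z" for z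
    by (rule regular_polygon_unit_circle(1)[OF finZ card3Z unitZ chordZ that])
  have next_pos: "Im (cnj (z * cis (2*pi / real (card Z)) - z) * (w - z)) > 0"
    if "z \<in> Z" "w \<in> Z" "w \<noteq> z" "w \<noteq> z * cis (2*pi / real (card Z))" for z w
    by (rule regular_polygon_unit_circle(3)[OF finZ card3Z unitZ chordZ that])
  show "\<exists>c. c \<bullet> axis_rot e (2*pi / real (card X)) x = c \<bullet> x \<and>
      (\<forall>y\<in>X. y \<noteq> x \<longrightarrow> y \<noteq> axis_rot e (2*pi / real (card X)) x \<longrightarrow> c \<bullet> y < c \<bullet> x)" if x: "x \<in> X"
  proof -
    obtain z where z: "z \<in> Z" "x = \<psi> z" using x XZ by auto
    define z' where "z' = z * cis (2*pi / real (card Z))"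
    show ?thesis unfolding cZ z(2) p(3) z'_def[symmetric]
    proof (intro exI[of _ "c (z' - z)"] conjI ballI impI)
      show "c (z' - z) \<bullet> \<psi> z' = c (z' - z) \<bullet> \<psi> z" unfolding p(4) by (simp add: algebra_simps)
      fix y assume y: "y \<in> X" "y \<noteq> \<psi> z" "y \<noteq> \<psi> z'"
      then obtain w where w: "w \<in> Z" "y = \<psi> w" using XZ by auto
      have "Im (cnj (z' - z) * (w - z)) > 0"
        unfolding z'_def by (rule next_pos[OF z(1) w(1)]) (use w y in \<open>auto simp: z'_def\<close>)
      then show "c (z' - z) \<bullet> y < c (z' - z) \<bullet> \<psi> z" unfolding w p(4) by (simp add: algebra_simps)
    qed
  qed
  show "X = (\<lambda>j. axis_rot e (2*pi*real j / real (card X)) x) ` {..<card X}" if x: "x \<in> X"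
  proof -
    obtain z where z: "z \<in> Z" "x = \<psi> z" using x XZ by auto
    have "X = \<psi> ` (\<lambda>j. z * cis (2*pi*real j / real (card Z))) ` {..<card Z}"
      by (subst orbit[OF z(1), symmetric]) (rule XZ)
    then show ?thesis unfolding cZ z image_image p(3) .
  qed
qed

section \<open>Edges of polytopes\<close>

text \<open>Among the faces through \<open>v\<close> other than \<open>{v}\<close> take one of least
  dimension. Some facet of it contains \<open>v\<close> and by minimality must be
  \<open>{v}\<close>, so the chosen face has dimension 1.\<close>

lemma polytope_vertex_edge:
  fixes P :: "'a::euclidean_space set"
  assumes P: "polytope P" and v: "v extreme_point_of P" and ne: "P \<noteq> {v}"
  shows "\<exists>n. n \<noteq> v \<and> closed_segment v n face_of P"
proof -
  let ?Q = "\<lambda>M. M face_of P \<and> v \<in> M \<and> M \<noteq> {v}"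
  have convP: "convex P" using P by (rule polytope_imp_convex)
  have vP: "v \<in> P" using v by (simp add: extreme_point_of_def)
  have "?Q P" using convP vP ne by (simp add: face_of_refl)
  then obtain M where M: "?Q M" and least: "\<And>M'. ?Q M' \<Longrightarrow> nat (aff_dim M) \<le> nat (aff_dim M')"
    using ex_has_least_nat[of ?Q P "\<lambda>M. nat (aff_dim M)"] by blast
  have polyM: "polytope M" using P M face_of_polytope_polytope by blast
  have "{v} face_of M" using M v by (simp add: face_of_singleton extreme_point_of_face[of M P])
  then obtain F where F: "F facet_of M" "{v} \<subseteq> F"
    using face_of_polyhedron_subset_facet[OF polytope_imp_polyhedron[OF polyM]] M by (metis insert_not_empty)
  have FP: "F face_of P" using F M by (meson facet_of_imp_face_of face_of_trans)
  have dF: "aff_dim F = aff_dim M - 1" using F by (simp add: facet_of_def)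
  have F0: "0 \<le> aff_dim F" using F by (metis aff_dim_negative_iff empty_iff insert_subset not_le)
  have "F = {v}"
  proof (rule ccontr)
    assume "F \<noteq> {v}"
    then have "?Q F" using FP F by auto
    from least[OF this] show False using dF F0 by linarith
  qed
  then have M1: "aff_dim M = 1" using dF by simp
  have cM: "compact M" "convex M" using polyM by (simp_all add: polytope_imp_compact polytope_imp_convex)
  have "collinear M" using M1 by (simp add: collinear_aff_dim)
  then obtain a b where ab: "M = closed_segment a b"
    using compact_convex_collinear_segment[of M] cM M by blast
  have "v extreme_point_of M" using M v by (simp add: extreme_point_of_face[of M P])
  then have "v = a \<or> v = b" unfolding ab by (simp add: extreme_point_of_segment)
  then obtain n where n: "M = closed_segment v n" using ab by (metis closed_segment_commute)
  then have "n \<noteq> v" using M by auto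
  then show ?thesis using n M by auto
qed

text \<open>If \<open>c\<close> increased somewhere, tilt it by the functional \<open>a\<close> exposing \<open>v\<close> until \<open>v\<close> is just
  optimal; the optimal face then contains an edge at \<open>v\<close> along which \<open>c\<close> increases.\<close>
lemma polytope_local_max_imp_max:
  fixes P :: "'a::euclidean_space set"
  assumes P: "polytope P" and v: "v extreme_point_of P"
    and a: "\<And>x. x \<in> P \<Longrightarrow> x \<noteq> v \<Longrightarrow> a \<bullet> x < a \<bullet> v"
    and c: "\<And>n. n \<noteq> v \<Longrightarrow> closed_segment v n face_of P \<Longrightarrow> c \<bullet> n \<le> c \<bullet> v"
    and x: "x \<in> P"
  shows "c \<bullet> x \<le> c \<bullet> v"
proof (rule ccontr)
  assume x_gt: "\<not> c \<bullet> x \<le> c \<bullet> v"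
  define U where "U = {u. u extreme_point_of P}"
  have cP: "compact P" "convex P" using P by (simp_all add: polytope_imp_compact polytope_imp_convex)
  have hull: "P = convex hull U" unfolding U_def by (rule Krein_Milman_Minkowski[OF cP])
  have finU: "finite U" unfolding U_def
    by (rule finite_polyhedron_extreme_points) (rule polytope_imp_polyhedron[OF P])
  have UP: "U \<subseteq> P" unfolding U_def extreme_point_of_def by auto
  have bound: "w \<bullet> y \<le> w \<bullet> v" if "\<And>u. u \<in> U \<Longrightarrow> w \<bullet> u \<le> w \<bullet> v" "y \<in> P" for w y
  proof -
    have "convex hull U \<subseteq> {y. w \<bullet> y \<le> w \<bullet> v}"
      by (rule hull_minimal) (use that in \<open>auto simp: convex_halfspace_le\<close>)
    then show ?thesis using that hull by auto
  qed
  obtain u1 where u1: "u1 \<in> U" "c \<bullet> u1 > c \<bullet> v" using bound[of c x] x x_gt by (meson not_le)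
  \<comment> \<open>\<open>q u\<close> is the amount of tilt at which \<open>u\<close> and
    \<open>v\<close> become equally good. Its maximum \<open>L\<close> is the least tilt that makes
    \<open>v\<close> optimal, and it is positive because of \<open>u1\<close>.\<close>
  define q where "q u = (c \<bullet> u - c \<bullet> v) / (a \<bullet> v - a \<bullet> u)" for u
  define L where "L = Max (q ` (U - {v}))"
  have u1v: "u1 \<in> U - {v}" using u1 by auto
  have fin: "finite (q ` (U - {v}))" using finU by simp
  have apos: "a \<bullet> v - a \<bullet> u > 0" if "u \<in> U - {v}" for u using a[of u] that UP by auto
  have "q u1 > 0" unfolding q_def using u1 apos[OF u1v] by simp
  moreover have "q u1 \<le> L" unfolding L_def using fin u1v by (intro Max_ge) auto
  ultimately have L: "L > 0" by linarith
  have "L \<in> q ` (U - {v})" unfolding L_def using fin u1v by (intro Max_in) auto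
  then obtain u0 where u0: "u0 \<in> U - {v}" "q u0 = L" by auto
  define g where "g = c + L *\<^sub>R a"
  have "g \<bullet> u \<le> g \<bullet> v" if u: "u \<in> U" for u
  proof (cases "u = v")
    case False
    then have uv: "u \<in> U - {v}" using u by auto
    then have "q u \<le> L" unfolding L_def using fin by (intro Max_ge) auto
    then have "c \<bullet> u - c \<bullet> v \<le> L * (a \<bullet> v - a \<bullet> u)"
      unfolding q_def using apos[OF uv] by (simp add: pos_divide_le_eq)
    then show ?thesis by (simp add: g_def inner_add_left algebra_simps)
  qed simp
  then have gmax: "g \<bullet> y \<le> g \<bullet> v" if "y \<in> P" for y using bound that by blast
  define F where "F = P \<inter> {y. g \<bullet> y = g \<bullet> v}"
  have F: "F face_of P" unfolding F_def by (rule face_of_Int_supporting_hyperplane_le) (use cP gmax in auto)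
  have vF: "v \<in> F" using v by (simp add: F_def extreme_point_of_def)
  have "c \<bullet> u0 - c \<bullet> v = L * (a \<bullet> v - a \<bullet> u0)"
    using u0(2) apos[OF u0(1)] unfolding q_def by (simp add: field_simps)
  then have "u0 \<in> F" using u0 UP by (auto simp: F_def g_def inner_add_left algebra_simps)
  then have "F \<noteq> {v}" using u0 by auto
  moreover have "v extreme_point_of F" using v vF extreme_point_of_face[OF F] by simp
  ultimately obtain n where n: "n \<noteq> v" "closed_segment v n face_of F"
    using polytope_vertex_edge[OF face_of_polytope_polytope[OF P F]] by blast
  have "closed_segment v n face_of P" using n F face_of_trans by blast
  then have "c \<bullet> n \<le> c \<bullet> v" using c n by blast
  moreover have nF: "n \<in> F" using face_of_imp_subset[OF n(2)] by auto
  then have "c \<bullet> n + L * (a \<bullet> n) = c \<bullet> v + L * (a \<bullet> v)" by (simp add: F_def g_def inner_add_left)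
  moreover have "L * (a \<bullet> n) < L * (a \<bullet> v)" using a[of n] nF n L by (auto simp: F_def)
  ultimately show False by linarith
qed

text \<open>Split off the part \<open>z\<close> of \<open>x - v\<close> that is orthogonal to all
  edge directions. As a functional, \<open>z\<close> is constant along the edges at
  \<open>v\<close>, so \<open>v\<close> maximises it globally; but its gain from \<open>v\<close> to
  \<open>x\<close> is \<open>z \<bullet> z\<close>.\<close>

lemma polytope_vertex_edges_span:
  fixes P :: "'a::euclidean_space set"
  assumes P: "polytope P" and v: "v extreme_point_of P"
    and a: "\<And>x. x \<in> P \<Longrightarrow> x \<noteq> v \<Longrightarrow> a \<bullet> x < a \<bullet> v" and x: "x \<in> P"
  shows "x - v \<in> span ((\<lambda>n. n - v) ` {n. n \<noteq> v \<and> closed_segment v n face_of P})"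
proof -
  let ?B = "(\<lambda>n. n - v) ` {n. n \<noteq> v \<and> closed_segment v n face_of P}"
  obtain y z where yz: "y \<in> span ?B" "\<And>w. w \<in> span ?B \<Longrightarrow> Linear_Algebra.orthogonal z w" "x - v = y + z"
    using orthogonal_subspace_decomp_exists[of ?B "x - v"] by blast
  have "z \<bullet> x \<le> z \<bullet> v"
  proof (rule polytope_local_max_imp_max[OF P v a _ x])
    fix n assume "n \<noteq> v" "closed_segment v n face_of P"
    then have "n - v \<in> span ?B" by (intro span_base) auto
    then have "z \<bullet> (n - v) = 0" using yz(2) by (simp add: Linear_Algebra.orthogonal_def)
    then show "z \<bullet> n \<le> z \<bullet> v" by (simp add: inner_diff_right)
  qed
  moreover have "z \<bullet> (x - v) = z \<bullet> z" unfolding yz(3) using yz(1,2) by (simp add: inner_add_right Linear_Algebra.orthogonal_def)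
  ultimately have "z \<bullet> z \<le> 0" by (simp add: inner_diff_right)
  then have "z = 0" by (metis inner_eq_zero_iff inner_ge_zero order_antisym)
  then show ?thesis using yz by simp
qed

text \<open>The edge directions at \<open>v\<close> span all directions of \<open>P\<close>.\<close>

lemma polytope_vertex_degree:
  fixes P :: "'a::euclidean_space set"
  assumes P: "polytope P" and v: "v extreme_point_of P"
    and a: "\<And>x. x \<in> P \<Longrightarrow> x \<noteq> v \<Longrightarrow> a \<bullet> x < a \<bullet> v"
    and N: "N = {n. n \<noteq> v \<and> closed_segment v n face_of P}" and fin: "finite N"
  shows "aff_dim P \<le> int (card N)"
proof -
  have "v \<in> P" using v by (simp add: extreme_point_of_def)
  then have "aff_dim P = int (dim ((+) (- v) ` P))" by (intro aff_dim_eq_dim) (simp add: hull_inc)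
  also have "dim ((+) (- v) ` P) \<le> card ((\<lambda>n. n - v) ` N)"
    by (rule dim_le_card) (use fin polytope_vertex_edges_span[OF P v a] in \<open>auto simp: N\<close>)
  also have "\<dots> \<le> card N" using fin by (rule card_image_le)
  finally show ?thesis by simp
qed

text \<open>On the unit sphere a vertex is its own exposing functional: expand
  \<open>0 < (norm (x - v))^2\<close> and use \<open>norm x \<le> 1\<close>. This supplies the
  functional \<open>a\<close> of the preceding lemmas.\<close>

lemma hull_unit_sphere_exposed:
  fixes v :: "'a::euclidean_space"
  assumes "\<And>u. u \<in> U \<Longrightarrow> norm u = 1" "norm v = 1" "x \<in> convex hull U" "x \<noteq> v"
  shows "v \<bullet> x < v \<bullet> v"
proof -
  have "convex hull U \<subseteq> cball 0 1" by (rule hull_minimal) (use assms in \<open>auto simp: convex_cball\<close>)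
  then have nx: "norm x \<le> 1" using assms by auto
  have "(norm (x - v))^2 > 0" using assms by simp
  moreover have "(norm (x - v))^2 = (norm x)^2 - 2 * (v \<bullet> x) + (norm v)^2"
    by (simp add: power2_norm_eq_inner inner_diff_left inner_diff_right inner_commute)
  moreover have "(norm x)^2 \<le> 1" using nx by (simp add: power_le_one)
  ultimately show ?thesis using assms(2) by (simp add: norm_eq_1)
qed

text \<open>For a vertex \<open>t\<close> take the \<open>s\<close> in \<open>S\<close> nearest to
  it, that is, with \<open>t \<bullet> s\<close> maximal. The neighbours of \<open>s\<close> stay in
  \<open>S\<close>, so no edge at \<open>s\<close> improves the functional \<open>t\<close>; hence
  \<open>s\<close> maximises it globally, and only \<open>t\<close> does.\<close>

lemma sphere_polytope_edge_connected:
  fixes P :: "'a::euclidean_space set"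
  assumes fin: "finite U" and P: "P = convex hull U" and ext: "\<And>u. u \<in> U \<Longrightarrow> u extreme_point_of P"
    and unit: "\<And>u. u \<in> U \<Longrightarrow> norm u = 1"
    and S: "S \<subseteq> U" "S \<noteq> {}" and closed: "\<And>s n. s \<in> S \<Longrightarrow> n \<noteq> s \<Longrightarrow> closed_segment s n face_of P \<Longrightarrow> n \<in> S"
  shows "S = U"
proof
  show "U \<subseteq> S"
  proof
    fix t assume t: "t \<in> U"
    have finS: "finite S" using S fin finite_subset by blast
    define M where "M = Max ((\<lambda>s. t \<bullet> s) ` S)"
    have "M \<in> (\<lambda>s. t \<bullet> s) ` S" unfolding M_def using finS S by (intro Max_in) auto
    then obtain s where s: "s \<in> S" "t \<bullet> s = M" by auto
    have smax: "t \<bullet> s' \<le> t \<bullet> s" if "s' \<in> S" for s' unfolding s(2) M_def using finS that by (intro Max_ge) auto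
    have polyP: "polytope P" using P fin by (simp add: polytope_convex_hull)
    have sU: "s \<in> U" using s S by auto
    have tP: "t \<in> P" using t unfolding P by (simp add: hull_inc)
    have "t \<bullet> t \<le> t \<bullet> s"
    proof (rule polytope_local_max_imp_max[OF polyP ext[OF sU] _ _ tP])
      fix x assume "x \<in> P" "x \<noteq> s"
      then show "s \<bullet> x < s \<bullet> s"
        unfolding P by (intro hull_unit_sphere_exposed[OF unit unit[OF sU]]) auto
    next
      fix n assume "n \<noteq> s" "closed_segment s n face_of P"
      then show "t \<bullet> n \<le> t \<bullet> s" using closed s(1) smax by blast
    qed
    moreover have "t \<bullet> s < t \<bullet> t" if "s \<noteq> t"
      by (rule hull_unit_sphere_exposed[OF unit unit[OF t]]) (use that sU in \<open>auto simp: hull_inc\<close>)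
    ultimately have "s = t" by fastforce
    then show "t \<in> S" using s by simp
  qed
qed (use S in simp)

section \<open>Equilateral polyhedra inscribed in the sphere\<close>

text \<open>A rotation is the square of the rotation by half the angle, so its determinant is the
  square of 1 or -1. Orthogonal maps of determinant 1 respect the cross product.\<close>

lemma axis_rot_cross3:
  assumes "norm e = 1"
  shows "cross3 (axis_rot e t x) (axis_rot e t y) = axis_rot e t (cross3 x y)"
proof -
  have orth: "orthogonal_transformation (axis_rot e s)" for s
    by (simp add: orthogonal_transformation linear_axis_rot norm_axis_rot assms)
  have "axis_rot e t = axis_rot e (t/2) \<circ> axis_rot e (t/2)"
    by (auto simp: axis_rot_add[OF assms])
  then have "matrix (axis_rot e t) = matrix (axis_rot e (t/2)) ** matrix (axis_rot e (t/2))"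
    by (simp add: matrix_compose linear_axis_rot)
  then have "Determinants.det (matrix (axis_rot e t)) = Determinants.det (matrix (axis_rot e (t/2))) * Determinants.det (matrix (axis_rot e (t/2)))"
    by (simp add: det_mul)
  also have "\<dots> = \<bar>Determinants.det (matrix (axis_rot e (t/2)))\<bar>^2" by (simp add: power2_eq_square)
  also have "\<dots> = 1" using orthogonal_transformation_det[OF orth, of "t/2"] by simp
  finally have "Determinants.det (matrix (axis_rot e t)) = 1" .
  then show ?thesis using cross_orthogonal_transformation[OF orth, of t x y] by simp
qed

lemma axis_rot_conjugate:
  assumes "norm e = 1"
  shows "axis_rot e t (axis_rot w s x) = axis_rot (axis_rot e t w) s (axis_rot e t x)"
proof -
  have [simp]: "axis_rot e t (c *\<^sub>R y) = c *\<^sub>R axis_rot e t y" 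
    "axis_rot e t (y + z) = axis_rot e t y + axis_rot e t z"
    "axis_rot e t (y - z) = axis_rot e t y - axis_rot e t z" for c y z
    using linear_axis_rot[of e t] by (simp_all add: linear_scale linear_add linear_diff)
  show ?thesis
    unfolding axis_rot_def[of w] axis_rot_def[of "axis_rot e t w"]
    by (simp add: axis_rot_cross3 assms inner_axis_rot)
qed

text \<open>The content of \<open>regular_polyhedron_vertices\<close> with the enumeration
  forgotten. The goal within the locale is invariance of \<open>V\<close> under the rotation by
  \<open>2*pi / real q\<close> about each vertex.\<close>

locale equilateral_sphere_polytope =
  fixes V :: "(real^3) set" and P :: "(real^3) set" and len :: real and p q :: nat
  assumes fin: "finite V" and P: "P = convex hull V" and ext: "{v. v extreme_point_of P} = V"
    and unit: "\<And>v. v \<in> V \<Longrightarrow> norm v = 1" and dim3: "aff_dim P = 3" and len: "len > 0"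
    and edges: "\<And>e. e face_of P \<Longrightarrow> aff_dim e = 1 \<Longrightarrow> \<exists>a b. e = closed_segment a b \<and> dist a b = len"
    and faces: "\<And>F. F face_of P \<Longrightarrow> aff_dim F = 2 \<Longrightarrow> card {v. v extreme_point_of F} = p"
    and degree: "\<And>v. v \<in> V \<Longrightarrow> card {F. F face_of P \<and> aff_dim F = 2 \<and> v \<in> F} = q"
    and p3: "p \<ge> 3"
begin

definition nbr :: "real^3 \<Rightarrow> (real^3) set" where
  "nbr v = {n. n \<noteq> v \<and> closed_segment v n face_of P}"

lemma polyP: "polytope P" using P fin by (simp add: polytope_convex_hull)

lemma convP: "convex P" using polyP by (rule polytope_imp_convex)

lemma ext_V: "v extreme_point_of P \<longleftrightarrow> v \<in> V" using ext by auto

lemma V_sub_P: "v \<in> V \<Longrightarrow> v \<in> P" unfolding P by (simp add: hull_inc)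

lemma exposed: "v \<in> V \<Longrightarrow> x \<in> P \<Longrightarrow> x \<noteq> v \<Longrightarrow> v \<bullet> x < v \<bullet> v"
  unfolding P by (rule hull_unit_sphere_exposed[OF unit unit]) auto

lemma nbr_V: assumes "n \<in> nbr v" shows "n \<in> V"
  using assms segment_face_of(2)[of v n P] by (simp add: nbr_def ext_V)

lemma nbr_sym: "n \<in> nbr v \<Longrightarrow> v \<in> nbr n"
  by (auto simp: nbr_def closed_segment_commute)

lemma nbr_dist: assumes "n \<in> nbr v" shows "dist v n = len"
proof -
  have n: "n \<noteq> v" "closed_segment v n face_of P" using assms by (auto simp: nbr_def)
  have "aff_dim (closed_segment v n) = 1"
    using n by (simp add: segment_convex_hull aff_dim_convex_hull)
  from edges[OF n(2) this] obtain a b where "closed_segment v n = closed_segment a b" "dist a b = len" by blast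
  then show ?thesis by (auto simp: closed_segment_eq doubleton_eq_iff dist_commute)
qed

lemma finite_nbr: "finite (nbr v)"
  using fin nbr_V by (meson finite_subset subsetI)

lemma face_hull: assumes "G face_of P" shows "G = convex hull {u\<in>V. u \<in> G}"
proof -
  have "polytope G" using polyP assms by (rule face_of_polytope_polytope)
  then have "G = convex hull {u. u extreme_point_of G}"
    by (intro Krein_Milman_Minkowski) (simp_all add: polytope_imp_compact polytope_imp_convex)
  also have "{u. u extreme_point_of G} = {u\<in>V. u \<in> G}" using extreme_point_of_face[OF assms] ext_V by auto
  finally show ?thesis .
qed

text \<open>A face of dimension at most 1 is a segment, and vertices of \<open>P\<close> lying in it
  are extreme points of it, hence end points.\<close>

lemma aff_dim_face_ge_2:
  assumes G: "G face_of P" and abc: "a \<in> V" "b \<in> V" "c \<in> V" "a \<in> G" "b \<in> G" "c \<in> G" "a \<noteq> b" "a \<noteq> c" "b \<noteq> c"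
  shows "aff_dim G \<ge> 2"
proof (rule ccontr)
  assume "\<not> aff_dim G \<ge> 2"
  then have col: "collinear G" by (simp add: collinear_aff_dim)
  have "polytope G" using polyP G by (rule face_of_polytope_polytope)
  then have "compact G" "convex G" by (simp_all add: polytope_imp_compact polytope_imp_convex)
  then obtain x y where xy: "G = closed_segment x y"
    using compact_convex_collinear_segment[of G] col abc(4) by blast
  have "u = x \<or> u = y" if "u \<in> V" "u \<in> G" for u
  proof -
    have "u extreme_point_of G" using extreme_point_of_face[OF G] ext_V that by auto
    then show ?thesis unfolding xy by (simp add: extreme_point_of_segment)
  qed
  from this[OF abc(1,4)] this[OF abc(2,5)] this[OF abc(3,6)] abc(7-9) show False by auto
qed

lemma face_Int_vertices_2:
  assumes G: "G face_of P" and x: "x \<noteq> x'" "{u\<in>V. u \<in> G} = {x, x'}"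
  shows "x' \<in> nbr x"
proof -
  have "G = closed_segment x x'" using face_hull[OF G] x by (simp add: segment_convex_hull)
  then show ?thesis using G x by (auto simp: nbr_def)
qed

text \<open>The plane of \<open>F\<close> cuts the sphere in a circle, on which the vertices of
  \<open>F\<close> form an equilateral, hence regular, polygon with \<open>p\<close> corners. The
  two neighbours of \<open>v\<close> in \<open>F\<close> are its rotations by
  \<open>2*pi / real p\<close> either way, and their distance is the short diagonal. What matters is
  that this length is the same for every face and every vertex.\<close>

lemma face_nbrs:
  assumes F: "F face_of P" "aff_dim F = 2" and v: "v \<in> V" "v \<in> F"
  shows "\<exists>n n'. n \<noteq> n' \<and> nbr v \<inter> F = {n, n'} \<and> dist n n' = 2 * len * cos (pi / real p)"
proof -
  define X where "X = {u\<in>V. u \<in> F}"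
  have extF: "{u. u extreme_point_of F} = X" using extreme_point_of_face[OF F(1)] ext_V by (auto simp: X_def)
  have cX: "card X = p" using faces[OF F] extF by simp
  have finX: "finite X" using fin by (simp add: X_def)
  have "F \<noteq> P" using F dim3 by auto
  moreover have "F exposed_face_of P"
    using F exposed_face_of_polyhedron[OF polytope_imp_polyhedron[OF polyP]] by simp
  ultimately obtain a b where ab: "a \<noteq> 0" "P \<subseteq> {x. a \<bullet> x \<le> b}" "F = P \<inter> {x. a \<bullet> x = b}"
    using v(2) unfolding exposed_face_of by blast
  define e where "e = (1 / norm a) *\<^sub>R a"
  define h where "h = b / norm a"
  have e: "norm e = 1" using ab by (simp add: e_def)
  have Xh: "x \<bullet> e = h" if "x \<in> X" for x
    using that ab by (simp add: X_def e_def h_def inner_commute)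
  define r where "r = sqrt (1 - h^2)"
  have Xr: "norm (x - h *\<^sub>R e) = r" if "x \<in> X" for x
  proof -
    have "norm x = 1" using that unit by (simp add: X_def)
    then have "(norm (x - h *\<^sub>R e))^2 = 1 - h^2"
      unfolding power2_norm_eq_inner using Xh[OF that] e by (simp add: inner_diff_left inner_diff_right norm_eq_1 inner_commute power2_eq_square)
    then show ?thesis unfolding r_def by (metis norm_ge_zero real_sqrt_unique)
  qed
  \<comment> \<open>A functional that is maximal over \<open>X\<close> exactly at \<open>x\<close>
    and \<open>x'\<close> cuts out a face of \<open>F\<close> with these two vertices, which is an
    edge of \<open>P\<close>.\<close>
  have chord: "dist x x' = len" if x: "x \<in> X" "x' \<in> X" "x \<noteq> x'" and c: "c \<bullet> x' = c \<bullet> x"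
      "\<And>y. y \<in> X \<Longrightarrow> y \<noteq> x \<Longrightarrow> y \<noteq> x' \<Longrightarrow> c \<bullet> y < c \<bullet> x" for x x' c
  proof -
    have "X \<subseteq> {y. c \<bullet> y \<le> c \<bullet> x}"
    proof
      fix y assume "y \<in> X"
      then show "y \<in> {y. c \<bullet> y \<le> c \<bullet> x}" using c by (cases "y = x \<or> y = x'") (auto intro: less_imp_le)
    qed
    then have "convex hull X \<subseteq> {y. c \<bullet> y \<le> c \<bullet> x}" by (rule hull_minimal) (rule convex_halfspace_le)
    moreover have "F = convex hull X" using face_hull[OF F(1)] by (simp add: X_def)
    ultimately have le: "c \<bullet> y \<le> c \<bullet> x" if "y \<in> F" for y using that by auto
    have "convex F" using F(1) by (rule face_of_imp_convex)
    then have G: "F \<inter> {y. c \<bullet> y = c \<bullet> x} face_of F" using le by (rule face_of_Int_supporting_hyperplane_le)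
    have "x' \<in> nbr x"
    proof (rule face_Int_vertices_2[OF face_of_trans[OF G F(1)] x(3)])
      show "{u \<in> V. u \<in> F \<inter> {y. c \<bullet> y = c \<bullet> x}} = {x, x'}"
      proof
        show "{u \<in> V. u \<in> F \<inter> {y. c \<bullet> y = c \<bullet> x}} \<subseteq> {x, x'}"
        proof
          fix u assume "u \<in> {u \<in> V. u \<in> F \<inter> {y. c \<bullet> y = c \<bullet> x}}"
          then show "u \<in> {x, x'}" using c(2)[of u] by (auto simp: X_def)
        qed
      qed (use x c(1) in \<open>auto simp: X_def\<close>)
    qed
    then show ?thesis by (rule nbr_dist)
  qed
  have card3X: "3 \<le> card X" using p3 cX by simp
  have r: "r > 0" by (rule regular_polygon_circle(1)[OF e finX card3X Xh Xr chord])
  have len_eq: "len = 2 * r * sin (pi / real p)"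
    using regular_polygon_circle(3)[OF e finX card3X Xh Xr chord] cX by simp
  have vX: "v \<in> X" using v by (simp add: X_def)
  define t where "t = 2 * pi / real p"
  have t: "0 \<le> t" "t \<le> pi" "t/2 = pi / real p" using p3 by (auto simp: t_def field_simps)
  have near: "n = axis_rot e t v \<or> n = axis_rot e (-t) v" if n: "n \<in> nbr v \<inter> F" for n
  proof -
    have nX: "n \<in> X" using n nbr_V by (auto simp: X_def)
    have "dist v n = 2 * r * sin (t/2)" using nbr_dist n len_eq t by simp
    then show ?thesis
      by (rule axis_rot_chord_cases[OF e Xh[OF vX] Xr[OF vX] Xh[OF nX] Xr[OF nX] r t(1,2)])
  qed
  have extv: "v extreme_point_of F" using extreme_point_of_face[OF F(1)] v ext_V by auto
  have "closed_segment v n \<subseteq> F" if "n \<in> F" for n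
    using face_of_imp_convex[OF F(1)] v that by (simp add: closed_segment_subset)
  then have NF: "nbr v \<inter> F = {n. n \<noteq> v \<and> closed_segment v n face_of F}"
    by (auto simp: nbr_def face_of_face[OF F(1)])
  \<comment> \<open>\<open>near\<close> leaves two candidates for the neighbours in
    \<open>F\<close>. Conversely a polygon has at least two edges at each corner, so both candidates
    occur and they are distinct.\<close>
  have "aff_dim F \<le> int (card (nbr v \<inter> F))"
  proof (rule polytope_vertex_degree[OF face_of_polytope_polytope[OF polyP F(1)] extv _ NF])
    show "v \<bullet> x < v \<bullet> v" if "x \<in> F" "x \<noteq> v" for x
      using exposed[OF v(1)] face_of_imp_subset[OF F(1)] that by auto
  qed (simp add: finite_nbr)
  then have c2: "2 \<le> card (nbr v \<inter> F)" using F by simp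
  have sub: "nbr v \<inter> F \<subseteq> {axis_rot e t v, axis_rot e (-t) v}" using near by auto
  have "card {axis_rot e t v, axis_rot e (-t) v} \<le> 2" by (simp add: card_insert_if)
  then have eq: "nbr v \<inter> F = {axis_rot e (-t) v, axis_rot e t v}"
    using card_subset_eq[OF _ sub] card_mono[OF _ sub] c2 by auto
  have ne: "axis_rot e (-t) v \<noteq> axis_rot e t v"
    using c2 unfolding eq by (auto simp: card_insert_if split: if_splits)
  define n where "n = axis_rot e (-t) v"
  have "n \<in> X" using eq nbr_V by (auto simp: n_def X_def)
  then have "dist n (axis_rot e (2*t) n) = 2 * r * sin (2*t/2)"
    by (intro dist_axis_rot[OF e Xh Xr]) (use t in auto)
  also have "axis_rot e (2*t) n = axis_rot e t v" unfolding n_def axis_rot_add[OF e] by simp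
  also have "2 * r * sin (2*t/2) = 2 * len * cos (pi / real p)"
    using sin_double[of "pi / real p"] unfolding len_eq by (simp add: t_def)
  finally show ?thesis using ne eq unfolding n_def by blast
qed

text \<open>By polarisation a fixed edge length fixes the inner product with \<open>v\<close>, and
  Pythagoras gives the distance from the axis.\<close>

lemma nbr_h: 
  assumes v: "v \<in> V" and n: "n \<in> nbr v"
  shows "n \<bullet> v = 1 - len^2/2" "norm (n - (1 - len^2/2) *\<^sub>R v) = sqrt (1 - (1 - len^2/2)^2)"
proof -
  have nn: "norm n = 1" "norm v = 1" using unit v nbr_V[OF n] by auto
  have "len^2 = (norm (v - n))^2" using nbr_dist[OF n] by (simp add: dist_norm)
  also have "\<dots> = 2 - 2 * (n \<bullet> v)"
    unfolding power2_norm_eq_inner using nn by (simp add: inner_diff_left inner_diff_right norm_eq_1 inner_commute)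
  finally have "len^2 = 2 - 2 * (n \<bullet> v)" .
  then show nv: "n \<bullet> v = 1 - len^2/2" by linarith
  define h where "h = 1 - len^2/2"
  have nh: "n \<bullet> v = h" "v \<bullet> n = h" using nv by (simp_all add: h_def inner_commute)
  have "(norm (n - h *\<^sub>R v))^2 = 1 - h^2"
    unfolding power2_norm_eq_inner using nh nn by (simp add: inner_diff_left inner_diff_right norm_eq_1 inner_commute power2_eq_square)
  then show "norm (n - (1 - len^2/2) *\<^sub>R v) = sqrt (1 - (1 - len^2/2)^2)"
    unfolding h_def[symmetric] by (metis norm_ge_zero real_sqrt_unique)
qed

lemma nbr_card3: assumes v: "v \<in> V" shows "3 \<le> card (nbr v)"
proof -
  have "aff_dim P \<le> int (card (nbr v))"
    by (rule polytope_vertex_degree[OF polyP _ exposed[OF v] nbr_def finite_nbr]) (use v ext_V in auto)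
  then show ?thesis using dim3 by simp
qed

text \<open>All neighbours have the same inner product with \<open>v\<close>, so adding a multiple
  of \<open>v\<close> to \<open>c\<close> does not change comparisons among them. The multiple
  \<open>s\<close> is chosen to make the value at \<open>v\<close> equal to that at
  \<open>x\<close>. Then no edge at \<open>v\<close> increases \<open>g\<close>, so \<open>v\<close>
  is optimal, and the optimal face meets \<open>nbr v\<close> in \<open>x\<close> and
  \<open>x'\<close> only. It contains three vertices and misses a neighbour of \<open>v\<close>,
  which leaves dimension 2.\<close>

lemma nbr_support_face:
  assumes v: "v \<in> V" and x: "x \<in> nbr v" "x' \<in> nbr v" "x \<noteq> x'" and c: "c \<bullet> x' = c \<bullet> x"
      "\<And>y. y \<in> nbr v \<Longrightarrow> y \<noteq> x \<Longrightarrow> y \<noteq> x' \<Longrightarrow> c \<bullet> y < c \<bullet> x"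
  shows "\<exists>F. F face_of P \<and> aff_dim F = 2 \<and> v \<in> F \<and> nbr v \<inter> F = {x, x'}"
proof -
  define h where "h = 1 - len^2/2"
  have h1: "1 - h > 0" using len by (simp add: h_def)
  define s where "s = (c \<bullet> x - c \<bullet> v) / (1 - h)"
  define g where "g = c + s *\<^sub>R v"
  have vv: "v \<bullet> v = 1" using unit[OF v] by (simp add: norm_eq_1)
  have gy: "g \<bullet> y - g \<bullet> v = c \<bullet> y - c \<bullet> x" if "y \<in> nbr v" for y
  proof -
    have "v \<bullet> y = h" using nbr_h(1)[OF v that] by (simp add: h_def inner_commute)
    then have "g \<bullet> y - g \<bullet> v = c \<bullet> y - c \<bullet> v - s * (1 - h)"
      by (simp add: g_def inner_add_left vv algebra_simps)
    also have "s * (1 - h) = c \<bullet> x - c \<bullet> v" using h1 by (simp add: s_def)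
    finally show ?thesis by simp
  qed
  have gmax: "g \<bullet> y \<le> g \<bullet> v" if "y \<in> P" for y
  proof (rule polytope_local_max_imp_max[OF polyP _ exposed[OF v] _ that])
    show "v extreme_point_of P" using v ext_V by simp
    fix n assume "n \<noteq> v" "closed_segment v n face_of P"
    then have n: "n \<in> nbr v" by (simp add: nbr_def)
    have "c \<bullet> n \<le> c \<bullet> x" using c n by (cases "n = x \<or> n = x'") (auto intro: less_imp_le)
    then show "g \<bullet> n \<le> g \<bullet> v" using gy[OF n] by simp
  qed
  define F where "F = P \<inter> {y. g \<bullet> y = g \<bullet> v}"
  have F: "F face_of P" unfolding F_def using convP gmax by (rule face_of_Int_supporting_hyperplane_le)
  have inF: "y \<in> F \<longleftrightarrow> c \<bullet> y = c \<bullet> x" if "y \<in> nbr v" for y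
    using gy[OF that] V_sub_P[OF nbr_V[OF that]] by (auto simp: F_def)
  have nF: "nbr v \<inter> F = {x, x'}"
  proof
    show "nbr v \<inter> F \<subseteq> {x, x'}"
    proof
      fix u assume "u \<in> nbr v \<inter> F"
      then show "u \<in> {x, x'}" using c(2)[of u] inF[of u] by auto
    qed
    show "{x, x'} \<subseteq> nbr v \<inter> F" using x c(1) inF by auto
  qed
  have vF: "v \<in> F" using V_sub_P[OF v] by (simp add: F_def)
  have "F \<noteq> P"
  proof
    assume "F = P"
    then have "nbr v = {x, x'}" using nF nbr_V V_sub_P by blast
    then have "card (nbr v) \<le> 2" by (simp add: card_insert_if)
    then show False using nbr_card3[OF v] by simp
  qed
  then have "aff_dim F < 3" using face_of_aff_dim_lt[OF convP F] dim3 by simp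
  moreover have "2 \<le> aff_dim F"
    by (rule aff_dim_face_ge_2[OF F v nbr_V[OF x(1)] nbr_V[OF x(2)] vF])
      (use nF x in \<open>auto simp: nbr_def\<close>)
  ultimately have "aff_dim F = 2" by simp
  then show ?thesis using F vF nF by (intro exI[of _ F] conjI)
qed

text \<open>The common part is a face with three vertices, hence of dimension at least 2, whereas a
  proper face of either would have smaller dimension.\<close>

lemma face_unique:
  assumes F: "F face_of P" "aff_dim F = 2" "F' face_of P" "aff_dim F' = 2"
    and abc: "a \<in> V" "b \<in> V" "c \<in> V" "a \<in> F \<inter> F'" "b \<in> F \<inter> F'" "c \<in> F \<inter> F'" "a \<noteq> b" "a \<noteq> c" "b \<noteq> c"
  shows "F = F'"
proof -
  have G: "F \<inter> F' face_of P" using F by (simp add: face_of_Int)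
  have d: "aff_dim (F \<inter> F') \<ge> 2" by (rule aff_dim_face_ge_2[OF G abc])
  have eq: "F \<inter> F' = H" if H: "H face_of P" "aff_dim H = 2" "F \<inter> F' \<subseteq> H" for H
  proof (rule ccontr)
    assume "F \<inter> F' \<noteq> H"
    moreover have "F \<inter> F' face_of H" using G H by (simp add: face_of_face)
    ultimately have "aff_dim (F \<inter> F') < aff_dim H" using face_of_imp_convex[OF H(1)] face_of_aff_dim_lt by blast
    then show False using d H by simp
  qed
  show ?thesis using eq[OF F(1,2)] eq[OF F(3,4)] by auto
qed

text \<open>The neighbours of a vertex lie on a circle, and two consecutive ones span a face with it, so they form
  a regular polygon; matching its sides with the faces at the vertex shows that it has \<open>q\<close> sides.\<close>
lemma nbr_regular:
  assumes v: "v \<in> V" and n: "n \<in> nbr v"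
  shows "nbr v = (\<lambda>j. axis_rot v (2*pi*real j / real q) n) ` {..<q}" and "q \<ge> 3"
proof -
  have e: "norm v = 1" using unit[OF v] .
  define h where "h = 1 - len^2/2"
  define r where "r = sqrt (1 - h^2)"
  define l where "l = 2 * len * cos (pi / real p)"
  have Xh: "x \<bullet> v = h" "norm (x - h *\<^sub>R v) = r" if "x \<in> nbr v" for x
    using nbr_h[OF v that] by (simp_all add: h_def r_def)
  have chord: "dist x x' = l" if x: "x \<in> nbr v" "x' \<in> nbr v" "x \<noteq> x'" and c: "c \<bullet> x' = c \<bullet> x"
      "\<And>y. y \<in> nbr v \<Longrightarrow> y \<noteq> x \<Longrightarrow> y \<noteq> x' \<Longrightarrow> c \<bullet> y < c \<bullet> x" for x x' c
  proof -
    obtain F where F: "F face_of P" "aff_dim F = 2" "v \<in> F" "nbr v \<inter> F = {x, x'}"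
      using nbr_support_face[OF v x c] by blast
    obtain n n' where "n \<noteq> n'" "nbr v \<inter> F = {n, n'}" "dist n n' = l"
      using face_nbrs[OF F(1,2) v F(3)] unfolding l_def by blast
    then show ?thesis using F by (auto simp: doubleton_eq_iff dist_commute)
  qed
  define m where "m = card (nbr v)"
  have m3: "3 \<le> m" using nbr_card3[OF v] by (simp add: m_def)
  have r: "r > 0" by (rule regular_polygon_circle(1)[OF e finite_nbr nbr_card3[OF v] Xh chord])
  have l: "l = 2 * r * sin (pi / real m)"
    unfolding m_def by (rule regular_polygon_circle(3)[OF e finite_nbr nbr_card3[OF v] Xh chord])
  have orbit: "nbr v = (\<lambda>j. axis_rot v (2*pi*real j / real m) x) ` {..<m}" if "x \<in> nbr v" for x
    unfolding m_def by (rule regular_polygon_circle(2)[OF e finite_nbr nbr_card3[OF v] Xh chord that])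
  define t where "t = 2 * pi / real m"
  have t: "0 < t" "t < pi" "t \<le> 2 * pi" "t/2 = pi / real m" using m3 by (auto simp: t_def field_simps)
  have consec: "\<exists>c. c \<bullet> axis_rot v t x = c \<bullet> x \<and> (\<forall>y\<in>nbr v. y \<noteq> x \<longrightarrow> y \<noteq> axis_rot v t x \<longrightarrow> c \<bullet> y < c \<bullet> x)"
    if "x \<in> nbr v" for x
    unfolding m_def t_def by (rule regular_polygon_circle(4)[OF e finite_nbr nbr_card3[OF v] Xh chord that])
  have rot_in: "axis_rot v t x \<in> nbr v" if "x \<in> nbr v" for x
    unfolding t_def by (subst orbit[OF that]) (rule image_eqI[of _ _ 1], use m3 in auto)
  have rot_ne: "axis_rot v s x \<noteq> x" if "x \<in> nbr v" "0 < s" "s < 2*pi" for x s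
  proof -
    have "dist x (axis_rot v s x) = 2 * r * sin (s/2)" by (rule dist_axis_rot[OF e Xh[OF that(1)]]) (use that in auto)
    moreover have "sin (s/2) > 0" using that by (intro sin_gt_zero) auto
    ultimately have "dist x (axis_rot v s x) > 0" using r by simp
    then show ?thesis by auto
  qed
  \<comment> \<open>Two injections give \<open>m = q\<close>: \<open>\<phi>\<close> sends a
    neighbour \<open>x\<close> to the face spanned by \<open>v\<close>, \<open>x\<close> and the
    successor of \<open>x\<close> on the circle, and \<open>\<psi>\<close> sends a face at
    \<open>v\<close> to the first of its two neighbours of \<open>v\<close>.\<close>
  define FS where "FS = {F. F face_of P \<and> aff_dim F = 2 \<and> v \<in> F}"
  have cFS: "card FS = q" using degree[OF v] by (simp add: FS_def)
  have "finite {F. F face_of P}" using polyP by (rule finite_polytope_faces)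
  then have finFS: "finite FS" by (rule rev_finite_subset) (auto simp: FS_def)
  have "\<exists>F\<in>FS. nbr v \<inter> F = {x, axis_rot v t x}" if x: "x \<in> nbr v" for x
  proof -
    obtain c where c: "c \<bullet> axis_rot v t x = c \<bullet> x" "\<And>y. y\<in>nbr v \<Longrightarrow> y \<noteq> x \<Longrightarrow> y \<noteq> axis_rot v t x \<Longrightarrow> c \<bullet> y < c \<bullet> x"
      using consec[OF x] by blast
    have "x \<noteq> axis_rot v t x" using rot_ne[OF x, of t] t by auto
    then show ?thesis using nbr_support_face[OF v x rot_in[OF x] _ c] unfolding FS_def by blast
  qed
  then have "\<forall>x\<in>nbr v. \<exists>F. F \<in> FS \<and> nbr v \<inter> F = {x, axis_rot v t x}" by blast
  from bchoice[OF this] obtain \<phi> where "\<forall>x\<in>nbr v. \<phi> x \<in> FS \<and> nbr v \<inter> \<phi> x = {x, axis_rot v t x}" ..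
  then have \<phi>: "\<And>x. x \<in> nbr v \<Longrightarrow> \<phi> x \<in> FS" "\<And>x. x \<in> nbr v \<Longrightarrow> nbr v \<inter> \<phi> x = {x, axis_rot v t x}"
    by simp_all
  have "inj_on \<phi> (nbr v)"
  proof (rule inj_onI)
    fix x y assume xy: "x \<in> nbr v" "y \<in> nbr v" "\<phi> x = \<phi> y"
    show "x = y"
    proof (rule ccontr)
      assume "x \<noteq> y"
      then have "x = axis_rot v t y" "y = axis_rot v t x"
        using \<phi>(2)[OF xy(1)] \<phi>(2)[OF xy(2)] xy(3) by (auto simp: doubleton_eq_iff)
      \<comment> \<open>Two neighbours can be each other's successor only when \<open>m = 2\<close>,
        which \<open>t < pi\<close> excludes.\<close>
      then have "axis_rot v t (axis_rot v t x) = x" by simp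
      then have "axis_rot v (t + t) x = x" unfolding axis_rot_add[OF e] .
      then show False using rot_ne[OF xy(1), of "t + t"] t by auto
    qed
  qed
  then have "card (nbr v) \<le> card FS" using \<phi>(1) finFS by (intro card_inj_on_le[of \<phi>]) auto
  \<comment> \<open>Each face at \<open>v\<close> contributes two neighbours at distance
    \<open>l\<close>, the side of the regular polygon, so they are consecutive on the
    circle.\<close>
  moreover have "\<exists>x\<in>nbr v. nbr v \<inter> F = {x, axis_rot v t x}" if F: "F \<in> FS" for F
  proof -
    obtain n n' where n: "n \<noteq> n'" "nbr v \<inter> F = {n, n'}" "dist n n' = l"
      using face_nbrs[of F v] F v unfolding l_def FS_def by blast
    have nn: "n \<in> nbr v" "n' \<in> nbr v" using n by auto
    have "n' = axis_rot v t n \<or> n' = axis_rot v (-t) n"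
      by (rule axis_rot_chord_cases[OF e Xh[OF nn(1)] Xh[OF nn(2)] r]) (use t n(3) l in auto)
    then show ?thesis
    proof
      assume "n' = axis_rot v (-t) n"
      then have "axis_rot v t n' = n" by (simp add: axis_rot_add[OF e])
      then show ?thesis using n nn by auto
    qed (use n nn in auto)
  qed
  then have "\<forall>F\<in>FS. \<exists>x. x \<in> nbr v \<and> nbr v \<inter> F = {x, axis_rot v t x}" by blast
  from bchoice[OF this] obtain \<psi> where "\<forall>F\<in>FS. \<psi> F \<in> nbr v \<and> nbr v \<inter> F = {\<psi> F, axis_rot v t (\<psi> F)}" ..
  then have \<psi>: "\<And>F. F \<in> FS \<Longrightarrow> \<psi> F \<in> nbr v" "\<And>F. F \<in> FS \<Longrightarrow> nbr v \<inter> F = {\<psi> F, axis_rot v t (\<psi> F)}"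
    by simp_all
  have "inj_on \<psi> FS"
  proof (rule inj_onI)
    fix F F' assume FF: "F \<in> FS" "F' \<in> FS" "\<psi> F = \<psi> F'"
    define x where "x = \<psi> F"
    have x: "x \<in> nbr v" "axis_rot v t x \<in> nbr v" using \<psi>(1)[OF FF(1)] rot_in by (auto simp: x_def)
    have "x \<in> F \<inter> F'" "axis_rot v t x \<in> F \<inter> F'" using \<psi>(2)[OF FF(1)] \<psi>(2)[OF FF(2)] FF(3) unfolding x_def by auto
    moreover have "axis_rot v t x \<noteq> x" using rot_ne[OF x(1), of t] t by auto
    moreover have "v \<noteq> x" "v \<noteq> axis_rot v t x" using x by (auto simp: nbr_def)
    ultimately show "F = F'" using FF v nbr_V[OF x(1)] nbr_V[OF x(2)]
      by (intro face_unique[of F F' v x "axis_rot v t x"]) (auto simp: FS_def)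
  qed
  then have "card FS \<le> card (nbr v)" using \<psi>(1) finite_nbr by (intro card_inj_on_le[of \<psi>]) auto
  ultimately have mq: "m = q" using cFS by (simp add: m_def)
  then show "q \<ge> 3" using m3 by simp
  show "nbr v = (\<lambda>j. axis_rot v (2*pi*real j / real q) n) ` {..<q}" using orbit[OF n] unfolding mq .
qed

text \<open>An isometry that carries a vertex and its neighbours to a vertex and its neighbours does so at each
  of these neighbours, whose own neighbours are an orbit of the first vertex.\<close>
lemma vertex_rotation_invariant:
  assumes v: "v \<in> V" and u: "u \<in> V"
  shows "axis_rot v (2*pi / real q) u \<in> V"
proof -
  have e: "norm v = 1" using unit[OF v] .
  define T where "T = axis_rot v (2*pi / real q)"
  have injT: "inj T"
  proof (rule injI)
    fix x y assume "T x = T y"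
    then have "axis_rot v (- (2*pi / real q)) (T x) = axis_rot v (- (2*pi / real q)) (T y)" by simp
    then show "x = y" unfolding T_def axis_rot_add[OF e] by simp
  qed
  define S where "S = {u\<in>V. T u \<in> V \<and> T ` nbr u = nbr (T u)}"
  have vS: "v \<in> S"
  proof -
    have Tv: "T v = v" unfolding T_def by (rule axis_rot_axis[OF e])
    have "T ` nbr v \<subseteq> nbr v"
    proof (rule image_subsetI)
      fix n assume n: "n \<in> nbr v"
      have q: "q \<ge> 3" by (rule nbr_regular(2)[OF v n])
      show "T n \<in> nbr v" unfolding T_def
        by (subst nbr_regular(1)[OF v n]) (rule image_eqI[of _ _ 1], use q in auto)
    qed
    moreover have "card (T ` nbr v) = card (nbr v)" using injT by (intro card_image) (auto intro: inj_on_subset)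
    ultimately have "T ` nbr v = nbr v" using finite_nbr by (intro card_subset_eq)
    then show ?thesis using v Tv by (simp add: S_def)
  qed
  have closed: "w \<in> S" if u: "u \<in> S" and w: "w \<noteq> u" "closed_segment u w face_of P" for u w
  proof -
    have wu: "w \<in> nbr u" using w by (simp add: nbr_def)
    have Tw: "T w \<in> nbr (T u)" using wu u by (auto simp: S_def)
    have wV: "w \<in> V" "T w \<in> V" using nbr_V wu Tw by auto
    have "T ` nbr w = T ` (\<lambda>j. axis_rot w (2*pi*real j / real q) u) ` {..<q}"
      by (subst nbr_regular(1)[OF wV(1) nbr_sym[OF wu]]) simp
    also have "\<dots> = (\<lambda>j. axis_rot (T w) (2*pi*real j / real q) (T u)) ` {..<q}"
      unfolding image_image T_def by (simp only: axis_rot_conjugate[OF e])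
    also have "\<dots> = nbr (T w)" by (rule nbr_regular(1)[OF wV(2) nbr_sym[OF Tw], symmetric])
    finally show ?thesis using wV by (simp add: S_def)
  qed
  have "S = V"
  proof (rule sphere_polytope_edge_connected[OF fin P _ unit _ _ closed])
    show "S \<subseteq> V" by (simp add: S_def)
    show "S \<noteq> {}" using vS by blast
  qed (simp_all add: ext_V)
  then have "u \<in> S" using u by simp
  then show ?thesis by (simp add: S_def T_def)
qed

end

section \<open>The equilibrium\<close>

lemma hat_mult_vector: "hat x *v y = cross3 x y"
proof -
  have "linear (cross3 x)" by (rule linearI) (simp_all add: cross3_add_scaleR)
  moreover have "hat x = matrix (cross3 x)" by (simp add: hat_def matrix_def)
  ultimately show ?thesis by (simp add: matrix_works)
qed

text \<open>For a unit \<open>e\<close> the third power of \<open>cross3 e\<close> is its negative,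
  so the powers alternate between \<open>cross3 e\<close> and its square with the signs of the sine
  and cosine series. At \<open>n = 0\<close> the general expression gives minus the square instead
  of the identity, which the last term corrects.\<close>

lemma matpow_hat_mult_vector:
  assumes e: "norm e = 1"
  shows "matpow (t *\<^sub>R hat e) n *v x = (fact n * sin_coeff n * t^n) *\<^sub>R cross3 e x
    - (fact n * cos_coeff n * t^n) *\<^sub>R cross3 e (cross3 e x) + (if n = 0 then x + cross3 e (cross3 e x) else 0)"
proof (induction n)
  case 0
  then show ?case by simp
next
  case (Suc n)
  have ee: "e \<bullet> e = 1" using e by (simp add: norm_eq_1)
  have H3: "cross3 e (cross3 e (cross3 e x)) = - cross3 e x"
    unfolding cross3_twice[of e "cross3 e x"] by (simp add: ee)
  have s: "fact (Suc n) * sin_coeff (Suc n) = (fact n * cos_coeff n :: real)"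
    "fact (Suc n) * cos_coeff (Suc n) = (- (fact n * sin_coeff n) :: real)"
    by (simp_all add: sin_coeff_Suc cos_coeff_Suc del: of_nat_Suc)
  have "matpow (t *\<^sub>R hat e) (Suc n) *v x = t *\<^sub>R cross3 e (matpow (t *\<^sub>R hat e) n *v x)"
    by (simp add: matrix_vector_mul_assoc[symmetric] scaleR_matrix_vector_assoc[symmetric] hat_mult_vector)
  also have "\<dots> = (fact n * cos_coeff n * t^Suc n) *\<^sub>R cross3 e x
    - (- (fact n * sin_coeff n) * t^Suc n) *\<^sub>R cross3 e (cross3 e x)"
    unfolding Suc.IH by (cases "n = 0") (simp_all add: cross3_add_scaleR H3 algebra_simps)
  finally show ?case unfolding s by simp
qed

text \<open>The series sums to \<open>I + sin t H + (1 - cos t) H^2\<close> with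
  \<open>H = hat e\<close>, the matrix form of Rodrigues' formula.\<close>

lemma mexp_hat:
  assumes e: "norm e = 1"
  shows "mexp (t *\<^sub>R hat e) *v x = axis_rot e t x"
proof -
  define H where "H = hat e"
  let ?f = "\<lambda>n. (sin_coeff n * t^n) *\<^sub>R H - (cos_coeff n * t^n) *\<^sub>R (H ** H) + (if n = 0 then Finite_Cartesian_Product.mat 1 + H ** H else 0)"
  have "(1 / fact n) *\<^sub>R matpow (t *\<^sub>R H) n = ?f n" for n
  proof (rule matrix_eq[THEN iffD2], rule allI)
    fix x
    show "((1 / fact n) *\<^sub>R matpow (t *\<^sub>R H) n) *v x = ?f n *v x"
      unfolding H_def scaleR_matrix_vector_assoc[symmetric] matpow_hat_mult_vector[OF e]
      by (cases "n = 0") (simp_all add: matrix_vector_mult_add_rdistrib matrix_vector_mult_diff_rdistrib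
        scaleR_matrix_vector_assoc[symmetric] matrix_vector_mul_assoc[symmetric] hat_mult_vector scaleR_diff_right)
  qed
  then have "mexp (t *\<^sub>R H) = suminf ?f" by (simp add: mexp_def)
  also have "?f sums (sin t *\<^sub>R H - cos t *\<^sub>R (H ** H) + (Finite_Cartesian_Product.mat 1 + H ** H))"
    using sums_add[OF sums_diff[OF sums_scaleR_left[OF sin_converges[of t], of H] sums_scaleR_left[OF cos_converges[of t], of "H ** H"]]
      sums_single[of 0 "\<lambda>_. Finite_Cartesian_Product.mat 1 + H ** H"]] by (simp add: eq_commute)
  then have "suminf ?f = sin t *\<^sub>R H - cos t *\<^sub>R (H ** H) + (Finite_Cartesian_Product.mat 1 + H ** H)" by (rule sums_unique[symmetric])
  finally have *: "mexp (t *\<^sub>R hat e) = sin t *\<^sub>R H - cos t *\<^sub>R (H ** H) + (Finite_Cartesian_Product.mat 1 + H ** H)" by (simp add: H_def)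
  have ee: "e \<bullet> e = 1" using e by (simp add: norm_eq_1)
  show ?thesis unfolding * H_def axis_rot_def
    by (simp add: matrix_vector_mult_add_rdistrib matrix_vector_mult_diff_rdistrib scaleR_matrix_vector_assoc[symmetric]
      matrix_vector_mul_assoc[symmetric] hat_mult_vector cross3_twice ee algebra_simps inner_commute)
qed

text \<open>This justifies the definite description in \<open>sigma\<close>: an index exists because
  the rotated vertex is a vertex, and it is unique because the enumeration is injective.\<close>

lemma regular_polyhedron_rotation:
  assumes poly: "regular_polyhedron_vertices p q N \<Gamma>" and p: "p \<ge> 3" and ik: "i \<in> {1..N}" "k \<in> {1..N}"
  shows "sigma q N \<Gamma> i k \<in> {1..N}" "\<Gamma> (sigma q N \<Gamma> i k) = axis_rot (\<Gamma> i) (2 * pi / real q) (\<Gamma> k)"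
proof -
  define V where "V = \<Gamma> ` {1..N}"
  define P where "P = convex hull V"
  have inj: "inj_on \<Gamma> {1..N}" and uG: "\<And>k. k \<in> {1..N} \<Longrightarrow> norm (\<Gamma> k) = 1"
    using poly by (auto simp: regular_polyhedron_vertices_def)
  obtain len where "len > 0" "\<And>e. e face_of P \<Longrightarrow> aff_dim e = 1 \<Longrightarrow> \<exists>a b. e = closed_segment a b \<and> dist a b = len"
    using poly unfolding regular_polyhedron_vertices_def Let_def V_def[symmetric] P_def[symmetric] by blast
  then have len: "len > 0" "\<And>e. e face_of P \<Longrightarrow> aff_dim e = 1 \<Longrightarrow> \<exists>a b. e = closed_segment a b \<and> dist a b = len"
    by blast+
  have rest: "aff_dim P = 3" "{v. v extreme_point_of P} = V"
    "\<And>F. F face_of P \<Longrightarrow> aff_dim F = 2 \<Longrightarrow> card {v. v extreme_point_of F} = p"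
    "\<And>v. v \<in> V \<Longrightarrow> card {F. F face_of P \<and> aff_dim F = 2 \<and> v \<in> F} = q"
    using poly unfolding regular_polyhedron_vertices_def Let_def V_def[symmetric] P_def[symmetric] by blast+
  have finV: "finite V" and unitV: "\<And>v. v \<in> V \<Longrightarrow> norm v = 1" using uG by (auto simp: V_def)
  have "equilateral_sphere_polytope V P len p q"
    by (rule equilateral_sphere_polytope.intro[OF finV P_def rest(2) unitV rest(1) len rest(3,4) p])
  then interpret equilateral_sphere_polytope V P len p q .
  have "axis_rot (\<Gamma> i) (2 * pi / real q) (\<Gamma> k) \<in> V"
    by (rule vertex_rotation_invariant) (use ik in \<open>auto simp: V_def\<close>)
  then obtain m where m: "axis_rot (\<Gamma> i) (2 * pi / real q) (\<Gamma> k) = \<Gamma> m" "m \<in> {1..N}"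
    unfolding V_def by (rule imageE)
  have ex1: "\<exists>!m. m \<in> {1..N} \<and> \<Gamma> m = mexp ((2 * pi / real q) *\<^sub>R hat (\<Gamma> i)) *v \<Gamma> k"
    unfolding mexp_hat[OF uG[OF ik(1)]] m(1)
  proof (rule ex1I[of _ m])
    fix m' assume "m' \<in> {1..N} \<and> \<Gamma> m' = \<Gamma> m"
    then show "m' = m" using inj m(2) by (meson inj_onD)
  qed (use m in simp)
  have "sigma q N \<Gamma> i k \<in> {1..N} \<and> \<Gamma> (sigma q N \<Gamma> i k) = mexp ((2 * pi / real q) *\<^sub>R hat (\<Gamma> i)) *v \<Gamma> k"
    unfolding sigma_def by (rule theI'[OF ex1])
  then show "sigma q N \<Gamma> i k \<in> {1..N}" "\<Gamma> (sigma q N \<Gamma> i k) = axis_rot (\<Gamma> i) (2 * pi / real q) (\<Gamma> k)"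
    unfolding mexp_hat[OF uG[OF ik(1)]] by blast+
qed

text \<open>The control input at \<open>\<Gamma> i\<close> is a weighted sum over a rotation-invariant set of vertices, hence fixed by the
  rotation about \<open>\<Gamma> i\<close>, hence parallel to \<open>\<Gamma> i\<close>.\<close>
lemma formation_equilibrium:
  assumes poly: "regular_polyhedron_vertices p q N \<Gamma>" and p: "p \<ge> 3" and q: "q \<ge> 3" and i: "i \<in> {1..N}"
    and E: "\<And>j k. E j k \<Longrightarrow> j \<in> {1..N} \<and> k \<in> {1..N}"
    and aut: "graph_automorphism {1..N} E (sigma q N \<Gamma> i)"
  shows "(\<Sum>k\<in>nbrs E i. exp (2 * (\<Gamma> i \<bullet> \<Gamma> k)) *\<^sub>R (\<Gamma> k - (\<Gamma> i \<bullet> \<Gamma> k) *\<^sub>R \<Gamma> i)) = 0"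
proof -
  define s where "s = sigma q N \<Gamma> i"
  define e where "e = \<Gamma> i"
  define t where "t = 2 * pi / real q"
  define w where "w x = exp (2 * (e \<bullet> x))" for x
  define S where "S = (\<Sum>k\<in>nbrs E i. w (\<Gamma> k) *\<^sub>R \<Gamma> k)"
  have inj: "inj_on \<Gamma> {1..N}" and e: "norm e = 1"
    using poly i by (auto simp: regular_polyhedron_vertices_def e_def)
  have s: "s k \<in> {1..N}" "\<Gamma> (s k) = axis_rot e t (\<Gamma> k)" if "k \<in> {1..N}" for k
    using regular_polyhedron_rotation[OF poly p i that] by (simp_all add: s_def e_def t_def)
  have "\<Gamma> (s i) = \<Gamma> i" using s(2)[OF i] axis_rot_axis[OF e, of t] by (simp add: e_def)
  \<comment> \<open>\<open>\<Gamma> i\<close> lies on the rotation axis. Being fixed by the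
    automorphism \<open>s\<close>, the index \<open>i\<close> has its neighbour set permuted by
    \<open>s\<close>.\<close>
  then have si: "s i = i" by (rule inj_onD[OF inj _ s(1)[OF i] i])
  have finV: "nbrs E i \<subseteq> {1..N}" using E by (auto simp: nbrs_def)
  have fin: "finite (nbrs E i)" using finite_subset[OF finV] by simp
  have injs: "inj_on s (nbrs E i)"
  proof (rule inj_onI)
    fix j k assume jk: "j \<in> nbrs E i" "k \<in> nbrs E i" "s j = s k"
    have jkV: "j \<in> {1..N}" "k \<in> {1..N}" using jk finV by blast+
    have "axis_rot e t (\<Gamma> j) = axis_rot e t (\<Gamma> k)"
      unfolding s(2)[OF jkV(1), symmetric] s(2)[OF jkV(2), symmetric] jk(3) ..
    then have "axis_rot e (-t) (axis_rot e t (\<Gamma> j)) = axis_rot e (-t) (axis_rot e t (\<Gamma> k))" by simp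
    then have "\<Gamma> j = \<Gamma> k" by (simp add: axis_rot_add[OF e])
    then show "j = k" by (rule inj_onD[OF inj _ jkV])
  qed
  have "s ` nbrs E i \<subseteq> nbrs E i"
  proof (rule image_subsetI)
    fix k assume k: "k \<in> nbrs E i"
    then have "k \<in> {1..N}" "E i k" using finV by (auto simp: nbrs_def)
    then have "E (s i) (s k)" using aut i unfolding graph_automorphism_def s_def by blast
    then show "s k \<in> nbrs E i" by (simp add: si nbrs_def)
  qed
  then have "s ` nbrs E i = nbrs E i" using fin injs by (simp add: endo_inj_surj)
  then have "S = (\<Sum>k\<in>s ` nbrs E i. w (\<Gamma> k) *\<^sub>R \<Gamma> k)" by (simp add: S_def)
  also have "\<dots> = (\<Sum>k\<in>nbrs E i. w (\<Gamma> (s k)) *\<^sub>R \<Gamma> (s k))" using injs by (simp add: sum.reindex)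
  also have "\<dots> = (\<Sum>k\<in>nbrs E i. axis_rot e t (w (\<Gamma> k) *\<^sub>R \<Gamma> k))"
  proof (rule sum.cong[OF refl])
    fix k assume "k \<in> nbrs E i"
    then have k: "k \<in> {1..N}" using finV by auto
    have "w (axis_rot e t (\<Gamma> k)) = w (\<Gamma> k)"
      using inner_axis_rot_axis[OF e, of t "\<Gamma> k"] by (simp add: w_def inner_commute)
    then show "w (\<Gamma> (s k)) *\<^sub>R \<Gamma> (s k) = axis_rot e t (w (\<Gamma> k) *\<^sub>R \<Gamma> k)"
      using s(2)[OF k] by (simp add: linear_scale[OF linear_axis_rot])
  qed
  also have "\<dots> = axis_rot e t S" unfolding S_def by (simp add: linear_sum[OF linear_axis_rot])
  finally have fixed: "axis_rot e t S = S" ..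
  \<comment> \<open>The part of \<open>S\<close> orthogonal to the axis. Pairing the fixed-point
    equation with \<open>u\<close> removes the cross product and leaves \<open>cos t - 1\<close>
    times \<open>u \<bullet> u\<close>.\<close>
  define u where "u = S - (S \<bullet> e) *\<^sub>R e"
  have "axis_rot e t S - S = (cos t - 1) *\<^sub>R u + sin t *\<^sub>R cross3 e S"
    by (simp add: axis_rot_def u_def algebra_simps)
  then have "u \<bullet> ((cos t - 1) *\<^sub>R u + sin t *\<^sub>R cross3 e S) = 0" using fixed by simp
  moreover have "u \<bullet> cross3 e S = 0" by (simp add: u_def inner_diff_left)
  ultimately have "(cos t - 1) * (u \<bullet> u) = 0" by (simp add: inner_add_right)
  moreover have "cos t < 1"
  proof -
    have "0 < t" "t \<le> pi" using q by (auto simp: t_def field_simps)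
    then have "cos t < cos 0" by (intro cos_monotone_0_pi) auto
    then show ?thesis by simp
  qed
  ultimately have "u = 0" by simp
  have "(\<Sum>k\<in>nbrs E i. w (\<Gamma> k) *\<^sub>R (\<Gamma> k - (e \<bullet> \<Gamma> k) *\<^sub>R e)) = u"
    by (simp add: u_def S_def scaleR_diff_right sum_subtractf inner_commute[of _ e] inner_sum_right scaleR_sum_left)
  then show ?thesis using \<open>u = 0\<close> by (simp add: w_def e_def)
qed

section \<open>Linearisation of the induced vector field\<close>

lemma finite_pairs [simp]: "finite (pairs N)"
  by (rule finite_subset[of _ "{1..N} \<times> {1..N}"]) (auto simp: pairs_def)

lemma xnorm_nonneg [simp]: "0 \<le> xnorm N x"
  by (simp add: xnorm_def sum_nonneg)

lemma xnorm_power2: "(xnorm N x)^2 = (\<Sum>a\<in>pairs N. (x a)^2)"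
  by (simp add: xnorm_def sum_nonneg)

lemma abs_le_xnorm: assumes "a \<in> pairs N" shows "\<bar>x a\<bar> \<le> xnorm N x"
proof -
  have "(x a)^2 \<le> (\<Sum>a\<in>pairs N. (x a)^2)" using assms by (intro member_le_sum) auto
  then show ?thesis unfolding xnorm_def using real_le_rsqrt by fastforce
qed

lemma abs_le_xnorm': "x \<in> xi_space N \<Longrightarrow> \<bar>x a\<bar> \<le> xnorm N x"
proof (cases "a \<in> pairs N")
  case False
  assume "x \<in> xi_space N"
  with False have "x a = 0" unfolding xi_space_def by blast
  then show ?thesis by simp
qed (rule abs_le_xnorm)

lemma xnorm_le_sum: "xnorm N x \<le> (\<Sum>a\<in>pairs N. \<bar>x a\<bar>)"
  using L2_set_le_sum_abs[of x "pairs N"] by (simp add: L2_set_def xnorm_def)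

lemma xnorm_triangle: "xnorm N (\<lambda>a. x a + y a) \<le> xnorm N x + xnorm N y"
  using L2_set_triangle_ineq[of x y "pairs N"] by (simp add: L2_set_def xnorm_def)

lemma xnorm_scale: "xnorm N (\<lambda>a. c * x a) = \<bar>c\<bar> * xnorm N x"
  by (simp add: xnorm_def power_mult_distrib sum_distrib_left[symmetric] real_sqrt_mult)

lemma pderiv_xi_eq:
  assumes "((\<lambda>s. F (\<lambda>a. x a + s * (if a = b then 1 else 0))) has_real_derivative D) (at 0)"
  shows "pderiv_xi F x b = D"
proof -
  have "((\<lambda>t. F (x(b := t))) has_real_derivative D) (at (0 + x b))"
    unfolding DERIV_shift
  proof -
    have "x(b := s + x b) = (\<lambda>a. x a + s * (if a = b then 1 else 0))" for s by auto
    then show "((\<lambda>s. F (x(b := s + x b))) has_real_derivative D) (at 0)" using assms by simp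
  qed
  then show ?thesis unfolding pderiv_xi_def by (simp add: DERIV_imp_deriv)
qed

text \<open>A directional derivative that is linear in the direction is determined by the coordinate
  directions, where it is the partial derivative. Products with a Jacobian can thus be computed from
  derivatives along lines.\<close>

lemma sum_pderiv_xi:
  assumes D: "\<And>y. ((\<lambda>s. F (\<lambda>a. x a + s * y a)) has_real_derivative D y) (at 0)"
    and add: "\<And>y z. D (\<lambda>a. y a + z a) = D y + D z" and scale: "\<And>c y. D (\<lambda>a. c * y a) = c * D y"
    and y: "y \<in> xi_space N"
  shows "(\<Sum>b\<in>pairs N. pderiv_xi F x b * y b) = D y"
proof -
  have 0: "D (\<lambda>a. 0) = 0" using scale[of 0 "\<lambda>a. 0"] by simp
  have "D (\<lambda>a. \<Sum>b\<in>B. y b * (if a = b then 1 else 0)) = (\<Sum>b\<in>B. y b * D (\<lambda>a. if a = b then 1 else 0))"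
    if "finite B" for B
    using that
  proof (induction B rule: finite_induct)
    case (insert b B)
    have "D (\<lambda>a. \<Sum>b\<in>insert b B. y b * (if a = b then 1 else 0)) =
      D (\<lambda>a. y b * (if a = b then 1 else 0) + (\<Sum>b\<in>B. y b * (if a = b then 1 else 0)))"
      using insert by simp
    then show ?case unfolding add scale using insert by simp
  qed (simp add: 0)
  from this[OF finite_pairs[of N]]
  have "D (\<lambda>a. \<Sum>b\<in>pairs N. y b * (if a = b then 1 else 0)) = (\<Sum>b\<in>pairs N. pderiv_xi F x b * y b)"
    using pderiv_xi_eq[OF D] by (simp add: mult.commute)
  moreover have "(\<lambda>a. \<Sum>b\<in>pairs N. y b * (if a = b then 1 else 0)) = y"
    using y by (auto simp: xi_space_def if_distrib sum.delta cong: if_cong)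
  ultimately show ?thesis by simp
qed

text \<open>The increment of \<open>xx\<close> in the direction \<open>y\<close>. Its diagonal is 0
  because that of \<open>xx\<close> is constantly 1.\<close>

definition dxx :: "(nat \<times> nat \<Rightarrow> real) \<Rightarrow> nat \<Rightarrow> nat \<Rightarrow> real" where
  "dxx y i j = (if i = j then 0 else if i < j then y (i, j) else y (j, i))"

lemma xx_line: "xx (\<lambda>a. x a + s * y a) i j = xx x i j + s * dxx y i j"
  by (simp add: xx_def dxx_def)

lemma dxx_linear: "dxx (\<lambda>a. y a + z a) i j = dxx y i j + dxx z i j" "dxx (\<lambda>a. c * y a) i j = c * dxx y i j"
  by (simp_all add: dxx_def)

text \<open>The derivative of one of the two sums in \<open>fs\<close>, for a matrix
  \<open>X\<close> of values and a matrix \<open>Y\<close> of increments; the other sum arises by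
  exchanging \<open>i\<close> and \<open>j\<close>.\<close>

definition half_dfs :: "(nat \<Rightarrow> nat \<Rightarrow> real) \<Rightarrow> (nat \<Rightarrow> nat \<Rightarrow> real) \<Rightarrow> nat set \<Rightarrow> nat \<Rightarrow> nat \<Rightarrow> real" where
  "half_dfs X Y K i j = (\<Sum>k\<in>K. exp (2 * X j k) * (2 * Y j k * (X i j * X j k - X i k)
      + (Y i j * X j k + X i j * Y j k - Y i k)))"

definition dfs :: "nat \<Rightarrow> (nat \<Rightarrow> nat \<Rightarrow> bool) \<Rightarrow> (nat \<times> nat \<Rightarrow> real) \<Rightarrow> (nat \<times> nat \<Rightarrow> real) \<Rightarrow> nat \<times> nat \<Rightarrow> real" where
  "dfs N E x y a = (if a \<in> pairs N then half_dfs (xx x) (dxx y) (nbrs E (snd a)) (fst a) (snd a)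
     + half_dfs (xx x) (dxx y) (nbrs E (fst a)) (snd a) (fst a) else 0)"

lemma xx_sym: "xx x i j = xx x j i"
  by (auto simp: xx_def)

lemma fs_alt: "fs N E x a = (if a \<in> pairs N then
    (\<Sum>k\<in>nbrs E (snd a). exp (2 * xx x (snd a) k) * (xx x (fst a) (snd a) * xx x (snd a) k - xx x (fst a) k)) +
    (\<Sum>k\<in>nbrs E (fst a). exp (2 * xx x (fst a) k) * (xx x (snd a) (fst a) * xx x (fst a) k - xx x (snd a) k)) else 0)"
  by (simp add: fs_def Let_def xx_sym[of x "snd a" "fst a"])

lemma half_fs_DERIV:
  fixes X Y :: "nat \<Rightarrow> nat \<Rightarrow> real"
  shows "((\<lambda>s. \<Sum>k\<in>K. exp (2 * (X j k + s * Y j k)) * ((X i j + s * Y i j) * (X j k + s * Y j k) - (X i k + s * Y i k)))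
     has_real_derivative half_dfs X Y K i j) (at 0)"
  unfolding half_dfs_def
  by (rule DERIV_sum) (auto intro!: derivative_eq_intros simp: algebra_simps)

lemma fs_DERIV: "((\<lambda>s. fs N E (\<lambda>a. x a + s * y a) a) has_real_derivative dfs N E x y a) (at 0)"
proof (cases "a \<in> pairs N")
  case True
  show ?thesis unfolding fs_alt dfs_def xx_line
    by (simp only: True if_True) (intro DERIV_add half_fs_DERIV)
next
  case False
  then show ?thesis by (simp add: fs_alt dfs_def)
qed

lemma half_dfs_add: "half_dfs X (\<lambda>i j. Y i j + Z i j) K i j = half_dfs X Y K i j + half_dfs X Z K i j"
  unfolding half_dfs_def sum.distrib[symmetric] by (rule sum.cong) (simp_all add: algebra_simps)

lemma half_dfs_scale: "half_dfs X (\<lambda>i j. c * Y i j) K i j = c * half_dfs X Y K i j"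
  unfolding half_dfs_def sum_distrib_left by (rule sum.cong) (simp_all add: algebra_simps)

lemma dfs_add: "dfs N E x (\<lambda>a. y a + z a) a = dfs N E x y a + dfs N E x z a"
proof -
  have "dxx (\<lambda>a. y a + z a) = (\<lambda>i j. dxx y i j + dxx z i j)" by (intro ext dxx_linear)
  then show ?thesis by (simp add: dfs_def half_dfs_add)
qed

lemma dfs_scale: "dfs N E x (\<lambda>a. c * y a) a = c * dfs N E x y a"
proof -
  have "dxx (\<lambda>a. c * y a) = (\<lambda>i j. c * dxx y i j)" by (intro ext dxx_linear)
  then show ?thesis by (simp add: dfs_def half_dfs_scale algebra_simps)
qed

lemma mat_app_jacobian:
  assumes "y \<in> xi_space N"
  shows "mat_app N (jacobian_fs N E x) y a = dfs N E x y a"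
proof (cases "a \<in> pairs N")
  case True
  then show ?thesis unfolding mat_app_def jacobian_fs_def
    using sum_pderiv_xi[of "\<lambda>x. fs N E x a" x "\<lambda>y. dfs N E x y a", OF fs_DERIV dfs_add dfs_scale assms] by (simp only: if_True)
qed (simp add: mat_app_def dfs_def)

section \<open>First-order approximation with quadratic remainder\<close>

text \<open>A calculus of remainders closed under the operations that build \<open>fs\<close>. The
  bound on the first-order part \<open>g\<close> is carried along because products and exponentials
  need it.\<close>

definition quad_approx :: "nat \<Rightarrow> ((nat \<times> nat \<Rightarrow> real) \<Rightarrow> real) \<Rightarrow> real \<Rightarrow> ((nat \<times> nat \<Rightarrow> real) \<Rightarrow> real) \<Rightarrow> bool" where
  "quad_approx N f f0 g \<longleftrightarrow> (\<exists>C. \<forall>y\<in>xi_space N. xnorm N y \<le> 1 \<longrightarrow>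
     \<bar>f y - f0 - g y\<bar> \<le> C * (xnorm N y)^2 \<and> \<bar>g y\<bar> \<le> C * xnorm N y)"

text \<open>The working form with a single nonnegative constant. The additional bound on
  \<open>f y - f0\<close> holds since the square of the norm is at most the norm on the unit
  ball.\<close>

definition quad_bound :: "nat \<Rightarrow> ((nat \<times> nat \<Rightarrow> real) \<Rightarrow> real) \<Rightarrow> real \<Rightarrow> ((nat \<times> nat \<Rightarrow> real) \<Rightarrow> real) \<Rightarrow> real \<Rightarrow> bool" where
  "quad_bound N f f0 g C \<longleftrightarrow> C \<ge> 0 \<and> (\<forall>y\<in>xi_space N. xnorm N y \<le> 1 \<longrightarrow> \<bar>f y - f0 - g y\<bar> \<le> C * (xnorm N y)^2 \<and>
    \<bar>g y\<bar> \<le> C * xnorm N y \<and> \<bar>f y - f0\<bar> \<le> 2 * C * xnorm N y)"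

lemma quad_boundD:
  assumes "quad_bound N f f0 g C"
  shows "C \<ge> 0" and "\<And>y. y \<in> xi_space N \<Longrightarrow> xnorm N y \<le> 1 \<Longrightarrow> \<bar>f y - f0 - g y\<bar> \<le> C * (xnorm N y)^2"
    and "\<And>y. y \<in> xi_space N \<Longrightarrow> xnorm N y \<le> 1 \<Longrightarrow> \<bar>g y\<bar> \<le> C * xnorm N y"
    and "\<And>y. y \<in> xi_space N \<Longrightarrow> xnorm N y \<le> 1 \<Longrightarrow> \<bar>f y - f0\<bar> \<le> 2 * C * xnorm N y"
  using assms by (simp_all add: quad_bound_def)

lemma quad_approxE:
  assumes "quad_approx N f f0 g"
  obtains C where "quad_bound N f f0 g C"
proof -
  obtain C where C: "\<And>y. y \<in> xi_space N \<Longrightarrow> xnorm N y \<le> 1 \<Longrightarrow> \<bar>f y - f0 - g y\<bar> \<le> C * (xnorm N y)^2 \<and> \<bar>g y\<bar> \<le> C * xnorm N y"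
    using assms unfolding quad_approx_def by blast
  define D where "D = max C 0"
  have 1: "\<bar>f y - f0 - g y\<bar> \<le> D * (xnorm N y)^2" "\<bar>g y\<bar> \<le> D * xnorm N y" if yN: "y \<in> xi_space N" "xnorm N y \<le> 1" for y
  proof -
    have "C * (xnorm N y)^2 \<le> D * (xnorm N y)^2" "C * xnorm N y \<le> D * xnorm N y"
      by (intro mult_right_mono; simp add: D_def)+
    then show "\<bar>f y - f0 - g y\<bar> \<le> D * (xnorm N y)^2" "\<bar>g y\<bar> \<le> D * xnorm N y" using C[OF yN] by linarith+
  qed
  have 2: "\<bar>f y - f0\<bar> \<le> 2 * D * xnorm N y" if y: "y \<in> xi_space N" "xnorm N y \<le> 1" for y
  proof -
    have "(xnorm N y)^2 \<le> xnorm N y" using y(2) by (simp add: power2_eq_square mult_left_le)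
    then have "D * (xnorm N y)^2 \<le> D * xnorm N y" by (intro mult_left_mono) (simp_all add: D_def)
    then show ?thesis using 1[OF y] by linarith
  qed
  have "quad_bound N f f0 g D" unfolding quad_bound_def by (intro conjI ballI impI 1 2) (simp_all add: D_def)
  then show ?thesis by (rule that)
qed

lemma quad_approxI:
  assumes "\<And>y. y \<in> xi_space N \<Longrightarrow> xnorm N y \<le> 1 \<Longrightarrow> \<bar>f y - f0 - g y\<bar> \<le> C * (xnorm N y)^2"
    "\<And>y. y \<in> xi_space N \<Longrightarrow> xnorm N y \<le> 1 \<Longrightarrow> \<bar>g y\<bar> \<le> D * xnorm N y"
  shows "quad_approx N f f0 g"
  unfolding quad_approx_def
proof (intro exI[of _ "max C D"] ballI impI conjI)
  fix y assume y: "y \<in> xi_space N" "xnorm N y \<le> 1"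
  have "C * (xnorm N y)^2 \<le> max C D * (xnorm N y)^2" "D * xnorm N y \<le> max C D * xnorm N y"
    by (intro mult_right_mono; simp)+
  then show "\<bar>f y - f0 - g y\<bar> \<le> max C D * (xnorm N y)^2" "\<bar>g y\<bar> \<le> max C D * xnorm N y"
    using assms[OF y] by linarith+
qed

lemma quad_approx_xx: "quad_approx N (\<lambda>y. xx (\<lambda>a. x a + y a) i j) (xx x i j) (\<lambda>y. dxx y i j)"
proof (rule quad_approxI[of _ _ _ _ 0 1])
  fix y assume "y \<in> xi_space N"
  then show "\<bar>dxx y i j\<bar> \<le> 1 * xnorm N y" by (simp add: dxx_def abs_le_xnorm')
qed (simp add: xx_def dxx_def)

lemma quad_approx_scale:
  assumes "quad_approx N f f0 g"
  shows "quad_approx N (\<lambda>y. c * f y) (c * f0) (\<lambda>y. c * g y)"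
proof -
  obtain C where Cb: "quad_bound N f f0 g C" by (rule quad_approxE[OF assms])
  note C = quad_boundD[OF Cb]
  show ?thesis
  proof (rule quad_approxI[of _ _ _ _ "\<bar>c\<bar> * C" "\<bar>c\<bar> * C"])
    fix y assume y: "y \<in> xi_space N" "xnorm N y \<le> 1"
    have "c * f y - c * f0 - c * g y = c * (f y - f0 - g y)" by (simp add: algebra_simps)
    then show "\<bar>c * f y - c * f0 - c * g y\<bar> \<le> \<bar>c\<bar> * C * (xnorm N y)^2"
      using C(2)[OF y] by (simp add: abs_mult mult.assoc mult_left_mono)
    show "\<bar>c * g y\<bar> \<le> \<bar>c\<bar> * C * xnorm N y" using C(3)[OF y] by (simp add: abs_mult mult.assoc mult_left_mono)
  qed
qed

lemma quad_approx_add: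
  assumes "quad_approx N f1 a1 g1" "quad_approx N f2 a2 g2"
  shows "quad_approx N (\<lambda>y. f1 y + f2 y) (a1 + a2) (\<lambda>y. g1 y + g2 y)"
proof -
  obtain C where Cb: "quad_bound N f1 a1 g1 C" by (rule quad_approxE[OF assms(1)])
  note C = quad_boundD[OF Cb]
  obtain D where Db: "quad_bound N f2 a2 g2 D" by (rule quad_approxE[OF assms(2)])
  note D = quad_boundD[OF Db]
  show ?thesis
  proof (rule quad_approxI[of _ _ _ _ "C + D" "C + D"])
    fix y assume y: "y \<in> xi_space N" "xnorm N y \<le> 1"
    show "\<bar>f1 y + f2 y - (a1 + a2) - (g1 y + g2 y)\<bar> \<le> (C + D) * (xnorm N y)^2"
      using C(2)[OF y] D(2)[OF y] by (simp add: distrib_right)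
    show "\<bar>g1 y + g2 y\<bar> \<le> (C + D) * xnorm N y"
      using C(3)[OF y] D(3)[OF y] by (simp add: distrib_right)
  qed
qed

lemma quad_approx_diff:
  assumes "quad_approx N f1 a1 g1" "quad_approx N f2 a2 g2"
  shows "quad_approx N (\<lambda>y. f1 y - f2 y) (a1 - a2) (\<lambda>y. g1 y - g2 y)"
  using quad_approx_add[OF assms(1) quad_approx_scale[OF assms(2), of "-1"]] by simp

lemma quad_approx_mult:
  assumes "quad_approx N f1 a1 g1" "quad_approx N f2 a2 g2"
  shows "quad_approx N (\<lambda>y. f1 y * f2 y) (a1 * a2) (\<lambda>y. g1 y * a2 + a1 * g2 y)"
proof -
  obtain C where Cb: "quad_bound N f1 a1 g1 C" by (rule quad_approxE[OF assms(1)])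
  note C = quad_boundD[OF Cb]
  obtain D where Db: "quad_bound N f2 a2 g2 D" by (rule quad_approxE[OF assms(2)])
  note D = quad_boundD[OF Db]
  show ?thesis
  proof (rule quad_approxI[of _ _ _ _ "(2*C) * (2*D) + \<bar>a1\<bar> * D + C * \<bar>a2\<bar>" "C * \<bar>a2\<bar> + \<bar>a1\<bar> * D"])
    fix y assume y: "y \<in> xi_space N" "xnorm N y \<le> 1"
    define n where "n = xnorm N y"
    \<comment> \<open>The first summand is a product of two first-order quantities, and each of the
      others contains a remainder; the constant above is read off term by term.\<close>
    have "f1 y * f2 y - a1 * a2 - (g1 y * a2 + a1 * g2 y)
      = (f1 y - a1) * (f2 y - a2) + a1 * (f2 y - a2 - g2 y) + (f1 y - a1 - g1 y) * a2" by (simp add: algebra_simps)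
    also have "\<bar>\<dots>\<bar> \<le> \<bar>f1 y - a1\<bar> * \<bar>f2 y - a2\<bar> + \<bar>a1\<bar> * \<bar>f2 y - a2 - g2 y\<bar> + \<bar>f1 y - a1 - g1 y\<bar> * \<bar>a2\<bar>"
      unfolding abs_mult[symmetric] by linarith
    also have "\<dots> \<le> (2*C*n) * (2*D*n) + \<bar>a1\<bar> * (D * n^2) + (C * n^2) * \<bar>a2\<bar>"
      unfolding n_def by (intro add_mono mult_mono C(4)[OF y] D(4)[OF y] C(2)[OF y] D(2)[OF y]) (use C(1) D(1) in auto)
    also have "\<dots> = ((2*C) * (2*D) + \<bar>a1\<bar> * D + C * \<bar>a2\<bar>) * n^2" by (simp add: algebra_simps power2_eq_square)
    finally show "\<bar>f1 y * f2 y - a1 * a2 - (g1 y * a2 + a1 * g2 y)\<bar> \<le> ((2*C) * (2*D) + \<bar>a1\<bar> * D + C * \<bar>a2\<bar>) * (xnorm N y)^2"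
      by (simp add: n_def)
    have "\<bar>g1 y * a2 + a1 * g2 y\<bar> \<le> \<bar>g1 y\<bar> * \<bar>a2\<bar> + \<bar>a1\<bar> * \<bar>g2 y\<bar>" unfolding abs_mult[symmetric] by linarith
    also have "\<dots> \<le> (C * n) * \<bar>a2\<bar> + \<bar>a1\<bar> * (D * n)"
      unfolding n_def by (intro add_mono mult_mono C(3)[OF y] D(3)[OF y]) (use C(1) D(1) in auto)
    also have "\<dots> = (C * \<bar>a2\<bar> + \<bar>a1\<bar> * D) * n" by (simp add: algebra_simps)
    finally show "\<bar>g1 y * a2 + a1 * g2 y\<bar> \<le> (C * \<bar>a2\<bar> + \<bar>a1\<bar> * D) * xnorm N y" by (simp add: n_def)
  qed
qed

lemma exp_quadratic_bound:
  fixes d :: real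
  assumes "\<bar>d\<bar> \<le> K"
  shows "\<bar>exp d - 1 - d\<bar> \<le> exp K * d^2"
proof -
  obtain t where t: "\<bar>t\<bar> \<le> \<bar>d\<bar>" "exp d = (\<Sum>m<2. d^m / fact m) + exp t / fact 2 * d^2"
    using Maclaurin_exp_le[of d 2] by blast
  have eq: "exp d - 1 - d = exp t / 2 * d^2" using t(2) by (simp add: numeral_2_eq_2)
  have "\<bar>exp d - 1 - d\<bar> = exp t / 2 * d^2" unfolding eq by (simp add: abs_mult)
  also have "\<dots> \<le> exp K * d^2"
  proof (rule mult_right_mono)
    have "exp t \<le> exp K" using t(1) assms by simp
    then show "exp t / 2 \<le> exp K" using exp_gt_zero[of K] by linarith
  qed simp
  finally show ?thesis .
qed

lemma quad_approx_exp:
  assumes "quad_approx N f a g"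
  shows "quad_approx N (\<lambda>y. exp (f y)) (exp a) (\<lambda>y. exp a * g y)"
proof -
  obtain C where Cb: "quad_bound N f a g C" by (rule quad_approxE[OF assms])
  note C = quad_boundD[OF Cb]
  show ?thesis
  \<comment> \<open>On the unit ball the increment \<open>d\<close> of the exponent is at most
    \<open>2*C\<close>, which makes the second-order bound for \<open>exp\<close> uniform.\<close>
  proof (rule quad_approxI[of _ _ _ _ "exp a * (exp (2*C) * (2*C)^2 + C)" "exp a * C"])
    fix y assume y: "y \<in> xi_space N" "xnorm N y \<le> 1"
    define n where "n = xnorm N y"
    define d where "d = f y - a"
    have d_le: "\<bar>d\<bar> \<le> 2 * C * n" using C(4)[OF y] by (simp add: d_def n_def)
    also have "2 * C * n \<le> 2 * C" using C(1) y by (simp add: n_def mult_left_le)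
    finally have d1: "\<bar>exp d - 1 - d\<bar> \<le> exp (2*C) * d^2" by (rule exp_quadratic_bound)
    have "\<bar>d\<bar>^2 \<le> (2 * C * n)^2" using d_le by (rule power_mono) simp
    then have "exp (2*C) * d^2 \<le> exp (2*C) * (2*C)^2 * n^2" by (simp add: power_mult_distrib)
    then have d2: "\<bar>exp d - 1 - d\<bar> \<le> exp (2*C) * (2*C)^2 * n^2" using d1 by linarith
    have "exp (f y) = exp a * exp d" by (simp add: d_def exp_diff)
    then have "exp (f y) - exp a - exp a * g y = exp a * ((exp d - 1 - d) + (d - g y))" by (simp add: algebra_simps)
    also have "\<bar>\<dots>\<bar> = exp a * \<bar>(exp d - 1 - d) + (d - g y)\<bar>" by (simp add: abs_mult)
    also have "\<dots> \<le> exp a * (exp (2*C) * (2*C)^2 * n^2 + C * n^2)"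
      using d2 C(2)[OF y] by (intro mult_left_mono) (auto simp: d_def n_def)
    finally show "\<bar>exp (f y) - exp a - exp a * g y\<bar> \<le> exp a * (exp (2*C) * (2*C)^2 + C) * (xnorm N y)^2"
      by (simp add: n_def algebra_simps)
    show "\<bar>exp a * g y\<bar> \<le> exp a * C * xnorm N y" using C(3)[OF y] by (simp add: abs_mult mult.assoc)
  qed
qed

lemma quad_approx_sum:
  assumes "finite K" "\<And>k. k \<in> K \<Longrightarrow> quad_approx N (f k) (a k) (g k)"
  shows "quad_approx N (\<lambda>y. \<Sum>k\<in>K. f k y) (\<Sum>k\<in>K. a k) (\<lambda>y. \<Sum>k\<in>K. g k y)"
  using assms
proof (induction K rule: finite_induct)
  case empty
  show ?case by (rule quad_approxI[of _ _ _ _ 0 0]) auto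
next
  case (insert k K)
  then show ?case by (simp add: quad_approx_add)
qed

lemma quad_approx_half_fs:
  assumes "finite K"
  shows "quad_approx N (\<lambda>y. \<Sum>k\<in>K. exp (2 * xx (\<lambda>a. x a + y a) j k) * (xx (\<lambda>a. x a + y a) i j * xx (\<lambda>a. x a + y a) j k - xx (\<lambda>a. x a + y a) i k))
    (\<Sum>k\<in>K. exp (2 * xx x j k) * (xx x i j * xx x j k - xx x i k)) (\<lambda>y. half_dfs (xx x) (dxx y) K i j)"
proof -
  have "half_dfs (xx x) (dxx y) K i j = (\<Sum>k\<in>K. (exp (2 * xx x j k) * (2 * dxx y j k)) * (xx x i j * xx x j k - xx x i k)
      + exp (2 * xx x j k) * ((dxx y i j * xx x j k + xx x i j * dxx y j k) - dxx y i k))" for y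
    unfolding half_dfs_def by (rule sum.cong) (simp_all add: algebra_simps)
  then show ?thesis
    by (simp only:) (intro quad_approx_sum[OF assms] quad_approx_mult quad_approx_exp quad_approx_scale quad_approx_diff quad_approx_xx)
qed

lemma fs_quadratic_remainder:
  assumes E: "\<And>i. finite (nbrs E i)"
  shows "\<exists>C\<ge>0. \<forall>y\<in>xi_space N. xnorm N y \<le> 1 \<longrightarrow>
    (\<forall>a. \<bar>fs N E (\<lambda>a. x a + y a) a - fs N E x a - dfs N E x y a\<bar> \<le> C * (xnorm N y)^2)"
proof -
  have "\<exists>C\<ge>0. \<forall>y\<in>xi_space N. xnorm N y \<le> 1 \<longrightarrow>
    \<bar>fs N E (\<lambda>a. x a + y a) a - fs N E x a - dfs N E x y a\<bar> \<le> C * (xnorm N y)^2" if "a \<in> pairs N" for a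
  proof -
    have "quad_approx N (\<lambda>y. fs N E (\<lambda>a. x a + y a) a) (fs N E x a) (\<lambda>y. dfs N E x y a)"
      using that quad_approx_add[OF quad_approx_half_fs[OF E[of "snd a"], of N x "snd a" "fst a"]
          quad_approx_half_fs[OF E[of "fst a"], of N x "fst a" "snd a"]]
      by (simp add: fs_alt dfs_def)
    then obtain C where "quad_bound N (\<lambda>y. fs N E (\<lambda>a. x a + y a) a) (fs N E x a) (\<lambda>y. dfs N E x y a) C" by (rule quad_approxE)
    from quad_boundD(1,2)[OF this] show ?thesis by blast
  qed
  then have "\<forall>a\<in>pairs N. \<exists>C\<ge>0. \<forall>y\<in>xi_space N. xnorm N y \<le> 1 \<longrightarrow>
    \<bar>fs N E (\<lambda>a. x a + y a) a - fs N E x a - dfs N E x y a\<bar> \<le> C * (xnorm N y)^2" by blast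
  from bchoice[OF this] obtain C where C: "\<And>a. a \<in> pairs N \<Longrightarrow> C a \<ge> 0"
    "\<And>a y. a \<in> pairs N \<Longrightarrow> y\<in>xi_space N \<Longrightarrow> xnorm N y \<le> 1 \<Longrightarrow>
    \<bar>fs N E (\<lambda>a. x a + y a) a - fs N E x a - dfs N E x y a\<bar> \<le> C a * (xnorm N y)^2" by blast
  show ?thesis
  proof (intro exI[of _ "\<Sum>a\<in>pairs N. C a"] conjI ballI impI allI)
    show "0 \<le> (\<Sum>a\<in>pairs N. C a)" using C(1) by (simp add: sum_nonneg)
    fix y a assume y: "y \<in> xi_space N" "xnorm N y \<le> 1"
    show "\<bar>fs N E (\<lambda>a. x a + y a) a - fs N E x a - dfs N E x y a\<bar> \<le> (\<Sum>a\<in>pairs N. C a) * (xnorm N y)^2"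
    proof (cases "a \<in> pairs N")
      case True
      have "C a \<le> (\<Sum>a\<in>pairs N. C a)" using True C(1) by (intro member_le_sum) auto
      then have "C a * (xnorm N y)^2 \<le> (\<Sum>a\<in>pairs N. C a) * (xnorm N y)^2" by (intro mult_right_mono) auto
      then show ?thesis using C(2)[OF True y] by linarith
    next
      case False
      then show ?thesis using C(1) by (simp add: fs_alt dfs_def sum_nonneg)
    qed
  qed
qed

section \<open>First variations of the Gram matrix\<close>

text \<open>Four vectors of 3-space, padded by a zero coordinate, are the rows of a 4 by 4 matrix
  with a zero column; the Gram matrix is this matrix times its transpose.\<close>

lemma det4_gram:
  fixes u :: "nat \<Rightarrow> real^3"
  shows "det4 (\<lambda>r s. u r \<bullet> u s) = 0"
proof -
  define c where "c r k = (if k = 0 then u r $ 1 else if k = 1 then u r $ 2 else if k = 2 then u r $ 3 else 0)" for r and k :: nat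
  define A where "A = Matrix.mat 4 4 (\<lambda>(r, k). c r k)"
  have A: "A \<in> carrier_mat 4 4" by (simp add: A_def)
  define M where "M = Matrix.mat 4 4 (\<lambda>(r, s). u r \<bullet> u s)"
  have M: "M = A * transpose_mat A"
    by (rule eq_matI)
      (auto simp: M_def A_def scalar_prod_def c_def inner_vec_def sum_3 numeral_eq_Suc)
  have lt: "\<pi> r < 4" if "\<pi> permutes {0..<4}" "r < 4" for \<pi> :: "nat \<Rightarrow> nat" and r
    using permutes_in_image[OF that(1), of r] that(2) by auto
  have "det4 (\<lambda>r s. u r \<bullet> u s) = Determinant.det M"
    unfolding det4_def Determinant.det_def M_def
    by (auto intro!: sum.cong prod.cong simp: lt)
  also have "\<dots> = Determinant.det A * Determinant.det A"
    unfolding M using A by (simp add: Determinant.det_mult[of A 4] Determinant.det_transpose[OF A])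
  also have "Determinant.det A = 0"
  proof -
    have "(\<Prod>i = 0..<4. A $$ (i, \<pi> i)) = 0" if pp: "\<pi> permutes {0..<4}" for \<pi> :: "nat \<Rightarrow> nat"
    proof -
      have "3 \<in> \<pi> ` {0..<4}" using permutes_image[OF pp] by simp
      then obtain i where i: "3 = \<pi> i" "i \<in> {0..<4}" by (rule imageE)
      then have "A $$ (i, \<pi> i) = 0" unfolding i(1)[symmetric] by (simp add: A_def c_def)
      then show ?thesis using i(2) by (intro prod_zero bexI[of _ i]) simp_all
    qed
    then show ?thesis using A unfolding Determinant.det_def by (simp add: sum.neutral)
  qed
  finally show ?thesis by simp
qed

text \<open>The product rule applied to the Leibniz expansion: the derivative of \<open>det4\<close>
  at \<open>M\<close> in the direction \<open>Y\<close>.\<close>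

definition ddet4 :: "(nat \<Rightarrow> nat \<Rightarrow> real) \<Rightarrow> (nat \<Rightarrow> nat \<Rightarrow> real) \<Rightarrow> real" where
  "ddet4 M Y = (\<Sum>\<pi> | \<pi> permutes {0..<4::nat}. of_int (sign \<pi>) *
     (\<Sum>r\<in>{0..<4}. Y r (\<pi> r) * (\<Prod>r'\<in>{0..<4} - {r}. M r' (\<pi> r'))))"

lemma det4_DERIV:
  assumes "\<And>r s. r < 4 \<Longrightarrow> s < 4 \<Longrightarrow> ((\<lambda>t. M t r s) has_real_derivative Y r s) (at t0)"
  shows "((\<lambda>t. det4 (M t)) has_real_derivative ddet4 (M t0) Y) (at t0)"
  unfolding det4_def ddet4_def
proof (intro DERIV_sum DERIV_cmult has_field_derivative_prod)
  fix \<pi> :: "nat \<Rightarrow> nat" and r :: nat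
  assume "\<pi> \<in> {\<pi>. \<pi> permutes {0..<4}}" "r \<in> {0..<4}"
  then have "r < 4" "\<pi> r < 4" using permutes_in_image[of \<pi> "{0..<4}" r] by auto
  then show "((\<lambda>t. M t r (\<pi> r)) has_real_derivative Y r (\<pi> r)) (at t0)" by (rule assms)
qed

lemma ddet4_cong:
  assumes "\<And>r s. r < 4 \<Longrightarrow> s < 4 \<Longrightarrow> M r s = M' r s" "\<And>r s. r < 4 \<Longrightarrow> s < 4 \<Longrightarrow> Y r s = Y' r s"
  shows "ddet4 M Y = ddet4 M' Y'"
proof -
  have "\<pi> r < 4" if "\<pi> permutes {0..<4}" "r < 4" for \<pi> :: "nat \<Rightarrow> nat" and r
    using permutes_in_image[OF that(1), of r] that(2) by auto
  then show ?thesis unfolding ddet4_def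
    by (intro sum.cong refl arg_cong2[of _ _ _ _ "(*)"] prod.cong) (auto simp: assms)
qed

lemma ddet4_add: "ddet4 M (\<lambda>r s. Y r s + Z r s) = ddet4 M Y + ddet4 M Z"
  by (simp add: ddet4_def algebra_simps sum.distrib)

lemma ddet4_scale: "ddet4 M (\<lambda>r s. c * Y r s) = c * ddet4 M Y"
  by (simp add: ddet4_def sum_distrib_left algebra_simps)

definition gram_deriv :: "nat \<Rightarrow> (nat \<Rightarrow> real^3) \<Rightarrow> (nat \<Rightarrow> real^3) \<Rightarrow> nat \<times> nat \<Rightarrow> real" where
  "gram_deriv N \<Gamma> v a = (if a \<in> pairs N then v (fst a) \<bullet> \<Gamma> (snd a) + \<Gamma> (fst a) \<bullet> v (snd a) else 0)"

lemma gram_deriv_xi_space: "gram_deriv N \<Gamma> v \<in> xi_space N"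
  by (simp add: xi_space_def gram_deriv_def)

lemma xx_xi_of:
  assumes "i \<in> {1..N}" "j \<in> {1..N}" "norm (\<Gamma> i) = 1"
  shows "xx (xi_of N \<Gamma>) i j = \<Gamma> i \<bullet> \<Gamma> j"
  using assms by (auto simp: xx_def xi_of_def pairs_def norm_eq_1 inner_commute)

lemma dxx_gram_deriv:
  assumes "i \<in> {1..N}" "j \<in> {1..N}" "v i \<bullet> \<Gamma> i = 0"
  shows "dxx (gram_deriv N \<Gamma> v) i j = v i \<bullet> \<Gamma> j + \<Gamma> i \<bullet> v j"
  using assms by (auto simp: dxx_def gram_deriv_def pairs_def inner_commute)

text \<open>Unit diagonal entries and those of a tangential variation agree to first order, so the derivative
  of \<open>gC C\<close> may be computed on honest Gram matrices, where the determinant vanishes.\<close>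
lemma gC_gram_deriv:
  assumes C: "C \<subseteq> {1..N}" "card C = 4" and unit: "\<And>i. i \<in> {1..N} \<Longrightarrow> norm (\<Gamma> i) = 1"
    and tang: "\<And>i. i \<in> {1..N} \<Longrightarrow> v i \<bullet> \<Gamma> i = 0"
  shows "(\<Sum>b\<in>pairs N. pderiv_xi (gC C) (xi_of N \<Gamma>) b * gram_deriv N \<Gamma> v b) = 0"
proof -
  define x where "x = xi_of N \<Gamma>"
  define cs where "cs = sorted_list_of_set C"
  have "finite C" using C finite_subset by blast
  then have cs: "cs ! r \<in> {1..N}" if "r < 4" for r
    using that C nth_mem[of r cs] by (auto simp: cs_def)
  let ?X = "\<lambda>r s. xx x (cs ! r) (cs ! s)"
  let ?D = "\<lambda>y. ddet4 ?X (\<lambda>r s. dxx y (cs ! r) (cs ! s))"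
  have D: "((\<lambda>s. gC C (\<lambda>a. x a + s * y a)) has_real_derivative ?D y) (at 0)" for y
  proof -
    let ?M = "\<lambda>t r s. xx x (cs ! r) (cs ! s) + t * dxx y (cs ! r) (cs ! s)"
    have "((\<lambda>t. det4 (?M t)) has_real_derivative ddet4 (?M 0) (\<lambda>r s. dxx y (cs ! r) (cs ! s))) (at 0)"
      by (rule det4_DERIV) (auto intro!: derivative_eq_intros)
    then show ?thesis unfolding gC_def Let_def cs_def[symmetric] xx_line by simp
  qed
  have "(\<Sum>b\<in>pairs N. pderiv_xi (gC C) x b * gram_deriv N \<Gamma> v b) = ?D (gram_deriv N \<Gamma> v)"
    by (rule sum_pderiv_xi[OF D _ _ gram_deriv_xi_space]) (simp_all add: dxx_linear ddet4_add ddet4_scale)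
  also have "\<dots> = 0"
  proof -
    \<comment> \<open>This curve leaves the sphere, but the Gram determinant of four vectors of
      3-space vanishes whatever their lengths.\<close>
    let ?u = "\<lambda>t r. \<Gamma> (cs ! r) + t *\<^sub>R v (cs ! r)"
    let ?Y = "\<lambda>r s. v (cs ! r) \<bullet> \<Gamma> (cs ! s) + \<Gamma> (cs ! r) \<bullet> v (cs ! s)"
    have "((\<lambda>t. ?u t r \<bullet> ?u t s) has_real_derivative ?Y r s) (at 0)" for r s
      by (auto intro!: derivative_eq_intros simp: inner_add_left inner_add_right has_field_derivative_def[symmetric])
    then have "((\<lambda>t. det4 (\<lambda>r s. ?u t r \<bullet> ?u t s)) has_real_derivative ddet4 (\<lambda>r s. ?u 0 r \<bullet> ?u 0 s) ?Y) (at 0)"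
      by (intro det4_DERIV[of "\<lambda>t r s. ?u t r \<bullet> ?u t s"])
    then have "((\<lambda>t. 0) has_real_derivative ddet4 (\<lambda>r s. ?u 0 r \<bullet> ?u 0 s) ?Y) (at 0)"
      unfolding det4_gram .
    then have "ddet4 (\<lambda>r s. ?u 0 r \<bullet> ?u 0 s) ?Y = 0" using DERIV_const DERIV_unique by blast
    moreover have "?D (gram_deriv N \<Gamma> v) = ddet4 (\<lambda>r s. ?u 0 r \<bullet> ?u 0 s) ?Y"
      using cs by (intro ddet4_cong) (simp_all only: x_def xx_xi_of unit dxx_gram_deriv tang scaleR_zero_left add_0_right)
    ultimately show ?thesis by simp
  qed
  finally show ?thesis by (simp add: x_def)
qed

text \<open>Since the velocity vanishes at \<open>\<Gamma>\<close>, the variation \<open>w\<close> is the linearised velocity field at \<open>v\<close>.\<close>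
lemma dfs_gram_deriv:
  assumes unit: "\<And>i. i \<in> {1..N} \<Longrightarrow> norm (\<Gamma> i) = 1" and tang: "\<And>i. i \<in> {1..N} \<Longrightarrow> v i \<bullet> \<Gamma> i = 0"
    and E: "\<And>i. nbrs E i \<subseteq> {1..N}"
    and equi: "\<And>i. i \<in> {1..N} \<Longrightarrow> (\<Sum>k\<in>nbrs E i. exp (2 * (\<Gamma> i \<bullet> \<Gamma> k)) *\<^sub>R (\<Gamma> k - (\<Gamma> i \<bullet> \<Gamma> k) *\<^sub>R \<Gamma> i)) = 0"
  shows "\<exists>w. (\<forall>i\<in>{1..N}. w i \<bullet> \<Gamma> i = 0) \<and> dfs N E (xi_of N \<Gamma>) (gram_deriv N \<Gamma> v) = gram_deriv N \<Gamma> w"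
proof -
  define X where "X i j = \<Gamma> i \<bullet> \<Gamma> j" for i j
  define Y where "Y i j = v i \<bullet> \<Gamma> j + \<Gamma> i \<bullet> v j" for i j
  define c where "c i k = exp (2 * X i k)" for i k
  \<comment> \<open>Up to the weight \<open>c i k\<close>, this is the derivative along
    \<open>v\<close> of the summand \<open>exp (2 * X i k) *\<^sub>R (X i k *\<^sub>R \<Gamma> i -
    \<Gamma> k)\<close> of the velocity of the \<open>i\<close>-th vector.\<close>
  define z where "z i k = (2 * Y i k) *\<^sub>R (X i k *\<^sub>R \<Gamma> i - \<Gamma> k) + (Y i k *\<^sub>R \<Gamma> i + X i k *\<^sub>R v i - v k)" for i k
  define w where "w i = (\<Sum>k\<in>nbrs E i. c i k *\<^sub>R z i k)" for i
  have eq0: "(\<Sum>k\<in>nbrs E i. c i k * (\<Gamma> k \<bullet> y - X i k * (\<Gamma> i \<bullet> y))) = 0" if "i \<in> {1..N}" for i y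
  proof -
    have "(\<Sum>k\<in>nbrs E i. c i k *\<^sub>R (\<Gamma> k - X i k *\<^sub>R \<Gamma> i)) \<bullet> y = 0" using equi[OF that] by (simp add: c_def X_def)
    then show ?thesis by (simp add: inner_sum_left inner_diff_left)
  qed
  have half: "half_dfs (xx (xi_of N \<Gamma>)) (dxx (gram_deriv N \<Gamma> v)) (nbrs E i) j i = w i \<bullet> \<Gamma> j"
    if ij: "i \<in> {1..N}" "j \<in> {1..N}" for i j
  proof -
    have "half_dfs (xx (xi_of N \<Gamma>)) (dxx (gram_deriv N \<Gamma> v)) (nbrs E i) j i =
      (\<Sum>k\<in>nbrs E i. c i k * (2 * Y i k * (X j i * X i k - X j k) + (Y j i * X i k + X j i * Y i k - Y j k)))" (is "_ = sum ?g _")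
      unfolding half_dfs_def
    proof (rule sum.cong[OF refl])
      fix k assume "k \<in> nbrs E i"
      then have "k \<in> {1..N}" by (rule subsetD[OF E])
      then show "exp (2 * xx (xi_of N \<Gamma>) i k) * (2 * dxx (gram_deriv N \<Gamma> v) i k * (xx (xi_of N \<Gamma>) j i * xx (xi_of N \<Gamma>) i k - xx (xi_of N \<Gamma>) j k) +
          (dxx (gram_deriv N \<Gamma> v) j i * xx (xi_of N \<Gamma>) i k + xx (xi_of N \<Gamma>) j i * dxx (gram_deriv N \<Gamma> v) i k -
           dxx (gram_deriv N \<Gamma> v) j k)) = ?g k"
        by (simp only: xx_xi_of dxx_gram_deriv ij unit tang c_def X_def Y_def)
    qed
    \<comment> \<open>Product rule for velocity times \<open>\<Gamma> j\<close>: the subtracted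
      terms come from differentiating \<open>\<Gamma> j\<close> and add up to the velocity at
      equilibrium paired with \<open>v j\<close>, which is zero.\<close>
    also have "\<dots> = (\<Sum>k\<in>nbrs E i. (c i k *\<^sub>R z i k) \<bullet> \<Gamma> j
        - c i k * (\<Gamma> k \<bullet> v j - X i k * (\<Gamma> i \<bullet> v j)))"
    proof (rule sum.cong[OF refl])
      fix k
      note sym = inner_commute[of "\<Gamma> j" "\<Gamma> i"] inner_commute[of "\<Gamma> j" "\<Gamma> k"] inner_commute[of "v j" "\<Gamma> i"]
        inner_commute[of "v j" "\<Gamma> k"] inner_commute[of "\<Gamma> j" "v i"] inner_commute[of "\<Gamma> j" "v k"]
      show "c i k * (2 * Y i k * (X j i * X i k - X j k) + (Y j i * X i k + X j i * Y i k - Y j k)) =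
          (c i k *\<^sub>R z i k) \<bullet> \<Gamma> j
          - c i k * (\<Gamma> k \<bullet> v j - X i k * (\<Gamma> i \<bullet> v j))"
        unfolding z_def X_def Y_def sym by (simp add: inner_add_left inner_diff_left algebra_simps)
    qed
    also have "\<dots> = w i \<bullet> \<Gamma> j - (\<Sum>k\<in>nbrs E i. c i k * (\<Gamma> k \<bullet> v j - X i k * (\<Gamma> i \<bullet> v j)))"
      unfolding w_def inner_sum_left by (rule sum_subtractf)
    also have "(\<Sum>k\<in>nbrs E i. c i k * (\<Gamma> k \<bullet> v j - X i k * (\<Gamma> i \<bullet> v j))) = 0" by (rule eq0[OF ij(1)])
    finally show ?thesis by simp
  qed
  have wt: "w i \<bullet> \<Gamma> i = 0" if i: "i \<in> {1..N}" for i
  proof -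
    have ii: "\<Gamma> i \<bullet> \<Gamma> i = 1" "v i \<bullet> \<Gamma> i = 0" "\<Gamma> i \<bullet> v i = 0" using unit[OF i] tang[OF i] by (simp_all add: norm_eq_1 inner_commute)
    have "w i \<bullet> \<Gamma> i = (\<Sum>k\<in>nbrs E i. c i k * (\<Gamma> k \<bullet> v i - X i k * (\<Gamma> i \<bullet> v i)))"
      unfolding w_def inner_sum_left
    proof (intro sum.cong[OF refl])
      fix k
      note sym = inner_commute[of "\<Gamma> k" "\<Gamma> i"] inner_commute[of "v k" "\<Gamma> i"] inner_commute[of "\<Gamma> k" "v i"]
      show "c i k *\<^sub>R z i k \<bullet> \<Gamma> i =
          c i k * (\<Gamma> k \<bullet> v i - X i k * (\<Gamma> i \<bullet> v i))"
        by (simp add: z_def X_def Y_def inner_add_left inner_diff_left sym ii algebra_simps)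
    qed
    then show ?thesis using eq0[OF i] by simp
  qed
  have "dfs N E (xi_of N \<Gamma>) (gram_deriv N \<Gamma> v) a = gram_deriv N \<Gamma> w a" for a
  proof (cases "a \<in> pairs N")
    case True
    then have "fst a \<in> {1..N}" "snd a \<in> {1..N}" by (auto simp: pairs_def)
    then show ?thesis using True by (simp only: dfs_def gram_deriv_def half if_True) (simp add: inner_commute)
  qed (simp add: dfs_def gram_deriv_def)
  then show ?thesis using wt by blast
qed

lemma gram_deriv_subset_max_invariant:
  assumes unit: "\<And>i. i \<in> {1..N} \<Longrightarrow> norm (\<Gamma> i) = 1" and E: "\<And>i. nbrs E i \<subseteq> {1..N}"
    and equi: "\<And>i. i \<in> {1..N} \<Longrightarrow> (\<Sum>k\<in>nbrs E i. exp (2 * (\<Gamma> i \<bullet> \<Gamma> k)) *\<^sub>R (\<Gamma> k - (\<Gamma> i \<bullet> \<Gamma> k) *\<^sub>R \<Gamma> i)) = 0"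
    and C: "\<And>r. r < m \<Longrightarrow> C r \<subseteq> {1..N} \<and> card (C r) = 4"
    and W: "max_invariant_subspace N (jacobian_fs N E (xi_of N \<Gamma>))
        {x \<in> xi_space N. \<forall>r<m. (\<Sum>b\<in>pairs N. pderiv_xi (gC (C r)) (xi_of N \<Gamma>) b * x b) = 0} W"
    and tang: "\<And>i. i \<in> {1..N} \<Longrightarrow> v i \<bullet> \<Gamma> i = 0"
  shows "gram_deriv N \<Gamma> v \<in> W"
proof -
  let ?V = "{x \<in> xi_space N. \<forall>r<m. (\<Sum>b\<in>pairs N. pderiv_xi (gC (C r)) (xi_of N \<Gamma>) b * x b) = 0}"
  let ?A = "jacobian_fs N E (xi_of N \<Gamma>)"
  define U where "U = {gram_deriv N \<Gamma> v | v. \<forall>i\<in>{1..N}. v i \<bullet> \<Gamma> i = 0}"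
  have UI: "gram_deriv N \<Gamma> v \<in> U" if "\<And>i. i \<in> {1..N} \<Longrightarrow> v i \<bullet> \<Gamma> i = 0" for v
    using that unfolding U_def by blast
  have UE: "\<exists>v. y = gram_deriv N \<Gamma> v \<and> (\<forall>i\<in>{1..N}. v i \<bullet> \<Gamma> i = 0)" if "y \<in> U" for y
    using that unfolding U_def by blast
  have "lin_subspace N U"
    unfolding lin_subspace_def
  proof (intro conjI ballI allI)
    show "U \<subseteq> xi_space N" unfolding U_def using gram_deriv_xi_space by auto
    have "gram_deriv N \<Gamma> (\<lambda>i. 0) = (\<lambda>_. 0)" by (auto simp: gram_deriv_def)
    then show "(\<lambda>_. 0) \<in> U" using UI[of "\<lambda>i. 0"] by simp
    fix x assume "x \<in> U"
    then obtain v where v: "x = gram_deriv N \<Gamma> v" "\<forall>i\<in>{1..N}. v i \<bullet> \<Gamma> i = 0" using UE by blast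
    show "(\<lambda>a. c * x a) \<in> U" for c
    proof -
      have "(\<lambda>a. c * x a) = gram_deriv N \<Gamma> (\<lambda>i. c *\<^sub>R v i)" by (auto simp: v gram_deriv_def algebra_simps)
      then show ?thesis using UI[of "\<lambda>i. c *\<^sub>R v i"] v by simp
    qed
    fix y assume "y \<in> U"
    then obtain w where w: "y = gram_deriv N \<Gamma> w" "\<forall>i\<in>{1..N}. w i \<bullet> \<Gamma> i = 0" using UE by blast
    have "(\<lambda>a. x a + y a) = gram_deriv N \<Gamma> (\<lambda>i. v i + w i)"
      by (auto simp: v w gram_deriv_def inner_add_left inner_add_right)
    then show "(\<lambda>a. x a + y a) \<in> U" using UI[of "\<lambda>i. v i + w i"] v w by (simp add: inner_add_left)
  qed
  moreover have "U \<subseteq> ?V"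
  proof
    fix y assume "y \<in> U"
    then obtain v where v: "y = gram_deriv N \<Gamma> v" "\<forall>i\<in>{1..N}. v i \<bullet> \<Gamma> i = 0" using UE by blast
    have "(\<Sum>b\<in>pairs N. pderiv_xi (gC (C r)) (xi_of N \<Gamma>) b * gram_deriv N \<Gamma> v b) = 0" if "r < m" for r
      by (rule gC_gram_deriv) (use C[OF that] unit v in auto)
    then show "y \<in> ?V" unfolding v(1) using gram_deriv_xi_space by simp
  qed
  moreover have "mat_app N ?A ` U \<subseteq> U"
  proof (rule image_subsetI)
    fix y assume "y \<in> U"
    then obtain v where v: "y = gram_deriv N \<Gamma> v" "\<forall>i\<in>{1..N}. v i \<bullet> \<Gamma> i = 0" using UE by blast
    obtain w where w: "\<forall>i\<in>{1..N}. w i \<bullet> \<Gamma> i = 0" "dfs N E (xi_of N \<Gamma>) (gram_deriv N \<Gamma> v) = gram_deriv N \<Gamma> w"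
      using dfs_gram_deriv[OF unit bspec[OF v(2)] E equi] by blast
    have "mat_app N ?A y = gram_deriv N \<Gamma> w"
      unfolding v(1) w(2)[symmetric] by (rule ext) (rule mat_app_jacobian[OF gram_deriv_xi_space])
    then show "mat_app N ?A y \<in> U" using UI w(1) by simp
  qed
  ultimately have "U \<subseteq> W" using W unfolding max_invariant_subspace_def by blast
  then show ?thesis using UI[OF tang] by blast
qed

section \<open>Gram matrices near the formation and their tangent space\<close>

text \<open>The basis is recorded by its indices so that the coefficients
  \<open>e b \<bullet> x\<close> can later be combined with a perturbed family in place of
  \<open>\<Gamma>\<close>. Coordinate functionals become vectors through the adjoint.\<close>

lemma dual_basis_subfamily:
  fixes \<Gamma> :: "'i \<Rightarrow> 'a::euclidean_space"
  assumes "finite I" and span: "span (\<Gamma> ` I) = UNIV"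
  shows "\<exists>B e. B \<subseteq> I \<and> (\<forall>x. x = (\<Sum>b\<in>B. (e b \<bullet> x) *\<^sub>R \<Gamma> b))"
proof -
  obtain S where S: "S \<subseteq> \<Gamma> ` I" "independent S" "\<Gamma> ` I \<subseteq> span S"
    using maximal_independent_subset[of "\<Gamma> ` I"] by blast
  obtain B where B: "B \<subseteq> I" "inj_on \<Gamma> B" "S = \<Gamma> ` B"
    using S(1) unfolding subset_image_inj by blast
  have spanS: "span S = UNIV" using span_mono[OF S(3)] unfolding span span_span by auto
  have finB: "finite B" using B(1) \<open>finite I\<close> finite_subset by blast
  have "\<forall>b\<in>B. \<exists>e. \<forall>b'\<in>B. e \<bullet> \<Gamma> b' = (if b' = b then 1 else 0)"
  proof
    fix b assume b: "b \<in> B"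
    obtain g :: "'a \<Rightarrow> real" where g: "linear g" "\<forall>x\<in>S. g x = (if x = \<Gamma> b then 1 else 0)"
      using linear_independent_extend[OF S(2), of "\<lambda>x. if x = \<Gamma> b then 1 else 0"] by blast
    show "\<exists>e. \<forall>b'\<in>B. e \<bullet> \<Gamma> b' = (if b' = b then 1 else 0)"
    proof (intro exI[of _ "adjoint g 1"] ballI)
      fix b' assume b': "b' \<in> B"
      have "adjoint g 1 \<bullet> \<Gamma> b' = g (\<Gamma> b')" using adjoint_works[OF g(1), of "\<Gamma> b'" 1] by (simp add: inner_commute)
      also have "\<dots> = (if \<Gamma> b' = \<Gamma> b then 1 else 0)" using g(2) b' B(3) by simp
      also have "\<Gamma> b' = \<Gamma> b \<longleftrightarrow> b' = b" using inj_on_eq_iff[OF B(2) b' b] .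
      finally show "adjoint g 1 \<bullet> \<Gamma> b' = (if b' = b then 1 else 0)" .
    qed
  qed
  from bchoice[OF this] obtain e where e: "\<forall>b\<in>B. \<forall>b'\<in>B. e b \<bullet> \<Gamma> b' = (if b' = b then 1 else 0)" ..
  have "x = (\<Sum>b\<in>B. (e b \<bullet> x) *\<^sub>R \<Gamma> b)" for x
  proof (rule linear_eq_on_span[of "\<lambda>x. x" "\<lambda>x. \<Sum>b\<in>B. (e b \<bullet> x) *\<^sub>R \<Gamma> b" S])
    show "linear (\<lambda>x. x)" by (rule linear_ident)
    show "linear (\<lambda>x. \<Sum>b\<in>B. (e b \<bullet> x) *\<^sub>R \<Gamma> b)"
      by (rule linearI) (simp_all add: inner_add_right scaleR_add_left sum.distrib scaleR_sum_right)
    show "x \<in> span S" using spanS by simp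
    fix y assume "y \<in> S"
    then obtain b' where b': "b' \<in> B" "y = \<Gamma> b'" using B(3) by auto
    have "(\<Sum>b\<in>B. (e b \<bullet> y) *\<^sub>R \<Gamma> b) = (\<Sum>b\<in>B. if b = b' then \<Gamma> b else 0)"
      unfolding b'(2) by (rule sum.cong[OF refl]) (use e b'(1) in auto)
    also have "\<dots> = y" using finB b' by (simp add: sum.delta)
    finally show "y = (\<Sum>b\<in>B. (e b \<bullet> y) *\<^sub>R \<Gamma> b)" ..
  qed
  then show ?thesis using B(1) by blast
qed

text \<open>\<open>L\<close> replaces the basis \<open>\<Gamma> b\<close> by \<open>G b\<close> in
  the expansion. Only inner products over \<open>B\<close> are compared, and they give \<open>x
  \<bullet> x - L x \<bullet> L x \<le> M^2 * d * (x \<bullet> x)\<close>; the bound 3/4 turns this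
  into \<open>norm x \<le> 2 * norm (L x)\<close>. So \<open>L\<close> is onto, and for
  \<open>D = L x\<close> the square of \<open>norm D\<close> is the combination of the numbers
  \<open>D \<bullet> G b\<close> with coefficients \<open>e b \<bullet> x\<close>.\<close>

lemma norm_le_inner_perturbed_basis:
  fixes \<Gamma> G e :: "nat \<Rightarrow> real^3"
  assumes exp: "\<And>x. x = (\<Sum>b\<in>B. (e b \<bullet> x) *\<^sub>R \<Gamma> b)"
    and M: "(\<Sum>b\<in>B. norm (e b)) \<le> M" and close: "\<And>b b'. b \<in> B \<Longrightarrow> b' \<in> B \<Longrightarrow> \<bar>G b \<bullet> G b' - \<Gamma> b \<bullet> \<Gamma> b'\<bar> \<le> d"
    and small: "M^2 * d \<le> 3/4" and h0: "0 \<le> h" and h: "\<And>b. b \<in> B \<Longrightarrow> \<bar>D \<bullet> G b\<bar> \<le> h"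
  shows "norm D \<le> 2 * M * h"
proof -
  define L where "L x = (\<Sum>b\<in>B. (e b \<bullet> x) *\<^sub>R G b)" for x
  have M0: "0 \<le> M" using M sum_nonneg[of B "\<lambda>b. norm (e b)"] by simp
  have linL: "linear L" unfolding L_def
    by (rule linearI) (simp_all add: inner_add_right scaleR_add_left sum.distrib scaleR_sum_right)
  have ex: "(\<Sum>b\<in>B. \<bar>e b \<bullet> x\<bar>) \<le> M * norm x" for x
  proof -
    have "(\<Sum>b\<in>B. \<bar>e b \<bullet> x\<bar>) \<le> (\<Sum>b\<in>B. norm (e b) * norm x)" by (intro sum_mono Cauchy_Schwarz_ineq2)
    also have "\<dots> \<le> M * norm x" unfolding sum_distrib_right[symmetric] using M by (intro mult_right_mono) auto
    finally show ?thesis .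
  qed
  have half: "norm x \<le> 2 * norm (L x)" for x
  proof (cases "B = {}")
    case True
    then have "x = 0" using exp[of x] by simp
    then show ?thesis by simp
  next
    case False
    then obtain b0 where "b0 \<in> B" by blast
    then have d0: "0 \<le> d" using close[of b0 b0] by linarith
    have "L x \<bullet> L x = (\<Sum>b\<in>B. \<Sum>b'\<in>B. (e b \<bullet> x) * (e b' \<bullet> x) * (G b' \<bullet> G b))"
      by (simp add: L_def inner_sum_left inner_sum_right sum_distrib_left mult.assoc)
    moreover have "x \<bullet> x = (\<Sum>b\<in>B. \<Sum>b'\<in>B. (e b \<bullet> x) * (e b' \<bullet> x) * (\<Gamma> b' \<bullet> \<Gamma> b))"
      by (subst (1 2) exp[of x]) (simp add: inner_sum_left inner_sum_right sum_distrib_left mult.assoc)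
    ultimately have "x \<bullet> x - L x \<bullet> L x = (\<Sum>b\<in>B. \<Sum>b'\<in>B. (e b \<bullet> x) * (e b' \<bullet> x) * (\<Gamma> b' \<bullet> \<Gamma> b - G b' \<bullet> G b))"
      by (simp add: sum_subtractf right_diff_distrib)
    also have "\<dots> \<le> (\<Sum>b\<in>B. \<Sum>b'\<in>B. \<bar>e b \<bullet> x\<bar> * \<bar>e b' \<bullet> x\<bar> * d)"
    proof (intro sum_mono)
      fix b b' assume b: "b \<in> B" "b' \<in> B"
      have "(e b \<bullet> x) * (e b' \<bullet> x) * (\<Gamma> b' \<bullet> \<Gamma> b - G b' \<bullet> G b) \<le> \<bar>(e b \<bullet> x) * (e b' \<bullet> x) * (\<Gamma> b' \<bullet> \<Gamma> b - G b' \<bullet> G b)\<bar>" by simp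
      also have "\<dots> \<le> \<bar>e b \<bullet> x\<bar> * \<bar>e b' \<bullet> x\<bar> * d"
        unfolding abs_mult using close[OF b(2,1)] by (intro mult_left_mono) (simp_all add: abs_minus_commute)
      finally show "(e b \<bullet> x) * (e b' \<bullet> x) * (\<Gamma> b' \<bullet> \<Gamma> b - G b' \<bullet> G b) \<le> \<bar>e b \<bullet> x\<bar> * \<bar>e b' \<bullet> x\<bar> * d" .
    qed
    also have "\<dots> = (\<Sum>b\<in>B. \<bar>e b \<bullet> x\<bar>) * (\<Sum>b\<in>B. \<bar>e b \<bullet> x\<bar>) * d"
      unfolding sum_product unfolding sum_distrib_right ..
    also have "\<dots> \<le> (M * norm x) * (M * norm x) * d"
      using ex[of x] d0 M0 by (intro mult_right_mono mult_mono) (auto intro: sum_nonneg)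
    also have "\<dots> = (M^2 * d) * (x \<bullet> x)" by (simp add: power2_eq_square dot_square_norm)
    also have "\<dots> \<le> 3/4 * (x \<bullet> x)" using small by (intro mult_right_mono) auto
    finally have "x \<bullet> x \<le> 4 * (L x \<bullet> L x)" by simp
    then have "(norm x)^2 \<le> (2 * norm (L x))^2" by (simp add: dot_square_norm power_mult_distrib)
    then show ?thesis by (rule power2_le_imp_le) simp
  qed
  have "inj L"
  proof (rule injI)
    fix x y assume "L x = L y"
    then have "L (x - y) = 0" using linL by (simp add: linear_diff)
    then show "x = y" using half[of "x - y"] by simp
  qed
  then have "surj L" using linL by (simp add: linear_injective_imp_surjective)
  then obtain x where x: "D = L x" by (metis surjD)
  have "norm D * norm D = D \<bullet> L x" using x by (simp add: dot_square_norm power2_eq_square)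
  also have "\<dots> = (\<Sum>b\<in>B. (e b \<bullet> x) * (D \<bullet> G b))" by (simp add: L_def inner_sum_right)
  also have "\<dots> \<le> (\<Sum>b\<in>B. \<bar>e b \<bullet> x\<bar> * h)"
  proof (rule sum_mono)
    fix b assume b: "b \<in> B"
    have "(e b \<bullet> x) * (D \<bullet> G b) \<le> \<bar>e b \<bullet> x\<bar> * \<bar>D \<bullet> G b\<bar>" unfolding abs_mult[symmetric] by simp
    also have "\<dots> \<le> \<bar>e b \<bullet> x\<bar> * h" using h[OF b] by (intro mult_left_mono) auto
    finally show "(e b \<bullet> x) * (D \<bullet> G b) \<le> \<bar>e b \<bullet> x\<bar> * h" .
  qed
  finally have Dh: "norm D * norm D \<le> (\<Sum>b\<in>B. \<bar>e b \<bullet> x\<bar>) * h" by (simp add: sum_distrib_right)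
  have "(\<Sum>b\<in>B. \<bar>e b \<bullet> x\<bar>) * h \<le> (M * norm x) * h" using ex h0 by (intro mult_right_mono)
  also have "\<dots> \<le> (M * (2 * norm D)) * h" using half[of x] x M0 h0 by (intro mult_right_mono mult_left_mono) auto
  finally have "norm D * norm D \<le> (2 * M * h) * norm D" using Dh by (simp add: algebra_simps)
  then show ?thesis using M0 h0 by (cases "norm D = 0") auto
qed

definition gram_dev :: "nat \<Rightarrow> (nat \<Rightarrow> real^3) \<Rightarrow> (nat \<Rightarrow> real^3) \<Rightarrow> nat \<times> nat \<Rightarrow> real" where
  "gram_dev N \<Gamma> G a = xi_of N G a - xi_of N \<Gamma> a"

text \<open>With \<open>D i\<close> the defect of the linear relation of \<open>\<Gamma>\<close> expressing the \<open>i\<close>-th vector in the basis, the Gram matrix of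
  \<open>D\<close> is exactly the deviation of \<open>G\<close> from its linear approximation, hence quadratically small.\<close>
lemma gram_tangent_approx:
  fixes \<Gamma> :: "nat \<Rightarrow> real^3"
  assumes unit: "\<And>i. i \<in> {1..N} \<Longrightarrow> norm (\<Gamma> i) = 1" and span: "span (\<Gamma> ` {1..N}) = UNIV"
  shows "\<exists>C\<ge>0. \<exists>r>0. \<forall>G. (\<forall>i\<in>{1..N}. norm (G i) = 1) \<longrightarrow>
    xnorm N (gram_dev N \<Gamma> G) \<le> r \<longrightarrow>
    (\<exists>v. (\<forall>i\<in>{1..N}. v i \<bullet> \<Gamma> i = 0) \<and>
      xnorm N (\<lambda>a. gram_dev N \<Gamma> G a - gram_deriv N \<Gamma> v a) \<le> C * (xnorm N (gram_dev N \<Gamma> G))^2)"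
proof -
  obtain B e where BI: "B \<subseteq> {1..N}" and "\<forall>x. x = (\<Sum>b\<in>B. (e b \<bullet> x) *\<^sub>R \<Gamma> b)"
    using dual_basis_subfamily[OF finite_atLeastAtMost span] by blast
  then have exp: "\<And>x. x = (\<Sum>b\<in>B. (e b \<bullet> x) *\<^sub>R \<Gamma> b)" by blast
  define c where "c i b = e b \<bullet> \<Gamma> i" for i b
  have \<Gamma>c: "\<Gamma> i = (\<Sum>b\<in>B. c i b *\<^sub>R \<Gamma> b)" for i unfolding c_def by (rule exp)
  define M where "M = (\<Sum>b\<in>B. norm (e b)) + 1"
  have M1: "1 \<le> M" by (simp add: M_def sum_nonneg)
  have cM: "(\<Sum>b\<in>B. \<bar>c i b\<bar>) \<le> M" if "i \<in> {1..N}" for i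
  proof -
    have "(\<Sum>b\<in>B. \<bar>c i b\<bar>) \<le> (\<Sum>b\<in>B. norm (e b) * norm (\<Gamma> i))"
      unfolding c_def by (intro sum_mono Cauchy_Schwarz_ineq2)
    then show ?thesis using unit[OF that] by (simp add: M_def)
  qed
  define K where "K = (2 * M * (1 + M))^2"
  define C where "C = (\<Sum>a\<in>pairs N. 2 * K)"
  \<comment> \<open>Exactly the smallness that the perturbed basis estimate asks for; the summand 1
    in \<open>M\<close> keeps the denominator positive.\<close>
  define r where "r = 3/4 / M^2"
  show ?thesis
  proof (rule exI[of _ C], rule conjI, goal_cases)
    case 1
    show "C \<ge> 0" by (simp add: C_def K_def sum_nonneg)
  next
    case 2
    show ?case
    proof (rule exI[of _ r], intro conjI allI impI)
    show "r > 0" using M1 by (simp add: r_def)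
    fix G :: "nat \<Rightarrow> real^3"
    assume uG: "\<forall>i\<in>{1..N}. norm (G i) = 1" and small: "xnorm N (gram_dev N \<Gamma> G) \<le> r"
    define d where "d = xnorm N (gram_dev N \<Gamma> G)"
    have d0: "0 \<le> d" by (simp add: d_def)
    define \<Delta> where "\<Delta> i j = G i \<bullet> G j - \<Gamma> i \<bullet> \<Gamma> j" for i j
    have \<Delta>sym: "\<Delta> i j = \<Delta> j i" for i j by (simp add: \<Delta>_def inner_commute)
    have \<Delta>pair: "\<Delta> i j = gram_dev N \<Gamma> G (i, j)" if "(i, j) \<in> pairs N" for i j
      using that by (simp add: \<Delta>_def gram_dev_def xi_of_def)
    have \<Delta>lt: "\<bar>\<Delta> i j\<bar> \<le> d" if "(i, j) \<in> pairs N" for i j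
      unfolding \<Delta>pair[OF that] d_def by (rule abs_le_xnorm[OF that])
    have \<Delta>0: "\<Delta> i i = 0" if "i \<in> {1..N}" for i
    proof -
      have "G i \<bullet> G i = 1" "\<Gamma> i \<bullet> \<Gamma> i = 1" using uG unit that by (simp_all add: norm_eq_1[symmetric])
      then show ?thesis by (simp add: \<Delta>_def)
    qed
    have \<Delta>d: "\<bar>\<Delta> i j\<bar> \<le> d" if "i \<in> {1..N}" "j \<in> {1..N}" for i j
    proof (rule linorder_cases[of i j])
      assume "i < j"
      then show ?thesis using that by (intro \<Delta>lt) (simp add: pairs_def)
    next
      assume "i = j"
      then show ?thesis using \<Delta>0 that d0 by simp
    next
      assume "j < i"
      then show ?thesis unfolding \<Delta>sym[of i j] using that by (intro \<Delta>lt) (simp add: pairs_def)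
    qed
    define D where "D i = G i - (\<Sum>b\<in>B. c i b *\<^sub>R G b)" for i
    \<comment> \<open>\<open>Q\<close> is linear in \<open>X\<close> and sends the Gram matrix of a
      family \<open>F\<close> to that of the defects of the linear relations in \<open>F\<close>. It
      annihilates the Gram matrix of \<open>\<Gamma>\<close>, so \<open>Q \<Delta>\<close> is the
      Gram matrix of \<open>D\<close>.\<close>
    define Q where "Q X i j = X i j - (\<Sum>b\<in>B. c j b * X i b) - (\<Sum>b\<in>B. c i b * X b j) + (\<Sum>b\<in>B. \<Sum>b'\<in>B. c i b * (c j b' * X b b'))"
      for X :: "nat \<Rightarrow> nat \<Rightarrow> real" and i j
    have Qgram: "Q (\<lambda>i j. F i \<bullet> F j) i j = (F i - (\<Sum>b\<in>B. c i b *\<^sub>R F b)) \<bullet> (F j - (\<Sum>b\<in>B. c j b *\<^sub>R F b))" for F :: "nat \<Rightarrow> real^3" and i j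
    proof -
      define S where "S i = (\<Sum>b\<in>B. c i b *\<^sub>R F b)" for i
      have "F i \<bullet> S j = (\<Sum>b\<in>B. c j b * (F i \<bullet> F b))" by (simp add: S_def inner_sum_right)
      moreover have "S i \<bullet> F j = (\<Sum>b\<in>B. c i b * (F b \<bullet> F j))" by (simp add: S_def inner_sum_left)
      moreover have "S i \<bullet> S j = (\<Sum>b\<in>B. \<Sum>b'\<in>B. c i b * (c j b' * (F b \<bullet> F b')))"
        unfolding S_def[of i] inner_sum_left by (simp add: S_def inner_sum_right sum_distrib_left mult.left_commute)
      moreover have "(F i - S i) \<bullet> (F j - S j) = F i \<bullet> F j - F i \<bullet> S j - S i \<bullet> F j + S i \<bullet> S j"
        by (simp add: inner_diff_left inner_diff_right)
      ultimately show ?thesis unfolding Q_def S_def by simp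
    qed
    have "Q \<Delta> i j = Q (\<lambda>i j. G i \<bullet> G j) i j - Q (\<lambda>i j. \<Gamma> i \<bullet> \<Gamma> j) i j" for i j
      unfolding Q_def \<Delta>_def by (simp add: right_diff_distrib sum_subtractf)
    moreover have "Q (\<lambda>i j. \<Gamma> i \<bullet> \<Gamma> j) i j = 0" for i j unfolding Qgram using \<Gamma>c[of i] by simp
    ultimately have QD: "Q \<Delta> i j = D i \<bullet> D j" for i j unfolding Qgram D_def by simp
    \<comment> \<open>Obtained by solving for the variation that makes \<open>dev0\<close> hold:
      each of the two linear sums in \<open>Q \<Delta>\<close> is assigned to one of
      \<open>v0 i\<close> and \<open>v0 j\<close>, and the double sum is shared equally between
      them.\<close>
    define v0 where "v0 i = (\<Sum>b\<in>B. \<Delta> i b *\<^sub>R e b) - (1/2) *\<^sub>R (\<Sum>b\<in>B. \<Sum>b'\<in>B. (c i b * \<Delta> b b') *\<^sub>R e b')" for i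
    have v0: "v0 i \<bullet> \<Gamma> j = (\<Sum>b\<in>B. c j b * \<Delta> i b) - (1/2) * (\<Sum>b\<in>B. \<Sum>b'\<in>B. c i b * (c j b' * \<Delta> b b'))" for i j
      unfolding v0_def by (simp add: inner_diff_left inner_sum_left c_def mult.commute mult.left_commute)
    have swap: "(\<Sum>b\<in>B. \<Sum>b'\<in>B. c j b * (c i b' * \<Delta> b b')) = (\<Sum>b\<in>B. \<Sum>b'\<in>B. c i b * (c j b' * \<Delta> b b'))" for i j
    proof -
      have "(\<Sum>b\<in>B. \<Sum>b'\<in>B. c j b * (c i b' * \<Delta> b b')) = (\<Sum>b'\<in>B. \<Sum>b\<in>B. c j b * (c i b' * \<Delta> b b'))" by (rule sum.swap)
      also have "\<dots> = (\<Sum>b\<in>B. \<Sum>b'\<in>B. c i b * (c j b' * \<Delta> b b'))"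
        by (intro sum.cong refl) (simp add: \<Delta>sym[of _ "_::nat"] mult.left_commute)
      finally show ?thesis .
    qed
    have dev0: "\<Delta> i j - (v0 i \<bullet> \<Gamma> j + \<Gamma> i \<bullet> v0 j) = D i \<bullet> D j" for i j
    proof -
      have "\<Gamma> i \<bullet> v0 j = (\<Sum>b\<in>B. c i b * \<Delta> b j) - (1/2) * (\<Sum>b\<in>B. \<Sum>b'\<in>B. c i b * (c j b' * \<Delta> b b'))"
        unfolding inner_commute[of "\<Gamma> i"] v0 swap by (simp add: \<Delta>sym[of j])
      then show ?thesis unfolding QD[symmetric] v0 by (simp add: Q_def)
    qed
    have Dnorm: "(norm (D i))^2 \<le> K * d^2" if i: "i \<in> {1..N}" for i
    proof -
      have "norm (D i) \<le> 2 * M * ((1 + M) * d)"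
      proof (rule norm_le_inner_perturbed_basis[OF exp, of M G d])
        show "(\<Sum>b\<in>B. norm (e b)) \<le> M" by (simp add: M_def)
        show "\<bar>G b \<bullet> G b' - \<Gamma> b \<bullet> \<Gamma> b'\<bar> \<le> d" if "b \<in> B" "b' \<in> B" for b b'
          using \<Delta>d[OF subsetD[OF BI that(1)] subsetD[OF BI that(2)]] unfolding \<Delta>_def .
        have "d \<le> 3/4 / M^2" using small unfolding d_def r_def .
        then show "M^2 * d \<le> 3/4" using M1 by (simp add: field_simps)
        show "0 \<le> (1 + M) * d" using M1 d0 by simp
        fix b assume b: "b \<in> B"
        then have bI: "b \<in> {1..N}" using BI by blast
        have "\<Gamma> i \<bullet> \<Gamma> b = (\<Sum>b'\<in>B. c i b' * (\<Gamma> b' \<bullet> \<Gamma> b))" by (subst \<Gamma>c[of i]) (simp add: inner_sum_left)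
        then have "D i \<bullet> G b = \<Delta> i b - (\<Sum>b'\<in>B. c i b' * \<Delta> b' b)"
          by (simp add: D_def \<Delta>_def inner_diff_left inner_sum_left right_diff_distrib sum_subtractf)
        also have "\<bar>\<dots>\<bar> \<le> \<bar>\<Delta> i b\<bar> + \<bar>\<Sum>b'\<in>B. c i b' * \<Delta> b' b\<bar>" by simp
        also have "\<bar>\<Sum>b'\<in>B. c i b' * \<Delta> b' b\<bar> \<le> (\<Sum>b'\<in>B. \<bar>c i b'\<bar> * d)"
        proof (rule order.trans[OF sum_abs], rule sum_mono)
          fix b' assume "b' \<in> B"
          then have "b' \<in> {1..N}" using BI by blast
          then show "\<bar>c i b' * \<Delta> b' b\<bar> \<le> \<bar>c i b'\<bar> * d" unfolding abs_mult by (intro mult_left_mono \<Delta>d bI) auto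
        qed
        also have "(\<Sum>b'\<in>B. \<bar>c i b'\<bar> * d) \<le> M * d"
          unfolding sum_distrib_right[symmetric] using cM[OF i] d0 by (intro mult_right_mono)
        also have "\<bar>\<Delta> i b\<bar> \<le> d" by (rule \<Delta>d[OF i bI])
        finally show "\<bar>D i \<bullet> G b\<bar> \<le> (1 + M) * d" by (simp add: distrib_right)
      qed
      then have "(norm (D i))^2 \<le> (2 * M * ((1 + M) * d))^2" by (rule power_mono) simp
      then show ?thesis by (simp add: K_def power_mult_distrib mult.assoc)
    qed
    \<comment> \<open>\<open>v0\<close> need not be tangential. Since
      \<open>\<Delta> i i = 0\<close>, its radial part is minus half the square of
      \<open>norm (D i)\<close>, so removing it costs only a quadratic error.\<close>
    define v where "v i = v0 i - (v0 i \<bullet> \<Gamma> i) *\<^sub>R \<Gamma> i" for i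
    have tang: "v i \<bullet> \<Gamma> i = 0" if "i \<in> {1..N}" for i
    proof -
      have "\<Gamma> i \<bullet> \<Gamma> i = 1" using unit[OF that] by (simp add: norm_eq_1)
      then show ?thesis by (simp add: v_def inner_diff_left)
    qed
    have diag: "v0 i \<bullet> \<Gamma> i = - ((norm (D i))^2 / 2)" if "i \<in> {1..N}" for i
      using dev0[of i i] \<Delta>0[OF that] by (simp add: inner_commute dot_square_norm)
    have dev: "\<bar>\<Delta> i j - (v i \<bullet> \<Gamma> j + \<Gamma> i \<bullet> v j)\<bar> \<le> 2 * K * d^2" if ij: "i \<in> {1..N}" "j \<in> {1..N}" for i j
    proof -
      have "\<Delta> i j - (v i \<bullet> \<Gamma> j + \<Gamma> i \<bullet> v j) = D i \<bullet> D j - ((norm (D i))^2 / 2 + (norm (D j))^2 / 2) * (\<Gamma> i \<bullet> \<Gamma> j)"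
        using dev0[of i j] by (simp add: v_def inner_diff_left inner_diff_right diag[OF ij(1)] diag[OF ij(2)] algebra_simps)
      also have "\<bar>\<dots>\<bar> \<le> \<bar>D i \<bullet> D j\<bar> + \<bar>((norm (D i))^2 / 2 + (norm (D j))^2 / 2) * (\<Gamma> i \<bullet> \<Gamma> j)\<bar>" by (rule abs_triangle_ineq4)
      also have "\<bar>((norm (D i))^2 / 2 + (norm (D j))^2 / 2) * (\<Gamma> i \<bullet> \<Gamma> j)\<bar> \<le> (norm (D i))^2 / 2 + (norm (D j))^2 / 2"
      proof -
        have "\<bar>\<Gamma> i \<bullet> \<Gamma> j\<bar> \<le> 1" using Cauchy_Schwarz_ineq2[of "\<Gamma> i" "\<Gamma> j"] unit ij by simp
        then show ?thesis unfolding abs_mult by (simp add: mult_left_le)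
      qed
      also have "\<bar>D i \<bullet> D j\<bar> \<le> norm (D i) * norm (D j)" by (rule Cauchy_Schwarz_ineq2)
      also have "\<dots> \<le> (norm (D i))^2 / 2 + (norm (D j))^2 / 2"
        using sum_squares_bound[of "norm (D i)" "norm (D j)"] by simp
      finally show ?thesis using Dnorm[OF ij(1)] Dnorm[OF ij(2)] by simp
    qed
    have "xnorm N (\<lambda>a. gram_dev N \<Gamma> G a - gram_deriv N \<Gamma> v a)
      \<le> (\<Sum>a\<in>pairs N. \<bar>gram_dev N \<Gamma> G a - gram_deriv N \<Gamma> v a\<bar>)" by (rule xnorm_le_sum)
    also have "\<dots> \<le> (\<Sum>a\<in>pairs N. 2 * K * d^2)"
    proof (rule sum_mono)
      fix a assume a: "a \<in> pairs N"
      then have "fst a \<in> {1..N}" "snd a \<in> {1..N}" unfolding pairs_def by auto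
      from dev[OF this] show "\<bar>gram_dev N \<Gamma> G a - gram_deriv N \<Gamma> v a\<bar> \<le> 2 * K * d^2"
        using a by (simp add: gram_dev_def xi_of_def gram_deriv_def \<Delta>_def)
    qed
    also have "\<dots> = C * d^2" by (simp add: C_def)
    finally have bound: "xnorm N (\<lambda>a. gram_dev N \<Gamma> G a - gram_deriv N \<Gamma> v a) \<le> C * d^2" .
    show "\<exists>v. (\<forall>i\<in>{1..N}. v i \<bullet> \<Gamma> i = 0) \<and>
      xnorm N (\<lambda>a. gram_dev N \<Gamma> G a - gram_deriv N \<Gamma> v a) \<le> C * (xnorm N (gram_dev N \<Gamma> G))^2"
    proof (rule exI[of _ v], rule conjI)
      show "\<forall>i\<in>{1..N}. v i \<bullet> \<Gamma> i = 0" using tang by (rule ballI)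
    qed (use bound in \<open>simp only: d_def\<close>)
    qed
  qed
qed

section \<open>Lyapunov functions\<close>

text \<open>Schur decomposition over the complex numbers: the diagonal of the triangular factor
  \<open>B\<close> consists of roots of the characteristic polynomial, hence of eigenvalues, and
  these have negative real part. Everything is stated in sums over indices, the format of
  \<open>hurwitz\<close>.\<close>

lemma hurwitz_schur:
  assumes "hurwitz d K"
  shows "\<exists>P P' B :: nat \<Rightarrow> nat \<Rightarrow> complex.
    (\<forall>r<d. \<forall>s<d. (\<Sum>t<d. P' r t * complex_of_real (K t s)) = (\<Sum>t<d. B r t * P' t s)) \<and>
    (\<forall>r<d. \<forall>s<d. (\<Sum>t<d. P r t * P' t s) = (if r = s then 1 else 0)) \<and>
    (\<forall>r<d. \<forall>s<r. B r s = 0) \<and> (\<forall>r<d. Re (B r r) < 0)"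
proof -
  define A where "A = Matrix.mat d d (\<lambda>(r, s). complex_of_real (K r s))"
  have A: "A \<in> carrier_mat d d" by (simp add: A_def)
  obtain es where es: "char_poly A = (\<Prod>a\<leftarrow>es. [:- a, 1:])" "length es = d"
    using char_poly_factorized[OF A] by blast
  obtain B P P' where dec: "schur_decomposition A es = (B, P, P')" by (cases "schur_decomposition A es")
  have sim: "similar_mat_wit A B P P'" and ut: "upper_triangular B" and dB: "diag_mat B = es"
    using schur_decomposition[OF A es(1) dec] by blast+
  have carr: "B \<in> carrier_mat d d" "P \<in> carrier_mat d d" "P' \<in> carrier_mat d d"
    and PP: "P * P' = 1\<^sub>m d" "P' * P = 1\<^sub>m d" and AB: "A = P * B * P'"
    using similar_mat_witD2[OF A sim] by blast+
  have "P' * A = (P' * P) * (B * P')"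
    unfolding AB using carr by (simp add: assoc_mult_mat[of _ d d _ d _ d])
  then have inter: "P' * A = B * P'" using carr by (simp add: PP(2))
  have neg: "Re (B $$ (r, r)) < 0" if r: "r < d" for r
  proof -
    define ev where "ev = B $$ (r, r)"
    have "ev \<in> set es" using dB r carr unfolding ev_def diag_mat_def by auto
    then have "poly (\<Prod>a\<leftarrow>es. [:- a, 1:]) ev = 0" by (simp add: poly_prod_list prod_list_zero_iff image_iff)
    then have "poly (char_poly A) ev = 0" unfolding es(1) .
    then have "eigenvalue A ev" using eigenvalue_root_char_poly[OF A] by simp
    then obtain v where v: "v \<in> carrier_vec d" "v \<noteq> 0\<^sub>v d" "A *\<^sub>v v = ev \<cdot>\<^sub>v v"
      using A unfolding eigenvalue_def eigenvector_def by auto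
    have nz: "\<exists>r<d. vec_index v r \<noteq> 0"
    proof (rule ccontr)
      assume "\<not> (\<exists>r<d. vec_index v r \<noteq> 0)"
      then have "v = 0\<^sub>v d" using v(1) by (intro eq_vecI) auto
      then show False using v(2) by simp
    qed
    have "(\<Sum>s<d. of_real (K i s) * vec_index v s) = ev * vec_index v i" if i: "i < d" for i
    proof -
      have "vec_index (A *\<^sub>v v) i = (\<Sum>s<d. of_real (K i s) * vec_index v s)"
        using i v(1) by (simp add: A_def scalar_prod_def atLeast0LessThan)
      then show ?thesis using v i by simp
    qed
    then have "\<exists>v. (\<exists>r<d. v r \<noteq> 0) \<and> (\<forall>r<d. (\<Sum>s<d. of_real (K r s) * v s) = ev * v r)"
      by (intro exI[of _ "vec_index v"] conjI nz) blast
    then show ?thesis unfolding ev_def[symmetric] by (rule mp[OF spec[OF assms[unfolded hurwitz_def], of ev]])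
  qed
  have mult: "(M * M') $$ (r, s) = (\<Sum>t<d. M $$ (r, t) * M' $$ (t, s))"
    if "M \<in> carrier_mat d d" "M' \<in> carrier_mat d d" "r < d" "s < d" for M M' :: "complex mat" and r s
    using that by (simp add: scalar_prod_def atLeast0LessThan)
  show ?thesis
  proof (intro exI conjI allI impI)
    fix r s assume rs: "r < d" "s < d"
    show "(\<Sum>t<d. P' $$ (r, t) * of_real (K t s)) = (\<Sum>t<d. B $$ (r, t) * P' $$ (t, s))"
      using arg_cong[OF inter, of "\<lambda>M. M $$ (r, s)"] mult[OF carr(3) A rs] mult[OF carr(1,3) rs] rs by (simp add: A_def)
    show "(\<Sum>t<d. P $$ (r, t) * P' $$ (t, s)) = (if r = s then 1 else 0)"
      using arg_cong[OF PP(1), of "\<lambda>M. M $$ (r, s)"] mult[OF carr(2,3) rs] rs by simp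
  next
    fix r s assume "r < d" "s < r"
    then show "B $$ (r, s) = 0" using ut carr by (auto simp: upper_triangular_def)
  next
    fix r assume "r < d"
    then show "Re (B $$ (r, r)) < 0" by (rule neg)
  qed
qed

text \<open>The squared length of the complex vector \<open>Q h\<close>. A complex factor
  \<open>Q\<close> spares a real normal form for pairs of conjugate eigenvalues.\<close>

definition cform :: "nat \<Rightarrow> (nat \<Rightarrow> nat \<Rightarrow> complex) \<Rightarrow> (nat \<Rightarrow> real) \<Rightarrow> real" where
  "cform d Q h = (\<Sum>r<d. (cmod (\<Sum>s<d. Q r s * h s))^2)"

definition cform_deriv :: "nat \<Rightarrow> (nat \<Rightarrow> nat \<Rightarrow> complex) \<Rightarrow> (nat \<Rightarrow> real) \<Rightarrow> (nat \<Rightarrow> real) \<Rightarrow> real" where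
  "cform_deriv d Q h k = 2 * Re (\<Sum>r<d. cnj (\<Sum>s<d. Q r s * h s) * (\<Sum>s<d. Q r s * k s))"

text \<open>A triangular matrix is conjugate, by a diagonal scaling, to one with arbitrarily small off-diagonal entries;
  in the scaled coordinates the Euclidean norm is a Lyapunov function.\<close>
lemma hurwitz_lyapunov:
  assumes "hurwitz d K"
  shows "\<exists>Q \<mu> \<kappa>. \<mu> > 0 \<and> \<kappa> > 0 \<and> (\<forall>w. (\<Sum>r<d. (w r)^2) \<le> \<kappa> * cform d Q w) \<and>
    (\<forall>w. cform_deriv d Q w (\<lambda>s. \<Sum>t<d. K s t * w t) \<le> - 2 * \<mu> * cform d Q w)"
proof -
  from hurwitz_schur[OF assms] obtain P P' B :: "nat \<Rightarrow> nat \<Rightarrow> complex" where schur: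
    "(\<forall>r<d. \<forall>s<d. (\<Sum>t<d. P' r t * of_real (K t s)) = (\<Sum>t<d. B r t * P' t s)) \<and>
    (\<forall>r<d. \<forall>s<d. (\<Sum>t<d. P r t * P' t s) = (if r = s then 1 else 0)) \<and>
    (\<forall>r<d. \<forall>s<r. B r s = 0) \<and> (\<forall>r<d. Re (B r r) < 0)" by (elim exE)
  then have inter: "\<And>r s. r < d \<Longrightarrow> s < d \<Longrightarrow> (\<Sum>t<d. P' r t * of_real (K t s)) = (\<Sum>t<d. B r t * P' t s)" and
    PP: "\<And>r s. r < d \<Longrightarrow> s < d \<Longrightarrow> (\<Sum>t<d. P r t * P' t s) = (if r = s then 1 else 0)" and
    ut: "\<And>r s. r < d \<Longrightarrow> s < r \<Longrightarrow> B r s = 0" and neg: "\<And>r. r < d \<Longrightarrow> Re (B r r) < 0"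
    by simp_all
  \<comment> \<open>The inserted 1 keeps the minimum meaningful for \<open>d = 0\<close>.\<close>
  define \<mu> where "\<mu> = Min (insert 1 ((\<lambda>r. - Re (B r r)) ` {..<d}))"
  have \<mu>0: "\<mu> > 0" unfolding \<mu>_def using neg by (subst Min_gr_iff) auto
  have \<mu>: "Re (B r r) \<le> - \<mu>" if "r < d" for r
  proof -
    have "\<mu> \<le> - Re (B r r)" unfolding \<mu>_def using that by (intro Min_le) auto
    then show ?thesis by simp
  qed
  define b where "b = (\<Sum>r<d. \<Sum>s<d. cmod (B r s))"
  have b0: "0 \<le> b" by (simp add: b_def sum_nonneg)
  have b: "cmod (B r s) \<le> b" if "r < d" "s < d" for r s
  proof -
    have "cmod (B r s) \<le> (\<Sum>s<d. cmod (B r s))" using that by (intro member_le_sum) auto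
    also have "\<dots> \<le> b" unfolding b_def using that by (intro member_le_sum[of _ _ "\<lambda>r. \<Sum>s<d. cmod (B r s)"]) (auto intro: sum_nonneg)
    finally show ?thesis .
  qed
  \<comment> \<open>Chosen so that the off-diagonal entries, of size at most
    \<open>b / \<eta>\<close> after scaling, use up no more than half of the decay rate
    \<open>\<mu>\<close>.\<close>
  define \<eta> where "\<eta> = 1 + 2 * b * real d / \<mu>"
  have \<eta>1: "\<eta> \<ge> 1" using b0 \<mu>0 by (simp add: \<eta>_def)
  have \<eta>b: "b / \<eta> * real d \<le> \<mu> / 2"
  proof -
    have "2 * b * real d \<le> \<mu> * \<eta>" using \<mu>0 by (simp add: \<eta>_def distrib_left)
    then show ?thesis using \<eta>1 by (simp add: field_simps)
  qed
  define Q where "Q r s = of_real (\<eta>^r) * P' r s" for r s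
  \<comment> \<open>The vector \<open>w\<close> is recovered from \<open>u w\<close> by undoing the
    scaling, which does not enlarge since \<open>\<eta> \<ge> 1\<close>, and applying
    \<open>P\<close>.\<close>
  define \<kappa> where "\<kappa> = 1 + (\<Sum>r<d. (\<Sum>s<d. cmod (P r s))^2)"
  have \<kappa>0: "\<kappa> > 0" unfolding \<kappa>_def by (rule add_pos_nonneg) (auto intro: sum_nonneg)
  define u where "u w r = (\<Sum>s<d. Q r s * of_real (w s))" for w r
  define S where "S w = (\<Sum>r<d. (cmod (u w r))^2)" for w
  have S0: "S w \<ge> 0" for w by (simp add: S_def sum_nonneg)
  have uS: "cmod (u w r) \<le> sqrt (S w)" if "r < d" for w r
  proof -
    have "(cmod (u w r))^2 \<le> S w" unfolding S_def using that by (intro member_le_sum[of _ _ "\<lambda>r. (cmod (u w r))^2"]) auto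
    then show ?thesis by (simp add: real_le_rsqrt)
  qed
  have P'w: "(\<Sum>s<d. P' r s * of_real (w s)) = u w r / of_real (\<eta>^r)" for w r
    using \<eta>1 by (simp add: u_def Q_def mult.assoc sum_distrib_left[symmetric])
  have lower: "(\<Sum>r<d. (w r)^2) \<le> \<kappa> * S w" for w :: "nat \<Rightarrow> real"
  proof -
    have "(w r)^2 \<le> (\<Sum>s<d. cmod (P r s))^2 * S w" if r: "r < d" for r
    proof -
      have "(\<Sum>t<d. P r t * (u w t / of_real (\<eta>^t))) = (\<Sum>t<d. \<Sum>s<d. P r t * P' t s * of_real (w s))"
        unfolding P'w[symmetric] by (simp add: sum_distrib_left mult.assoc)
      also have "\<dots> = (\<Sum>s<d. (\<Sum>t<d. P r t * P' t s) * of_real (w s))"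
        unfolding sum_distrib_right by (rule sum.swap)
      also have "\<dots> = (\<Sum>s<d. if s = r then of_real (w s) else 0)"
        by (rule sum.cong[OF refl]) (use PP r in auto)
      also have "\<dots> = of_real (w r)" using r by (simp add: sum.delta)
      finally have "\<bar>w r\<bar> = cmod (\<Sum>t<d. P r t * (u w t / of_real (\<eta>^t)))" by simp
      also have "\<dots> \<le> (\<Sum>t<d. cmod (P r t) * sqrt (S w))"
      proof (rule order.trans[OF norm_sum], rule sum_mono)
        fix t assume "t \<in> {..<d}"
        then have t: "t < d" by simp
        have "1 \<le> \<eta>^t" using \<eta>1 by simp
        then have "cmod (u w t) / \<eta>^t \<le> cmod (u w t)" by (simp add: divide_le_eq mult_left_le_one_le mult_le_cancel_left1)
        then have "cmod (u w t) / \<eta>^t \<le> sqrt (S w)" using uS[OF t, of w] by linarith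
        then have "cmod (P r t) * (cmod (u w t) / \<eta>^t) \<le> cmod (P r t) * sqrt (S w)" by (rule mult_left_mono) simp
        then show "cmod (P r t * (u w t / of_real (\<eta>^t))) \<le> cmod (P r t) * sqrt (S w)"
          using \<eta>1 by (simp add: norm_mult norm_divide norm_power)
      qed
      finally have "\<bar>w r\<bar>^2 \<le> ((\<Sum>t<d. cmod (P r t)) * sqrt (S w))^2"
        unfolding sum_distrib_right[symmetric] by (rule power_mono) simp
      then show ?thesis using S0 by (simp add: power_mult_distrib)
    qed
    then have "(\<Sum>r<d. (w r)^2) \<le> (\<Sum>r<d. (\<Sum>s<d. cmod (P r s))^2 * S w)" by (intro sum_mono) auto
    also have "\<dots> \<le> \<kappa> * S w" unfolding sum_distrib_right[symmetric] \<kappa>_def using S0[of w] by (intro mult_right_mono) auto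
    finally show ?thesis .
  qed
  have decay: "Re (\<Sum>r<d. cnj (u w r) * (\<Sum>s<d. Q r s * (\<Sum>t<d. of_real (K s t) * of_real (w t)))) \<le> - (\<mu>/2) * S w" for w :: "nat \<Rightarrow> real"
  proof -
    \<comment> \<open>The matrix of the system in the coordinates \<open>u\<close>: the conjugate of
      \<open>B\<close> by the diagonal scaling. Above the diagonal it gains the factor
      \<open>1 / \<eta>^(s - r)\<close>.\<close>
    define T where "T r s = of_real (\<eta>^r) * B r s / of_real (\<eta>^s)" for r s
    have der: "(\<Sum>s<d. Q r s * (\<Sum>t<d. of_real (K s t) * of_real (w t))) = (\<Sum>s<d. T r s * u w s)" if r: "r < d" for r
    proof -
      have "(\<Sum>s<d. Q r s * (\<Sum>t<d. of_real (K s t) * of_real (w t)))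
        = of_real (\<eta>^r) * (\<Sum>s<d. \<Sum>t<d. P' r s * of_real (K s t) * of_real (w t))"
        by (simp add: Q_def sum_distrib_left mult.assoc)
      also have "(\<Sum>s<d. \<Sum>t<d. P' r s * of_real (K s t) * of_real (w t))
        = (\<Sum>t<d. (\<Sum>s<d. P' r s * of_real (K s t)) * of_real (w t))"
        unfolding sum_distrib_right by (rule sum.swap)
      also have "\<dots> = (\<Sum>t<d. (\<Sum>s<d. B r s * P' s t) * of_real (w t))"
        by (rule sum.cong[OF refl]) (use inter r in auto)
      also have "\<dots> = (\<Sum>s<d. \<Sum>t<d. B r s * P' s t * of_real (w t))"
        unfolding sum_distrib_right by (rule sum.swap)
      also have "\<dots> = (\<Sum>s<d. B r s * (u w s / of_real (\<eta>^s)))"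
        unfolding P'w[symmetric] by (simp add: sum_distrib_left mult.assoc)
      also have "of_real (\<eta>^r) * \<dots> = (\<Sum>s<d. T r s * u w s)" by (simp add: T_def sum_distrib_left mult.assoc)
      finally show ?thesis .
    qed
    have off: "cmod (T r s) \<le> b / \<eta>" if rs: "r < d" "s < d" "r \<noteq> s" for r s
    proof (cases "s < r")
      case True
      then show ?thesis using ut rs b0 \<eta>1 by (simp add: T_def)
    next
      case False
      then have "r < s" using rs by simp
      then obtain k where k: "s = r + Suc k" using less_iff_Suc_add by auto
      have "cmod (T r s) = cmod (B r s) / \<eta>^Suc k" using \<eta>1 by (simp add: T_def k norm_mult norm_divide norm_power power_add)
      also have "\<dots> \<le> b / \<eta>"
      proof (rule frac_le)
        show "\<eta> \<le> \<eta>^Suc k" using \<eta>1 by (simp add: mult_le_cancel_left1)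
      qed (use b rs b0 \<eta>1 in auto)
      finally show ?thesis .
    qed
    \<comment> \<open>Off-diagonal products are split evenly between the two squares. The diagonal
      receives the same nonnegative extra term so that one formula serves all pairs.\<close>
    have "Re (cnj (u w r) * (T r s * u w s)) \<le> (if r = s then - \<mu> * (cmod (u w r))^2 else 0) + b / \<eta> * (((cmod (u w r))^2 + (cmod (u w s))^2) / 2)"
      if rs: "r < d" "s < d" for r s
    proof (cases "r = s")
      case True
      have eq: "cnj (u w r) * (T r r * u w r) = T r r * of_real ((cmod (u w r))^2)"
        unfolding complex_norm_square by (simp only: ac_simps)
      have "Re (cnj (u w r) * (T r r * u w r)) = Re (T r r) * (cmod (u w r))^2"
        unfolding eq by (simp del: of_real_power)
      also have "\<dots> = Re (B r r) * (cmod (u w r))^2" using \<eta>1 by (simp add: T_def)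
      also have "\<dots> \<le> - \<mu> * (cmod (u w r))^2" using \<mu>[OF rs(1)] by (intro mult_right_mono) auto
      also have "\<dots> \<le> - \<mu> * (cmod (u w r))^2 + b / \<eta> * (((cmod (u w r))^2 + (cmod (u w r))^2) / 2)" using b0 \<eta>1 by simp
      finally show ?thesis using True by simp
    next
      case False
      have "Re (cnj (u w r) * (T r s * u w s)) \<le> cmod (cnj (u w r) * (T r s * u w s))" by (rule complex_Re_le_cmod)
      also have "\<dots> = cmod (T r s) * (cmod (u w r) * cmod (u w s))" by (simp add: norm_mult)
      also have "\<dots> \<le> b / \<eta> * (cmod (u w r) * cmod (u w s))" using off[OF rs False] by (intro mult_right_mono) auto
      also have "\<dots> \<le> b / \<eta> * (((cmod (u w r))^2 + (cmod (u w s))^2) / 2)"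
        using b0 \<eta>1 sum_squares_bound[of "cmod (u w r)" "cmod (u w s)"] by (intro mult_left_mono) auto
      finally show ?thesis using False by simp
    qed
    then have "(\<Sum>r<d. \<Sum>s<d. Re (cnj (u w r) * (T r s * u w s)))
      \<le> (\<Sum>r<d. \<Sum>s<d. (if r = s then - \<mu> * (cmod (u w r))^2 else 0) + b / \<eta> * (((cmod (u w r))^2 + (cmod (u w s))^2) / 2))"
      by (intro sum_mono) auto
    also have "\<dots> = (\<Sum>r<d. \<Sum>s<d. (if r = s then - \<mu> * (cmod (u w r))^2 else 0)) +
      b / \<eta> * (((\<Sum>r<d. \<Sum>s<d. (cmod (u w r))^2) + (\<Sum>r<d. \<Sum>s<d. (cmod (u w s))^2)) / 2)"
      by (simp only: sum.distrib sum_distrib_left[symmetric] sum_divide_distrib[symmetric])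
    also have "(\<Sum>r<d. \<Sum>s<d. (cmod (u w r))^2) = real d * S w" by (simp add: S_def sum_distrib_left)
    also have "(\<Sum>r<d. \<Sum>s<d. (cmod (u w s))^2) = real d * S w" by (simp add: S_def)
    also have "(\<Sum>r<d. \<Sum>s<d. (if r = s then - \<mu> * (cmod (u w r))^2 else 0)) = - \<mu> * S w"
      unfolding S_def sum_distrib_left by (rule sum.cong[OF refl]) (simp add: sum.delta')
    also have "- \<mu> * S w + b / \<eta> * ((real d * S w + real d * S w) / 2) = - \<mu> * S w + (b / \<eta> * real d) * S w" by simp
    also have "\<dots> \<le> - \<mu> * S w + \<mu> / 2 * S w" using \<eta>b S0[of w] by (intro add_left_mono mult_right_mono)
    finally have "(\<Sum>r<d. \<Sum>s<d. Re (cnj (u w r) * (T r s * u w s))) \<le> - (\<mu>/2) * S w" by simp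
    moreover have "Re (\<Sum>r<d. cnj (u w r) * (\<Sum>s<d. Q r s * (\<Sum>t<d. of_real (K s t) * of_real (w t))))
      = (\<Sum>r<d. \<Sum>s<d. Re (cnj (u w r) * (T r s * u w s)))"
      unfolding Re_sum[symmetric] sum_distrib_left[symmetric] by (rule arg_cong[of _ _ Re], rule sum.cong[OF refl]) (simp add: der)
    ultimately show ?thesis by simp
  qed
  show ?thesis
  proof (rule exI[of _ Q], rule exI[of _ "\<mu>/2"], rule exI[of _ \<kappa>], intro conjI allI)
    show "\<mu>/2 > 0" using \<mu>0 by simp
    show "\<kappa> > 0" by (rule \<kappa>0)
    show "cform_deriv d Q w (\<lambda>s. \<Sum>t<d. K s t * w t) \<le> - 2 * (\<mu>/2) * cform d Q w" for w
      using decay[of w] unfolding cform_deriv_def cform_def u_def S_def of_real_sum of_real_mult by linarith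
  qed (use lower in \<open>simp_all add: u_def S_def cform_def\<close>)
qed

section \<open>Decay from inequalities that hold only near the equilibrium\<close>

text \<open>A continuation argument. While \<open>n\<close> stays below \<open>R\<close> the
  function \<open>V t * exp (\<mu> * t)\<close> does not increase, which keeps
  \<open>(n t)^2\<close> at most \<open>c * V 0 < R^2\<close>. At a first time where
  \<open>n\<close> equals \<open>R\<close> this is contradictory.\<close>

lemma lyapunov_exponential_decay:
  fixes n V V' :: "real \<Rightarrow> real"
  assumes n0: "\<And>t. 0 \<le> t \<Longrightarrow> 0 \<le> n t" and cont: "continuous_on {0..} n"
    and dV: "\<And>t. 0 \<le> t \<Longrightarrow> (V has_real_derivative V' t) (at t within {0..})"
    and pos: "c > 0" "R > 0"
    and lower: "\<And>t. 0 \<le> t \<Longrightarrow> n t \<le> R \<Longrightarrow> (n t)^2 \<le> c * V t"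
    and decay: "\<And>t. 0 \<le> t \<Longrightarrow> n t \<le> R \<Longrightarrow> V' t \<le> - \<mu> * V t" and \<mu>: "\<mu> > 0"
    and start: "n 0 < R" "c * V 0 < R^2" and t: "0 \<le> t"
  shows "(n t)^2 \<le> c * V 0 * exp (- \<mu> * t)"
proof -
  have contV: "continuous_on {0..} V"
    unfolding continuous_on_eq_continuous_within using dV DERIV_continuous by fastforce
  have le: "V b \<le> V 0 * exp (- \<mu> * b)" if b: "0 \<le> b" and nb: "\<And>s. 0 \<le> s \<Longrightarrow> s \<le> b \<Longrightarrow> n s \<le> R" for b
  proof (cases "b = 0")
    case False
    have "V b * exp (\<mu> * b) \<le> V 0 * exp (\<mu> * 0)"
    proof (rule DERIV_nonpos_imp_decreasing_open[of 0 b "\<lambda>s. V s * exp (\<mu> * s)"])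
      show "continuous_on {0..b} (\<lambda>s. V s * exp (\<mu> * s))"
        by (intro continuous_intros continuous_on_subset[OF contV]) auto
      fix s assume s: "0 < s" "s < b"
      have "at s within {0..} = at s" using s by (intro at_within_interior) auto
      then have "(V has_real_derivative V' s) (at s)" using dV[of s] s by simp
      then have "((\<lambda>s. V s * exp (\<mu> * s)) has_real_derivative (V' s + \<mu> * V s) * exp (\<mu> * s)) (at s)"
        by (auto intro!: derivative_eq_intros simp: algebra_simps)
      moreover have "(V' s + \<mu> * V s) * exp (\<mu> * s) \<le> 0"
        using decay[of s] nb[of s] s by (intro mult_nonpos_nonneg) auto
      ultimately show "\<exists>y. ((\<lambda>s. V s * exp (\<mu> * s)) has_real_derivative y) (at s) \<and> y \<le> 0" by blast
    qed (use b in simp)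
    then show ?thesis by (simp add: exp_minus field_simps)
  qed simp
  have bound: "(n b)^2 \<le> c * V 0 * exp (- \<mu> * b)" if b: "0 \<le> b" and nb: "\<And>s. 0 \<le> s \<Longrightarrow> s \<le> b \<Longrightarrow> n s \<le> R" for b
  proof -
    have "(n b)^2 \<le> c * V b" using lower[OF b nb[OF b order.refl]] .
    also have "\<dots> \<le> c * (V 0 * exp (- \<mu> * b))" using pos le[OF b nb] by (intro mult_left_mono) auto
    finally show ?thesis by (simp add: mult.assoc)
  qed
  have V0: "0 \<le> c * V 0" using lower[of 0] start(1) by (meson less_imp_le order.trans order_refl zero_le_power2)
  have "n s \<le> R" if s: "0 \<le> s" for s
  proof (rule ccontr)
    assume "\<not> n s \<le> R"
    \<comment> \<open>The least element \<open>b\<close> of this compact set is the first time at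
      which \<open>n\<close> reaches \<open>R\<close>; by the intermediate value theorem
      \<open>n b\<close> is exactly \<open>R\<close>.\<close>
    define Z where "Z = {0..s} \<inter> n -` {R..}"
    have conts: "continuous_on {0..s} n" by (rule continuous_on_subset[OF cont]) auto
    have "closed Z" unfolding Z_def by (rule continuous_closed_preimage[OF conts]) auto
    then have "compact Z" unfolding Z_def by (metis bounded_Int bounded_closed_interval compact_eq_bounded_closed)
    moreover have "s \<in> Z" using \<open>\<not> n s \<le> R\<close> s by (auto simp: Z_def)
    ultimately obtain b where b: "b \<in> Z" "\<And>y. y \<in> Z \<Longrightarrow> b \<le> y"
      using compact_attains_inf[of Z] by blast
    have b0: "0 \<le> b" "b \<le> s" "R \<le> n b" using b(1) by (auto simp: Z_def)
    obtain y where y: "0 \<le> y" "y \<le> b" "n y = R"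
      using IVT'[of n 0 R b] start(1) b0 continuous_on_subset[OF conts, of "{0..b}"] by auto
    then have "y \<in> Z" using b0 by (auto simp: Z_def)
    then have nb: "n b = R" using b(2) y by force
    have "n r \<le> R" if r: "0 \<le> r" "r \<le> b" for r
    proof (cases "r = b")
      case False
      then have "r \<notin> Z" using b(2)[of r] r by auto
      then show ?thesis using r b0 by (auto simp: Z_def)
    qed (use nb in simp)
    from bound[OF b0(1) this] have "R^2 \<le> c * V 0 * exp (- \<mu> * b)" using nb by simp
    also have "\<dots> \<le> c * V 0" using V0 \<mu> b0 by (simp add: mult_left_le)
    finally show False using start(2) by simp
  qed
  then show ?thesis using bound[OF t] by simp
qed

lemma abs_sum_mult_le_xnorm: "\<bar>\<Sum>a\<in>pairs N. f a * h a\<bar> \<le> xnorm N f * xnorm N h"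
proof -
  have "(\<Sum>a\<in>pairs N. f a * h a)^2 \<le> (xnorm N f * xnorm N h)^2"
    unfolding power_mult_distrib xnorm_power2 by (rule Cauchy_Schwarz_ineq_sum)
  then show ?thesis by (rule abs_le_square_iff[THEN iffD2, THEN order.trans]) simp
qed

text \<open>Near the equilibrium the component of \<open>x\<close> outside \<open>W\<close> is quadratically small, so the projection to \<open>W\<close>
  obeys the Hurwitz system up to a quadratic error.\<close>
lemma reduced_lyapunov:
  fixes A :: "nat \<times> nat \<Rightarrow> nat \<times> nat \<Rightarrow> real" and T :: "nat \<Rightarrow> nat \<times> nat \<Rightarrow> real"
  assumes T: "orthonormal_basis_rows N d T W" and hur: "hurwitz d (sandwich N T A)"
    and C0: "C0 \<ge> 0" and C1: "C1 \<ge> 0" and w_def: "w = (\<lambda>x r. \<Sum>a\<in>pairs N. T r a * x a)"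
  shows "\<exists>Q \<mu> R c c'. \<mu> > 0 \<and> R > 0 \<and> c > 0 \<and> c' > 0 \<and>
    (\<forall>x. cform d Q (w x) \<le> c' * (xnorm N x)^2) \<and>
    (\<forall>x y x'. y \<in> W \<longrightarrow> xnorm N x \<le> R \<longrightarrow> xnorm N (\<lambda>a. x a - y a) \<le> C1 * (xnorm N x)^2 \<longrightarrow>
       (\<forall>a\<in>pairs N. \<bar>x' a - mat_app N A x a\<bar> \<le> C0 * (xnorm N x)^2) \<longrightarrow>
       (xnorm N x)^2 \<le> c * cform d Q (w x) \<and> cform_deriv d Q (w x) (w x') \<le> - \<mu> * cform d Q (w x))"
proof -
  define K where "K = sandwich N T A"
  from hurwitz_lyapunov[OF hur[folded K_def]] obtain Q \<mu> \<kappa> where Q: "\<mu> > 0 \<and> \<kappa> > 0 \<and>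
    (\<forall>w. (\<Sum>r<d. (w r)^2) \<le> \<kappa> * cform d Q w) \<and>
    (\<forall>w. cform_deriv d Q w (\<lambda>s. \<Sum>t<d. K s t * w t) \<le> - 2 * \<mu> * cform d Q w)" by (elim exE)
  then have \<mu>0: "\<mu> > 0" and \<kappa>0: "\<kappa> > 0" by simp_all
  define u where "u x r = (\<Sum>s<d. Q r s * of_real (w x s))" for x r
  define V where "V x = (\<Sum>r<d. (cmod (u x r))^2)" for x
  have V0: "0 \<le> V x" for x by (simp add: V_def sum_nonneg)
  have lower: "(\<Sum>r<d. (w x r)^2) \<le> \<kappa> * V x" for x using Q unfolding V_def u_def cform_def by simp
  have decay: "Re (\<Sum>r<d. cnj (u x r) * (\<Sum>s<d. Q r s * of_real (\<Sum>t<d. K s t * w x t))) \<le> - \<mu> * V x" for x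
    using Q unfolding V_def u_def cform_def cform_deriv_def by simp
  have T1: "xnorm N (T r) = 1" if "r < d" for r
    using T that by (simp add: orthonormal_basis_rows_def xnorm_def power2_eq_square)
  have wn: "\<bar>w x r\<bar> \<le> xnorm N x" if "r < d" for x r
    unfolding w_def using abs_sum_mult_le_xnorm[of "T r" x N] T1[OF that] by simp
  define q where "q = (\<Sum>r<d. \<Sum>s<d. cmod (Q r s))"
  have q0: "0 \<le> q" by (simp add: q_def sum_nonneg)
  have qr: "(\<Sum>s<d. cmod (Q r s)) \<le> q" if "r < d" for r
    unfolding q_def using that by (intro member_le_sum[of _ _ "\<lambda>r. \<Sum>s<d. cmod (Q r s)"]) (auto intro: sum_nonneg)
  have Qbound: "cmod (\<Sum>s<d. Q r s * of_real (h s)) \<le> q * b" if r: "r < d" and b: "0 \<le> b" "\<And>s. s < d \<Longrightarrow> \<bar>h s\<bar> \<le> b" for r h b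
  proof -
    have "cmod (\<Sum>s<d. Q r s * of_real (h s)) \<le> (\<Sum>s<d. cmod (Q r s) * b)"
      by (rule order.trans[OF norm_sum], rule sum_mono) (auto simp: norm_mult intro!: mult_left_mono b)
    also have "\<dots> \<le> q * b" unfolding sum_distrib_right[symmetric] using qr[OF r] b(1) by (intro mult_right_mono)
    finally show ?thesis .
  qed
  have un: "cmod (u x r) \<le> q * xnorm N x" if "r < d" for x r
    unfolding u_def by (rule Qbound[OF that]) (simp_all add: wn)
  define c' where "c' = real d * q^2 + 1"
  have upper: "V x \<le> c' * (xnorm N x)^2" for x
  proof -
    have "V x \<le> (\<Sum>r<d. (q * xnorm N x)^2)" unfolding V_def using un by (intro sum_mono power_mono) auto
    also have "\<dots> = (real d * q^2) * (xnorm N x)^2" by (simp add: power_mult_distrib)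
    also have "\<dots> \<le> c' * (xnorm N x)^2" unfolding c'_def by (intro mult_right_mono) auto
    finally show ?thesis .
  qed
  define k where "k = (\<Sum>r<d. \<Sum>s<d. \<bar>K r s\<bar>)"
  define \<alpha> where "\<alpha> = (\<Sum>r<d. \<Sum>a\<in>pairs N. \<Sum>b\<in>pairs N. \<bar>T r a * A a b\<bar>)"
  \<comment> \<open>The three sources of error in the projected equation: the transversal part
    \<open>z\<close> seen by \<open>K\<close>, the same part seen by \<open>A\<close>, and the
    nonlinear remainder.\<close>
  define C2 where "C2 = k * C1 + \<alpha> * C1 + real (card (pairs N)) * C0"
  have k0: "0 \<le> k" and \<alpha>0: "0 \<le> \<alpha>" by (simp_all add: k_def \<alpha>_def sum_nonneg)
  have C20: "0 \<le> C2" using k0 \<alpha>0 C0 C1 by (simp add: C2_def)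
  define c where "c = 4 * (real d)^2 * \<kappa> + 1"
  have c0: "c > 0" using \<kappa>0 by (simp add: c_def add_nonneg_pos)
  define L where "L = 2 * real d * q^2 * C2 * c"
  have L0: "0 \<le> L" using C20 c0 by (simp add: L_def)
  \<comment> \<open>The second entry lets the transversal part be absorbed, bounding it by half of
    \<open>n\<close>. The third lets the perturbation consume at most half of the decay
    \<open>2 * \<mu>\<close>.\<close>
  define R where "R = min 1 (min (1 / (2 * (real d + 1) * C1 + 1)) (\<mu> / (L + 1)))"
  have R0: "R > 0" using \<mu>0 C1 L0 by (simp add: R_def add_nonneg_pos)
  have main: "(xnorm N x)^2 \<le> c * V x \<and> 2 * Re (\<Sum>r<d. cnj (u x r) * u x' r) \<le> - \<mu> * V x"
    if y: "y \<in> W" and xR: "xnorm N x \<le> R" and z_le: "xnorm N (\<lambda>a. x a - y a) \<le> C1 * (xnorm N x)^2"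
      and rem: "\<forall>a\<in>pairs N. \<bar>x' a - mat_app N A x a\<bar> \<le> C0 * (xnorm N x)^2" for x y x'
  proof -
    define n where "n = xnorm N x"
    define z where "z = (\<lambda>a. x a - y a)"
    define g where "g = (\<lambda>a. x' a - mat_app N A x a)"
    have n0: "0 \<le> n" by (simp add: n_def)
    have zn: "xnorm N z \<le> C1 * n^2" using z_le by (simp add: z_def n_def)
    have nR: "n \<le> 1" "n * (2 * (real d + 1) * C1 + 1) \<le> 1" "n * (L + 1) \<le> \<mu>"
      using xR C1 L0 by (simp_all add: R_def n_def[symmetric] pos_le_divide_eq add_nonneg_pos)
    obtain e where e: "\<forall>a\<in>pairs N. y a = (\<Sum>r<d. e r * T r a)"
      using T y unfolding orthonormal_basis_rows_def by blast
    have we: "w y s = e s" if s: "s < d" for s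
    proof -
      have "w y s = (\<Sum>a\<in>pairs N. \<Sum>r<d. e r * (T s a * T r a))"
        unfolding w_def by (rule sum.cong[OF refl]) (simp add: e sum_distrib_left mult.left_commute)
      also have "\<dots> = (\<Sum>r<d. e r * (\<Sum>a\<in>pairs N. T s a * T r a))"
        unfolding sum_distrib_left by (rule sum.swap)
      also have "\<dots> = (\<Sum>r<d. if r = s then e r else 0)"
        by (rule sum.cong[OF refl]) (use T s in \<open>auto simp: orthonormal_basis_rows_def\<close>)
      finally show ?thesis using s by (simp add: sum.delta)
    qed
    have wsplit: "w x s = w y s + w z s" for s
      by (simp add: w_def z_def sum.distrib[symmetric] algebra_simps)
    have wz: "\<bar>w z s\<bar> \<le> C1 * n^2" if "s < d" for s using wn[OF that, of z] zn by linarith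
    have n_le: "n \<le> 2 * (\<Sum>s<d. \<bar>w x s\<bar>)"
    proof -
      have "n = xnorm N (\<lambda>a. y a + z a)" by (simp add: n_def z_def)
      also have "\<dots> \<le> xnorm N y + xnorm N z" by (rule xnorm_triangle)
      also have "xnorm N y \<le> (\<Sum>s<d. \<bar>w y s\<bar>)"
      proof -
        have "xnorm N (\<lambda>a. \<Sum>r\<in>B. e r * T r a) \<le> (\<Sum>r\<in>B. \<bar>e r\<bar>)" if "finite B" "B \<subseteq> {..<d}" for B
          using that
        proof (induction B rule: finite_induct)
          case (insert r B)
          have "xnorm N (\<lambda>a. \<Sum>r\<in>insert r B. e r * T r a) = xnorm N (\<lambda>a. e r * T r a + (\<Sum>r\<in>B. e r * T r a))"
            using insert by simp
          also have "\<dots> \<le> xnorm N (\<lambda>a. e r * T r a) + xnorm N (\<lambda>a. \<Sum>r\<in>B. e r * T r a)" by (rule xnorm_triangle)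
          also have "xnorm N (\<lambda>a. e r * T r a) = \<bar>e r\<bar>" using insert T1 by (simp add: xnorm_scale)
          finally show ?case using insert by simp
        qed (simp add: xnorm_def)
        from this[of "{..<d}"] have "xnorm N (\<lambda>a. \<Sum>r<d. e r * T r a) \<le> (\<Sum>r<d. \<bar>e r\<bar>)" by simp
        moreover have "xnorm N y = xnorm N (\<lambda>a. \<Sum>r<d. e r * T r a)" unfolding xnorm_def using e by simp
        ultimately show ?thesis by (simp add: we)
      qed
      also have "(\<Sum>s<d. \<bar>w y s\<bar>) \<le> (\<Sum>s<d. \<bar>w x s\<bar> + C1 * n^2)"
      proof (rule sum_mono)
        fix s assume "s \<in> {..<d}"
        then show "\<bar>w y s\<bar> \<le> \<bar>w x s\<bar> + C1 * n^2" using wz[of s] wsplit[of s] by simp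
      qed
      also have "\<dots> = (\<Sum>s<d. \<bar>w x s\<bar>) + real d * (C1 * n^2)" by (simp add: sum.distrib)
      finally have "n \<le> (\<Sum>s<d. \<bar>w x s\<bar>) + (real d + 1) * C1 * n^2" using zn by (simp add: algebra_simps)
      moreover have "(real d + 1) * C1 * n^2 \<le> n / 2"
      proof -
        have "n * (2 * (real d + 1) * C1) \<le> 1" using nR(2) n0 by (simp add: distrib_left)
        then have "n * (n * (2 * (real d + 1) * C1)) \<le> n * 1" using n0 by (rule mult_left_mono)
        then show ?thesis by (simp add: power2_eq_square algebra_simps)
      qed
      ultimately show ?thesis by linarith
    qed
    have n2: "n^2 \<le> c * V x"
    proof -
      have ws: "\<bar>w x s\<bar> \<le> sqrt (\<kappa> * V x)" if "s < d" for s
      proof -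
        have "(w x s)^2 \<le> (\<Sum>r<d. (w x r)^2)" using that by (intro member_le_sum[of _ _ "\<lambda>r. (w x r)^2"]) auto
        also have "\<dots> \<le> \<kappa> * V x" by (rule lower)
        finally have "\<bar>w x s\<bar>^2 \<le> \<kappa> * V x" by simp
        then show ?thesis by (rule real_le_rsqrt)
      qed
      have "(\<Sum>s<d. \<bar>w x s\<bar>) \<le> (\<Sum>s<d. sqrt (\<kappa> * V x))" using ws by (intro sum_mono) auto
      then have "n \<le> 2 * (real d * sqrt (\<kappa> * V x))" using n_le by simp
      then have "n^2 \<le> (2 * (real d * sqrt (\<kappa> * V x)))^2" using n0 by (rule power_mono)
      also have "\<dots> = (4 * (real d)^2 * \<kappa>) * V x" using \<kappa>0 V0[of x] by (simp add: power_mult_distrib)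
      also have "\<dots> \<le> c * V x" unfolding c_def using V0 by (intro mult_right_mono) auto
      finally show ?thesis .
    qed
    define \<rho> where "\<rho> r = w x' r - (\<Sum>s<d. K r s * w x s)" for r
    have \<rho>: "\<bar>\<rho> r\<bar> \<le> C2 * n^2" if r: "r < d" for r
    proof -
      define TA where "TA h = (\<Sum>a\<in>pairs N. \<Sum>b\<in>pairs N. T r a * A a b * h b)" for h
      have TAw: "w (mat_app N A h) r = TA h" for h
        unfolding w_def TA_def by (rule sum.cong[OF refl]) (simp add: mat_app_def sum_distrib_left mult.assoc)
      have "w x' r = w (mat_app N A x) r + w g r" by (simp add: w_def g_def sum.distrib[symmetric] algebra_simps)
      also have "w (mat_app N A x) r = TA y + TA z"
        unfolding TAw by (simp add: TA_def z_def sum.distrib[symmetric] algebra_simps)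
      \<comment> \<open>No error arises here: \<open>y\<close> lies in \<open>W\<close>, so it is
        recovered from its coordinates \<open>w y s\<close>, and on such vectors the projected
        action of \<open>A\<close> is exactly \<open>K\<close>.\<close>
      also have "TA y = (\<Sum>s<d. K r s * w y s)"
      proof -
        have "TA y = (\<Sum>a\<in>pairs N. \<Sum>b\<in>pairs N. \<Sum>s<d. e s * (T r a * A a b * T s b))"
          unfolding TA_def by (intro sum.cong refl) (simp add: e sum_distrib_left mult.left_commute)
        also have "\<dots> = (\<Sum>a\<in>pairs N. \<Sum>s<d. \<Sum>b\<in>pairs N. e s * (T r a * A a b * T s b))"
          by (intro sum.cong refl sum.swap)
        also have "\<dots> = (\<Sum>s<d. \<Sum>a\<in>pairs N. \<Sum>b\<in>pairs N. e s * (T r a * A a b * T s b))" by (rule sum.swap)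
        also have "\<dots> = (\<Sum>s<d. K r s * w y s)"
          by (intro sum.cong refl) (simp add: K_def sandwich_def we sum_distrib_left mult.commute)
        finally show ?thesis .
      qed
      finally have "\<rho> r = TA z + w g r - (\<Sum>s<d. K r s * w z s)"
        by (simp add: \<rho>_def wsplit distrib_left sum.distrib)
      then have "\<bar>\<rho> r\<bar> \<le> \<bar>TA z\<bar> + \<bar>w g r\<bar> + \<bar>\<Sum>s<d. K r s * w z s\<bar>" by linarith
      also have "\<bar>\<Sum>s<d. K r s * w z s\<bar> \<le> (\<Sum>s<d. \<bar>K r s\<bar> * (C1 * n^2))"
        by (rule order.trans[OF sum_abs], rule sum_mono) (auto simp: abs_mult intro!: mult_left_mono wz)
      also have "\<dots> \<le> k * (C1 * n^2)"
      proof -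
        have "(\<Sum>s<d. \<bar>K r s\<bar>) \<le> k" unfolding k_def using r by (intro member_le_sum[of _ _ "\<lambda>r. \<Sum>s<d. \<bar>K r s\<bar>"]) (auto intro: sum_nonneg)
        then show ?thesis unfolding sum_distrib_right[symmetric] using C1 by (intro mult_right_mono) auto
      qed
      also have "\<bar>TA z\<bar> \<le> (\<Sum>a\<in>pairs N. \<Sum>b\<in>pairs N. \<bar>T r a * A a b\<bar> * (C1 * n^2))"
        unfolding TA_def
      proof (rule order.trans[OF sum_abs], rule sum_mono, rule order.trans[OF sum_abs], rule sum_mono)
        fix a b assume "b \<in> pairs N"
        then have "\<bar>z b\<bar> \<le> C1 * n^2" using abs_le_xnorm[of b N z] zn by linarith
        then show "\<bar>T r a * A a b * z b\<bar> \<le> \<bar>T r a * A a b\<bar> * (C1 * n^2)"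
          unfolding abs_mult[of "T r a * A a b"] by (intro mult_left_mono) auto
      qed
      also have "\<dots> \<le> \<alpha> * (C1 * n^2)"
      proof -
        have "(\<Sum>a\<in>pairs N. \<Sum>b\<in>pairs N. \<bar>T r a * A a b\<bar>) \<le> \<alpha>"
          unfolding \<alpha>_def using r by (intro member_le_sum[of _ _ "\<lambda>r. \<Sum>a\<in>pairs N. \<Sum>b\<in>pairs N. \<bar>T r a * A a b\<bar>"]) (auto intro: sum_nonneg)
        then show ?thesis unfolding sum_distrib_right[symmetric] using C1 by (intro mult_right_mono) auto
      qed
      also have "\<bar>w g r\<bar> \<le> real (card (pairs N)) * (C0 * n^2)"
      proof -
        have "\<bar>w g r\<bar> \<le> xnorm N g" by (rule wn[OF r])
        also have "\<dots> \<le> (\<Sum>a\<in>pairs N. \<bar>g a\<bar>)" by (rule xnorm_le_sum)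
        also have "\<dots> \<le> (\<Sum>a\<in>pairs N. C0 * n^2)" using rem by (intro sum_mono) (auto simp: g_def n_def)
        finally show ?thesis by simp
      qed
      finally show ?thesis by (simp add: C2_def algebra_simps)
    qed
    have ux': "u x' r = (\<Sum>s<d. Q r s * of_real (\<Sum>t<d. K s t * w x t)) + (\<Sum>s<d. Q r s * of_real (\<rho> s))" for r
      unfolding u_def \<rho>_def by (simp add: sum.distrib[symmetric] distrib_left[symmetric] del: of_real_sum of_real_mult)
    have "Re (\<Sum>r<d. cnj (u x r) * u x' r) = Re (\<Sum>r<d. cnj (u x r) * (\<Sum>s<d. Q r s * of_real (\<Sum>t<d. K s t * w x t)))
       + Re (\<Sum>r<d. cnj (u x r) * (\<Sum>s<d. Q r s * of_real (\<rho> s)))"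
      unfolding ux' distrib_left sum.distrib by (rule plus_complex.sel(1))
    also have "\<dots> \<le> - \<mu> * V x + Re (\<Sum>r<d. cnj (u x r) * (\<Sum>s<d. Q r s * of_real (\<rho> s)))"
      using decay[of x] by (rule add_right_mono)
    also have "Re (\<Sum>r<d. cnj (u x r) * (\<Sum>s<d. Q r s * of_real (\<rho> s))) \<le> (\<Sum>r<d. (q * n) * (q * (C2 * n^2)))"
    proof (rule order.trans[OF complex_Re_le_cmod], rule order.trans[OF norm_sum], rule sum_mono)
      fix r assume "r \<in> {..<d}"
      then have r: "r < d" by simp
      have "cmod (\<Sum>s<d. Q r s * of_real (\<rho> s)) \<le> q * (C2 * n^2)"
        by (rule Qbound[OF r]) (use C20 \<rho> in auto)
      then show "cmod (cnj (u x r) * (\<Sum>s<d. Q r s * of_real (\<rho> s))) \<le> (q * n) * (q * (C2 * n^2))"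
        unfolding norm_mult complex_mod_cnj using un[OF r, of x] q0 n0 by (intro mult_mono) (auto simp: n_def)
    qed
    also have "(\<Sum>r<d. (q * n) * (q * (C2 * n^2))) = (real d * q^2 * C2 * n) * n^2" by (simp add: power2_eq_square)
    also have "\<dots> \<le> (real d * q^2 * C2 * n) * (c * V x)" using n2 C20 n0 by (intro mult_left_mono) auto
    also have "\<dots> = (n * L) * V x / 2" by (simp add: L_def)
    also have "\<dots> \<le> \<mu> * V x / 2"
    proof -
      have "n * L \<le> \<mu>" using nR(3) n0 by (simp add: distrib_left)
      then show ?thesis using V0[of x] by (intro divide_right_mono mult_right_mono) auto
    qed
    finally have "2 * Re (\<Sum>r<d. cnj (u x r) * u x' r) \<le> - \<mu> * V x" by simp
    then show ?thesis using n2 by (simp add: n_def)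
  qed
  have "c' > 0" by (simp add: c'_def add_nonneg_pos)
  then show ?thesis
    using \<mu>0 R0 c0 upper main unfolding V_def u_def cform_def cform_deriv_def
    by (intro exI[of _ Q], rule_tac exI[of _ \<mu>], rule_tac exI[of _ R], rule_tac exI[of _ c], rule_tac exI[of _ c']) blast
qed

section \<open>Exponential stability\<close>

text \<open>Minus the closed-loop velocity: taking the cross product with the unit vector
  \<open>G i\<close> twice is minus the projection orthogonal to \<open>G i\<close>.\<close>

definition control :: "(nat \<Rightarrow> nat \<Rightarrow> bool) \<Rightarrow> (nat \<Rightarrow> real^3) \<Rightarrow> nat \<Rightarrow> real^3" where
  "control E G i = (\<Sum>k\<in>nbrs E i. exp (2 * (G i \<bullet> G k)) *\<^sub>R (G k - (G i \<bullet> G k) *\<^sub>R G i))"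

lemma hat_control:
  assumes unit: "\<And>i. i \<in> {1..N} \<Longrightarrow> norm (G i) = 1" and E: "nbrs E i \<subseteq> {1..N}" and i: "i \<in> {1..N}"
  shows "hat (G i) *v (\<Sum>j\<in>nbrs E i. exp (2 * cos (arccos (G i \<bullet> G j))) *\<^sub>R (hat (G i) *v G j)) = - control E G i"
proof -
  have ii: "G i \<bullet> G i = 1" using unit[OF i] by (simp add: norm_eq_1)
  have lin: "linear (cross3 (G i))" by (rule linearI) (simp_all add: cross3_add_scaleR)
  have "cross3 (G i) (\<Sum>j\<in>nbrs E i. exp (2 * cos (arccos (G i \<bullet> G j))) *\<^sub>R cross3 (G i) (G j)) =
    (\<Sum>j\<in>nbrs E i. exp (2 * cos (arccos (G i \<bullet> G j))) *\<^sub>R cross3 (G i) (cross3 (G i) (G j)))"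
    by (simp add: linear_sum[OF lin] linear_scale[OF lin])
  also have "\<dots> = (\<Sum>j\<in>nbrs E i. - (exp (2 * (G i \<bullet> G j)) *\<^sub>R (G j - (G i \<bullet> G j) *\<^sub>R G i)))"
  proof (rule sum.cong[OF refl])
    fix j assume "j \<in> nbrs E i"
    then have "norm (G j) = 1" by (intro unit subsetD[OF E])
    then have "\<bar>G i \<bullet> G j\<bar> \<le> 1" using Cauchy_Schwarz_ineq2[of "G i" "G j"] unit[OF i] by simp
    then have "cos (arccos (G i \<bullet> G j)) = G i \<bullet> G j" by (intro cos_arccos_abs)
    then show "exp (2 * cos (arccos (G i \<bullet> G j))) *\<^sub>R cross3 (G i) (cross3 (G i) (G j)) =
      - (exp (2 * (G i \<bullet> G j)) *\<^sub>R (G j - (G i \<bullet> G j) *\<^sub>R G i))"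
      by (simp add: cross3_twice ii algebra_simps)
  qed
  finally show ?thesis by (simp add: hat_mult_vector control_def sum_negf)
qed

lemma fs_xi_of:
  assumes unit: "\<And>i. i \<in> {1..N} \<Longrightarrow> norm (G i) = 1" and E: "\<And>i. nbrs E i \<subseteq> {1..N}" and a: "a \<in> pairs N"
  shows "fs N E (xi_of N G) a = - (control E G (snd a) \<bullet> G (fst a)) - control E G (fst a) \<bullet> G (snd a)"
proof -
  have half: "(\<Sum>k\<in>nbrs E j. exp (2 * xx (xi_of N G) j k) * (xx (xi_of N G) i j * xx (xi_of N G) j k - xx (xi_of N G) i k))
    = - (control E G j \<bullet> G i)" if ij: "i \<in> {1..N}" "j \<in> {1..N}" for i j
    unfolding control_def inner_sum_left sum_negf[symmetric]
  proof (rule sum.cong[OF refl])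
    fix k assume "k \<in> nbrs E j"
    then have k: "k \<in> {1..N}" by (rule subsetD[OF E])
    show "exp (2 * xx (xi_of N G) j k) * (xx (xi_of N G) i j * xx (xi_of N G) j k - xx (xi_of N G) i k)
      = - (exp (2 * (G j \<bullet> G k)) *\<^sub>R (G k - (G j \<bullet> G k) *\<^sub>R G j) \<bullet> G i)"
      unfolding xx_xi_of[of j N k G, OF ij(2) k unit[OF ij(2)]] xx_xi_of[of i N k G, OF ij(1) k unit[OF ij(1)]]
        xx_xi_of[of i N j G, OF ij unit[OF ij(1)]]
      by (simp add: inner_diff_left inner_commute[of "G i"] algebra_simps)
  qed
  have "fst a \<in> {1..N}" "snd a \<in> {1..N}" using a unfolding pairs_def by auto
  then show ?thesis unfolding fs_alt using a by (simp add: half)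
qed

lemma closed_loop_xi_DERIV:
  assumes sol: "closed_loop_solution N E G" and E: "\<And>i. nbrs E i \<subseteq> {1..N}" and a: "a \<in> pairs N" and t: "0 \<le> t"
  shows "((\<lambda>s. xi_of N (G s) a) has_real_derivative fs N E (xi_of N (G t)) a) (at t within {0..})"
proof -
  have unit: "norm (G t i) = 1" if "i \<in> {1..N}" for i
    using sol t that unfolding closed_loop_solution_def by blast
  have der: "((\<lambda>s. G s i) has_vector_derivative - control E (G t) i) (at t within {0..})" if i: "i \<in> {1..N}" for i
  proof -
    have "hat (G t i) *v (\<Sum>j\<in>nbrs E i. exp (2 * cos (arccos (G t i \<bullet> G t j))) *\<^sub>R (hat (G t i) *v G t j)) = - control E (G t) i"
      by (rule hat_control[OF unit E i])
    moreover have "((\<lambda>s. G s i) has_vector_derivative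
      hat (G t i) *v (\<Sum>j\<in>nbrs E i. exp (2 * cos (arccos (G t i \<bullet> G t j))) *\<^sub>R (hat (G t i) *v G t j))) (at t within {0..})"
      using sol t i unfolding closed_loop_solution_def by blast
    ultimately show ?thesis by (simp only:)
  qed
  have ij: "fst a \<in> {1..N}" "snd a \<in> {1..N}" using a unfolding pairs_def by auto
  have "((\<lambda>s. G s (fst a) \<bullet> G s (snd a)) has_vector_derivative
      G t (fst a) \<bullet> (- control E (G t) (snd a)) + (- control E (G t) (fst a)) \<bullet> G t (snd a)) (at t within {0..})"
    by (rule bounded_bilinear.has_vector_derivative[OF bounded_bilinear_inner der[OF ij(1)] der[OF ij(2)]])
  moreover have "fs N E (xi_of N (G t)) a = - (control E (G t) (snd a) \<bullet> G t (fst a)) - control E (G t) (fst a) \<bullet> G t (snd a)"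
    by (rule fs_xi_of[OF unit E a])
  moreover have "(\<lambda>s. xi_of N (G s) a) = (\<lambda>s. G s (fst a) \<bullet> G s (snd a))" using a by (simp add: xi_of_def)
  ultimately show ?thesis
    unfolding has_real_derivative_iff_has_vector_derivative by (simp add: inner_commute)
qed

text \<open>Squared moduli are split into squares of real and imaginary parts, so that only real
  derivatives of finite sums occur.\<close>

lemma cform_DERIV:
  fixes Q :: "nat \<Rightarrow> nat \<Rightarrow> complex" and h :: "real \<Rightarrow> nat \<Rightarrow> real"
  assumes h: "\<And>s. s < d \<Longrightarrow> ((\<lambda>t. h t s) has_real_derivative h' s) (at t within S)"
  shows "((\<lambda>t. cform d Q (h t)) has_real_derivative cform_deriv d Q (h t) h') (at t within S)"
proof -
  have re: "Re (\<Sum>s<d. Q r s * complex_of_real (g s)) = (\<Sum>s<d. Re (Q r s) * g s)"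
    and im: "Im (\<Sum>s<d. Q r s * complex_of_real (g s)) = (\<Sum>s<d. Im (Q r s) * g s)" for r g by simp_all
  have D: "((\<lambda>t. \<Sum>s<d. c s * h t s) has_real_derivative (\<Sum>s<d. c s * h' s)) (at t within S)" for c :: "nat \<Rightarrow> real"
    by (intro DERIV_sum DERIV_cmult h) simp
  have "((\<lambda>t. (\<Sum>s<d. c s * h t s)^2) has_real_derivative 2 * ((\<Sum>s<d. c s * h t s) * (\<Sum>s<d. c s * h' s))) (at t within S)" for c :: "nat \<Rightarrow> real"
    unfolding power2_eq_square by (rule DERIV_cong[OF DERIV_mult[OF D D]]) (simp only: mult.commute mult_2)
  then have "((\<lambda>t. \<Sum>r<d. (\<Sum>s<d. Re (Q r s) * h t s)^2 + (\<Sum>s<d. Im (Q r s) * h t s)^2) has_real_derivative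
    (\<Sum>r<d. 2 * ((\<Sum>s<d. Re (Q r s) * h t s) * (\<Sum>s<d. Re (Q r s) * h' s)) +
      2 * ((\<Sum>s<d. Im (Q r s) * h t s) * (\<Sum>s<d. Im (Q r s) * h' s)))) (at t within S)"
    by (intro DERIV_sum DERIV_add)
  moreover have "2 * Re (\<Sum>r<d. cnj (\<Sum>s<d. Q r s * h t s) * (\<Sum>s<d. Q r s * h' s)) =
    (\<Sum>r<d. 2 * ((\<Sum>s<d. Re (Q r s) * h t s) * (\<Sum>s<d. Re (Q r s) * h' s)) +
      2 * ((\<Sum>s<d. Im (Q r s) * h t s) * (\<Sum>s<d. Im (Q r s) * h' s)))" (is "?l = ?r")
  proof -
    have rr: "Re (z * complex_of_real y) = Re z * y" for z y by simp
    have cz: "Re (cnj z * z') = Re z * Re z' + Im z * Im z'" for z z' by simp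
    have "?l = 2 * (\<Sum>r<d. (\<Sum>s<d. Re (Q r s) * h t s) * (\<Sum>s<d. Re (Q r s) * h' s) +
      (\<Sum>s<d. Im (Q r s) * h t s) * (\<Sum>s<d. Im (Q r s) * h' s))"
      by (simp only: Re_sum cz re im rr)
    also have "\<dots> = (\<Sum>r<d. 2 * ((\<Sum>s<d. Re (Q r s) * h t s) * (\<Sum>s<d. Re (Q r s) * h' s) +
      (\<Sum>s<d. Im (Q r s) * h t s) * (\<Sum>s<d. Im (Q r s) * h' s)))" by (rule sum_distrib_left)
    also have "\<dots> = ?r" by (simp only: distrib_left)
    finally show ?thesis .
  qed
  ultimately show ?thesis unfolding cform_def cform_deriv_def cmod_power2 re im by simp
qed

lemma regular_polyhedron_span:
  assumes "regular_polyhedron_vertices p q N \<Gamma>"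
  shows "span (\<Gamma> ` {1..N}) = UNIV"
proof -
  let ?V = "\<Gamma> ` {1..N}"
  have "aff_dim (convex hull ?V) = 3" using assms by (simp add: regular_polyhedron_vertices_def Let_def)
  then have "3 = aff_dim ?V" by (simp add: aff_dim_convex_hull)
  also have "\<dots> \<le> aff_dim (span ?V)" by (intro aff_dim_subset span_superset)
  also have "\<dots> = int (dim ?V)" by (simp add: aff_dim_subspace)
  finally have "3 \<le> dim ?V" by simp
  moreover have "dim ?V \<le> DIM(real^3)" by (rule dim_subset_UNIV)
  ultimately have "dim ?V = DIM(real^3)" by simp
  then show ?thesis by (simp only: dim_eq_full)
qed

theorem theorem4:
  fixes p q :: nat
    and \<Gamma> :: "nat \<Rightarrow> real^3"
    and E :: "nat \<Rightarrow> nat \<Rightarrow> bool"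
    and m :: nat
    and C :: "nat \<Rightarrow> nat set"
  assumes pq: "p \<ge> 3" "q \<ge> 3" "1 / real p + 1 / real q > 1 / 2"
    and poly: "regular_polyhedron_vertices p q (N0 p q) \<Gamma>"
    and graph: "undirected_connected_graph {1..N0 p q} E"
    and aut: "\<forall>i\<in>{1..N0 p q}. graph_automorphism {1..N0 p q} E (sigma q (N0 p q) \<Gamma> i)"
    and C4: "\<forall>r<m. C r \<subseteq> {1..N0 p q} \<and> card (C r) = 4"
    and full_row_rank:
      "\<forall>c::nat \<Rightarrow> real.
         (\<forall>b\<in>pairs (N0 p q). (\<Sum>r<m. c r * pderiv_xi (gC (C r)) (xi_of (N0 p q) \<Gamma>) b) = 0)
         \<longrightarrow> (\<forall>r<m. c r = 0)"
    and hurw: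
      "\<exists>W d T.
         max_invariant_subspace (N0 p q) (jacobian_fs (N0 p q) E (xi_of (N0 p q) \<Gamma>))
           {x \<in> xi_space (N0 p q). \<forall>r<m.
              (\<Sum>b\<in>pairs (N0 p q). pderiv_xi (gC (C r)) (xi_of (N0 p q) \<Gamma>) b * x b) = 0}
           W \<and>
         orthonormal_basis_rows (N0 p q) d T W \<and>
         hurwitz d (sandwich (N0 p q) T (jacobian_fs (N0 p q) E (xi_of (N0 p q) \<Gamma>)))"
  shows "\<exists>\<epsilon>>0. \<forall>G. closed_loop_solution (N0 p q) E G \<and>
            xnorm (N0 p q) (\<lambda>a. xi_of (N0 p q) (G 0) a - xi_of (N0 p q) \<Gamma> a) < \<epsilon> \<longrightarrow>
            (\<exists>\<alpha>>0. \<exists>\<beta>>0. \<forall>t\<ge>0.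
               xnorm (N0 p q) (\<lambda>a. xi_of (N0 p q) (G t) a - xi_of (N0 p q) \<Gamma> a) \<le> \<alpha> * exp (- \<beta> * t))"
proof -
  let ?N = "N0 p q"
  let ?x0 = "xi_of ?N \<Gamma>"
  let ?A = "jacobian_fs ?N E ?x0"
  have unit: "norm (\<Gamma> i) = 1" if "i \<in> {1..?N}" for i
    using poly that unfolding regular_polyhedron_vertices_def by blast
  have E: "\<And>j k. E j k \<Longrightarrow> j \<in> {1..?N} \<and> k \<in> {1..?N}"
    using graph unfolding undirected_connected_graph_def by blast
  then have nbrs: "nbrs E i \<subseteq> {1..?N}" for i unfolding nbrs_def by blast
  have equi: "(\<Sum>k\<in>nbrs E i. exp (2 * (\<Gamma> i \<bullet> \<Gamma> k)) *\<^sub>R (\<Gamma> k - (\<Gamma> i \<bullet> \<Gamma> k) *\<^sub>R \<Gamma> i)) = 0" if "i \<in> {1..?N}" for i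
    by (rule formation_equilibrium[OF poly pq(1,2) that E bspec[OF aut that]])
  have fs0: "fs ?N E ?x0 a = 0" for a
  proof (cases "a \<in> pairs ?N")
    case True
    then have "fst a \<in> {1..?N}" "snd a \<in> {1..?N}" unfolding pairs_def by auto
    then have "control E \<Gamma> (fst a) = 0" "control E \<Gamma> (snd a) = 0" unfolding control_def by (simp_all only: equi)
    moreover have "fs ?N E ?x0 a = - (control E \<Gamma> (snd a) \<bullet> \<Gamma> (fst a)) - control E \<Gamma> (fst a) \<bullet> \<Gamma> (snd a)"
      by (rule fs_xi_of[OF unit nbrs True])
    ultimately show ?thesis by simp
  qed (simp add: fs_alt)
  from hurw obtain W d T where
    W: "max_invariant_subspace ?N ?A {x \<in> xi_space ?N. \<forall>r<m. (\<Sum>b\<in>pairs ?N. pderiv_xi (gC (C r)) ?x0 b * x b) = 0} W"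
    and T: "orthonormal_basis_rows ?N d T W" and hur: "hurwitz d (sandwich ?N T ?A)" by (elim exE conjE)
  have "\<exists>C\<ge>0. \<exists>r>0. \<forall>G. (\<forall>i\<in>{1..?N}. norm (G i) = 1) \<longrightarrow> xnorm ?N (gram_dev ?N \<Gamma> G) \<le> r \<longrightarrow>
      (\<exists>v. (\<forall>i\<in>{1..?N}. v i \<bullet> \<Gamma> i = 0) \<and>
      xnorm ?N (\<lambda>a. gram_dev ?N \<Gamma> G a - gram_deriv ?N \<Gamma> v a) \<le> C * (xnorm ?N (gram_dev ?N \<Gamma> G))^2)"
    by (rule gram_tangent_approx[OF unit regular_polyhedron_span[OF poly]])
  then obtain C1 r1 where C1: "C1 \<ge> 0" and r1: "r1 > 0"
    and tang: "\<forall>G. (\<forall>i\<in>{1..?N}. norm (G i) = 1) \<longrightarrow> xnorm ?N (gram_dev ?N \<Gamma> G) \<le> r1 \<longrightarrow>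
      (\<exists>v. (\<forall>i\<in>{1..?N}. v i \<bullet> \<Gamma> i = 0) \<and>
      xnorm ?N (\<lambda>a. gram_dev ?N \<Gamma> G a - gram_deriv ?N \<Gamma> v a) \<le> C1 * (xnorm ?N (gram_dev ?N \<Gamma> G))^2)"
    by (elim exE conjE)
  have "finite (nbrs E i)" for i using finite_subset[OF nbrs] by blast
  from fs_quadratic_remainder[of E ?N ?x0, OF this] obtain C0 where C0: "C0 \<ge> 0"
    and rem: "\<forall>y\<in>xi_space ?N. xnorm ?N y \<le> 1 \<longrightarrow>
      (\<forall>a. \<bar>fs ?N E (\<lambda>a. ?x0 a + y a) a - fs ?N E ?x0 a - dfs ?N E ?x0 y a\<bar> \<le> C0 * (xnorm ?N y)^2)"
    by (elim exE conjE)
  define w where "w = (\<lambda>x r. \<Sum>a\<in>pairs ?N. T r a * x a)"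
  from reduced_lyapunov[OF T hur C0 C1 w_def] obtain Q \<mu> R c c' where pos: "\<mu> > 0" "R > 0" "c > 0" "c' > 0"
    and upper: "\<forall>x. cform d Q (w x) \<le> c' * (xnorm ?N x)^2"
    and lyap: "\<forall>x y x'. y \<in> W \<longrightarrow> xnorm ?N x \<le> R \<longrightarrow> xnorm ?N (\<lambda>a. x a - y a) \<le> C1 * (xnorm ?N x)^2 \<longrightarrow>
       (\<forall>a\<in>pairs ?N. \<bar>x' a - mat_app ?N ?A x a\<bar> \<le> C0 * (xnorm ?N x)^2) \<longrightarrow>
       (xnorm ?N x)^2 \<le> c * cform d Q (w x) \<and> cform_deriv d Q (w x) (w x') \<le> - \<mu> * cform d Q (w x)"
    by (elim exE conjE)
  \<comment> \<open>Inside this radius the Lyapunov inequalities, the tangent approximation and the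
    Taylor estimate are all available.\<close>
  define R' where "R' = min R (min r1 1)"
  have R': "R' > 0" "R' \<le> R" "R' \<le> r1" "R' \<le> 1" using pos r1 by (simp_all add: R'_def)
  \<comment> \<open>The initial radius \<open>R' / D\<close> serves two purposes:
    \<open>D \<ge> 1\<close> gives \<open>n 0 < R'\<close>, and \<open>c * c' \<le> D^2\<close>
    gives \<open>c * V 0 < R'^2\<close>.\<close>
  define D where "D = 1 + c * c'"
  have D: "D \<ge> 1" using pos by (simp add: D_def)
  show ?thesis
  proof (rule exI[of _ "R' / D"], intro conjI allI impI, goal_cases)
    case 1
    then show ?case using R' D by simp
  next
    case (2 G)
    then have sol: "closed_loop_solution ?N E G" by blast
    define x where "x t = gram_dev ?N \<Gamma> (G t)" for t
    have x_eq: "x t = (\<lambda>a. xi_of ?N (G t) a - ?x0 a)" for t by (simp add: x_def gram_dev_def fun_eq_iff)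
    define x' where "x' t = fs ?N E (xi_of ?N (G t))" for t
    define n where "n t = xnorm ?N (x t)" for t
    define V where "V t = cform d Q (w (x t))" for t
    define V' where "V' t = cform_deriv d Q (w (x t)) (w (x' t))" for t
    have xs: "x t \<in> xi_space ?N" for t by (simp add: x_eq xi_space_def xi_of_def)
    have dx: "((\<lambda>s. x s a) has_real_derivative x' t a) (at t within {0..})" if "a \<in> pairs ?N" "0 \<le> t" for a t
      unfolding x_eq x'_def using DERIV_diff[OF closed_loop_xi_DERIV[OF sol nbrs that] DERIV_const] by simp
    have cont: "continuous_on {0..} n"
    proof -
      have "continuous_on {0..} (\<lambda>t. x t a)" if "a \<in> pairs ?N" for a
        unfolding continuous_on_eq_continuous_within using dx[OF that] DERIV_continuous by fastforce
      then show ?thesis unfolding n_def xnorm_def by (intro continuous_intros)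
    qed
    have dV: "(V has_real_derivative V' t) (at t within {0..})" if "0 \<le> t" for t
      unfolding V_def V'_def
    proof (rule cform_DERIV)
      fix s
      show "((\<lambda>t. w (x t) s) has_real_derivative w (x' t) s) (at t within {0..})"
        unfolding w_def by (intro DERIV_sum DERIV_cmult dx that)
    qed
    \<comment> \<open>The element of \<open>W\<close> close to \<open>x t\<close> is the first
      variation given by the tangent approximation. It depends on \<open>t\<close> and need not do
      so continuously, since it only enters a pointwise estimate.\<close>
    have key: "(n t)^2 \<le> c * V t \<and> V' t \<le> - \<mu> * V t" if t: "0 \<le> t" and nt: "n t \<le> R'" for t
    proof -
      have "\<forall>i\<in>{1..?N}. norm (G t i) = 1" using sol t unfolding closed_loop_solution_def by blast
      moreover have "xnorm ?N (gram_dev ?N \<Gamma> (G t)) \<le> r1" using nt R'(3) by (simp add: n_def x_def)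
      ultimately obtain v where v: "\<forall>i\<in>{1..?N}. v i \<bullet> \<Gamma> i = 0"
        "xnorm ?N (\<lambda>a. gram_dev ?N \<Gamma> (G t) a - gram_deriv ?N \<Gamma> v a) \<le> C1 * (xnorm ?N (gram_dev ?N \<Gamma> (G t)))^2"
        using tang by blast
      have yW: "gram_deriv ?N \<Gamma> v \<in> W"
        by (rule gram_deriv_subset_max_invariant[OF unit nbrs equi C4[rule_format] W bspec[OF v(1)]])
      have "\<bar>x' t a - mat_app ?N ?A (x t) a\<bar> \<le> C0 * (xnorm ?N (x t))^2" for a
      proof -
        have "xnorm ?N (x t) \<le> 1" using nt R'(4) by (simp add: n_def)
        then have "\<bar>fs ?N E (\<lambda>a. ?x0 a + x t a) a - fs ?N E ?x0 a - dfs ?N E ?x0 (x t) a\<bar> \<le> C0 * (xnorm ?N (x t))^2"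
          using rem xs by blast
        moreover have "(\<lambda>a. ?x0 a + x t a) = xi_of ?N (G t)" by (simp add: x_eq)
        ultimately show ?thesis unfolding mat_app_jacobian[OF xs] fs0 by (simp add: x'_def)
      qed
      moreover have "xnorm ?N (x t) \<le> R" using nt R'(2) by (simp add: n_def)
      moreover have "xnorm ?N (\<lambda>a. x t a - gram_deriv ?N \<Gamma> v a) \<le> C1 * (xnorm ?N (x t))^2"
        using v(2) by (simp add: x_def)
      ultimately show ?thesis using lyap yW unfolding n_def V_def V'_def by blast
    qed
    have n0D: "n 0 * D < R'" using 2 D by (simp add: n_def x_eq pos_less_divide_eq)
    have n0: "0 \<le> n t" for t by (simp add: n_def)
    have start: "n 0 < R'"
    proof -
      have "n 0 * 1 \<le> n 0 * D" using D n0 by (intro mult_left_mono)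
      then show ?thesis using n0D by simp
    qed
    have V0: "0 \<le> V 0" by (simp add: V_def cform_def sum_nonneg)
    have "c * V 0 \<le> c * (c' * (n 0)^2)" using upper pos by (simp add: V_def n_def)
    also have "\<dots> \<le> D^2 * (n 0)^2"
    proof -
      have "c * c' \<le> D" by (simp add: D_def)
      also have "D \<le> D^2" using D by (simp add: power2_eq_square)
      finally show ?thesis unfolding mult.assoc[symmetric] by (rule mult_right_mono) simp
    qed
    also have "\<dots> = (n 0 * D)^2" by (simp add: power_mult_distrib)
    also have "\<dots> < R'^2" using n0D n0 D by (intro power_strict_mono) auto
    finally have start2: "c * V 0 < R'^2" .
    have decay: "(n t)^2 \<le> c * V 0 * exp (- \<mu> * t)" if "0 \<le> t" for t
      by (rule lyapunov_exponential_decay[OF n0 cont dV pos(3) R'(1) conjunct1[OF key] conjunct2[OF key] pos(1) start start2 that])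
    show ?case
    \<comment> \<open>The summand 1 keeps the factor positive when \<open>V 0 = 0\<close>. The rate
      is \<open>\<mu> / 2\<close> because the decay was obtained for the square of
      \<open>n\<close>.\<close>
    proof (rule exI[of _ "sqrt (c * V 0) + 1"], rule conjI, goal_cases)
      case 1
      have "0 \<le> c * V 0" using pos V0 by simp
      then show ?case by (simp add: add_nonneg_pos)
    next
      case 2
      show ?case
      proof (rule exI[of _ "\<mu> / 2"], intro conjI allI impI)
        show "\<mu> / 2 > 0" using pos by simp
        fix t :: real assume t: "0 \<le> t"
        have "n t \<le> sqrt (c * V 0 * exp (- \<mu> * t))" using decay[OF t] by (rule real_le_rsqrt)
        also have "\<dots> = sqrt (c * V 0) * sqrt (exp (- \<mu> * t))" by (rule real_sqrt_mult)
        also have "sqrt (exp (- \<mu> * t)) = exp (- (\<mu> / 2) * t)"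
          by (rule real_sqrt_unique) (simp_all add: exp_double[symmetric])
        also have "sqrt (c * V 0) * exp (- (\<mu> / 2) * t) \<le> (sqrt (c * V 0) + 1) * exp (- (\<mu> / 2) * t)"
          by (intro mult_right_mono) auto
        finally show "xnorm ?N (\<lambda>a. xi_of ?N (G t) a - ?x0 a) \<le> (sqrt (c * V 0) + 1) * exp (- (\<mu> / 2) * t)"
          by (simp add: n_def x_eq)
      qed
    qed
  qed
qed

end
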